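(* Let $n\ge 3$ be an integer and let $\frac{2(n-1)}{2n-3}<d\le 2(n-1)$ be a real number. For any approximation function $\psi$, any $s>\frac{n-1}{2}$ and any $\mathscr{M}\in\mathscr{G}(\mathscr{H}_d^{\mathbf 0}(\mathbb{R}^{n-1}))$ we have $$\mathcal{H}^s(\mathscr{S}_n(\psi)\cap\mathscr{M})=0\quad\text{if}\quad\sum_{q\ge 1}\Big(\frac{\psi(q)}{q}\Big)^{s+1}q^n<\infty.$$
   Context: An approximation function is a non-increasing function $\psi:\mathbb{Z}_{\ge 1}\to(0,1/2)$. $\mathscr{S}_n(\psi)$ is the set of simultaneously $\psi$-approximable vectors: all $\mathbf{x}=(x_1,\dots,x_n)\in\mathbb{R}^n$ such that $\max_{1\le i\le n}\lVert q x_i\rVert<\psi(q)$ for infinitely many integers $q\ge 1$, where $\lVert x\rVert=\min_{z\in\mathbb{Z}}|x-z|$. $\mathcal{H}^s$ is the Hausdorff $s$-measure on $\mathbb{R}^n$. $\mathscr{H}_d^{\mathbf 0}(\mathbb{R}^{n-1})$ is the set of functions $f:\mathbb{R}^{n-1}\to\mathbb{R}$ with $f(\lambda\mathbf{x})=\lambda^d f(\mathbf{x})$ for all $\mathbf{x}$ and all $\lambda\ge 0$, that are smooth on $\mathbb{R}^{n-1}\setminus\{\mathbf 0\}$ and have Hessian determinant $\det H_f(\mathbf{x})\ne 0$ for all $\mathbf{x}\ne\mathbf 0$. $\mathscr{G}(\mathscr{H}_d^{\mathbf 0}(\mathbb{R}^{n-1}))$ is the set of hypersurfaces $\mathscr{M}\subset\mathbb{R}^n$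 of the form $\mathscr{M}=\{(\mathbf{x},f(\mathbf{x})):\mathbf{x}\in\mathbb{R}^{n-1},\ \lVert\mathbf{x}\rVert_2<1\}$ with $f\in\mathscr{H}_d^{\mathbf 0}(\mathbb{R}^{n-1})$. *)

theory Defs
  imports "HOL-Analysis.Analysis"
begin

text \<open>
  The ambient space is \<open>(real^'m) \<times> real\<close>, a Euclidean space with the usual Euclidean distance;
  with \<open>CARD('m) = n - 1\<close> it plays the role of \<open>n\<close>-dimensional space, split into the first
  \<open>n - 1\<close> coordinates and the last one, as in the description of a hypersurface as a graph.
\<close>

subsection \<open>Simultaneously approximable points\<close>

text \<open>The value at \<open>0\<close> is never used; functions on the positive integers are modelled on \<open>nat\<close>.\<close>

definition approximation_function :: "(nat \<Rightarrow> real) \<Rightarrow> bool" where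
  "approximation_function \<psi> \<longleftrightarrow>
     (\<forall>q\<ge>1. 0 < \<psi> q \<and> \<psi> q < 1/2) \<and> (\<forall>q r. 1 \<le> q \<longrightarrow> q \<le> r \<longrightarrow> \<psi> r \<le> \<psi> q)"

text \<open>
  \<open>infdist t \<int>\<close> is the distance from \<open>t\<close> to the nearest integer, and the numbers \<open>x \<bullet> b\<close> for
  \<open>b \<in> Basis\<close> are the standard coordinates of \<open>x\<close>.
\<close>

definition simult_approx :: "(nat \<Rightarrow> real) \<Rightarrow> 'a::euclidean_space set" where
  "simult_approx \<psi> =
     {x. infinite {q::nat. 1 \<le> q \<and> Max ((\<lambda>b. infdist (real q * (x \<bullet> b)) \<int>) ` Basis) < \<psi> q}}"

subsection \<open>Hausdorff measure\<close>

text \<open>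
  The contribution \<open>(diam U) ^ s\<close> of a covering set, with the conventions \<open>(diam {}) ^ 0 = 0\<close>
  and \<open>(diam U) ^ 0 = 1\<close> for nonempty \<open>U\<close> (whereas \<open>0 powr 0 = 0\<close>).
\<close>

definition hausdorff_gauge :: "real \<Rightarrow> 'a::metric_space set \<Rightarrow> ennreal" where
  "hausdorff_gauge s U =
     (if U = {} then 0 else if s = 0 then 1 else ennreal (diameter U powr s))"

text \<open>Boundedness is required because \<open>diameter\<close> is a junk value on unbounded sets.\<close>

definition hausdorff_premeasure :: "real \<Rightarrow> real \<Rightarrow> 'a::metric_space set \<Rightarrow> ennreal" where
  "hausdorff_premeasure \<delta> s A =
     (INF U \<in> {U :: nat \<Rightarrow> 'a set. (\<forall>i. bounded (U i) \<and> diameter (U i) \<le> \<delta>) \<and> A \<subseteq> (\<Union>i. U i)}.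
        \<Sum>i. hausdorff_gauge s (U i))"

text \<open>The premeasure grows as \<open>\<delta>\<close> decreases, so the limit for \<open>\<delta>\<close> tending to \<open>0\<close> is a supremum.\<close>

definition hausdorff_measure :: "real \<Rightarrow> 'a::metric_space set \<Rightarrow> ennreal" where
  "hausdorff_measure s A = (SUP \<delta>\<in>{0<..}. hausdorff_premeasure \<delta> s A)"

subsection \<open>Homogeneous functions with non-vanishing Hessian\<close>

definition partial_deriv :: "'m \<Rightarrow> (real^'m \<Rightarrow> real) \<Rightarrow> real^'m \<Rightarrow> real" where
  "partial_deriv i f x = frechet_derivative f (at x) (axis i 1)"

text \<open>\<open>C_k_on k S f\<close> is meant for open \<open>S\<close>: \<open>f\<close> is \<open>k\<close> times continuously differentiable on \<open>S\<close>.\<close>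

primrec C_k_on :: "nat \<Rightarrow> (real^'m) set \<Rightarrow> (real^'m \<Rightarrow> real) \<Rightarrow> bool" where
  "C_k_on 0 S f \<longleftrightarrow> continuous_on S f"
| "C_k_on (Suc k) S f \<longleftrightarrow>
     (\<forall>x\<in>S. f differentiable (at x)) \<and> (\<forall>i. C_k_on k S (partial_deriv i f))"

definition smooth_on :: "(real^'m) set \<Rightarrow> (real^'m \<Rightarrow> real) \<Rightarrow> bool" where
  "smooth_on S f \<longleftrightarrow> (\<forall>k. C_k_on k S f)"

definition hessian :: "(real^'m \<Rightarrow> real) \<Rightarrow> real^'m \<Rightarrow> real^'m^'m" where
  "hessian f x = (\<chi> i j. partial_deriv i (partial_deriv j f) x)"

definition homogeneous_nondegenerate :: "real \<Rightarrow> (real^'m \<Rightarrow> real) set" where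
  "homogeneous_nondegenerate d =
     {f. (\<forall>x. \<forall>t\<ge>0. f (t *\<^sub>R x) = t powr d * f x) \<and>
         smooth_on (- {0}) f \<and>
         (\<forall>x. x \<noteq> 0 \<longrightarrow> det (hessian f x) \<noteq> 0)}"

text \<open>The norm of \<open>real^'m\<close> is the Euclidean one.\<close>

definition graph_hypersurfaces :: "(real^'m \<Rightarrow> real) set \<Rightarrow> ((real^'m) \<times> real) set set" where
  "graph_hypersurfaces F = {M. \<exists>f\<in>F. M = {(x, f x) | x. norm x < 1}}"

end

theory Submission
  imports Defs
begin

text \<open>
  The points of the limsup set lie near rational points \<open>(a / q, b / q)\<close> close to the hypersurface,
  so everything rests on counting these up to the expected order of magnitude as soon as the
  distance \<open>D\<close> of \<open>b\<close> from \<open>q * f (a / q)\<close> is at least \<open>q powr (\<epsilon> - 1)\<close>; the hypothesis on \<open>s\<close> allows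
  us to enlarge \<open>\<psi>\<close> to satisfy this.

  The integer points near the cone over the hypersurface are covered by caps, which are essentially
  convex bodies. By a large sieve argument, the number of integer points in a cap is at most a constant times
  its volume times the number of integer points in the polar body; and a non-zero integer point in a
  polar body lies near the cone over the Legendre dual hypersurface, or is vertical. Hence a bound for
  the dual hypersurface with error exponent \<open>\<beta>\<close> yields a bound with error exponent \<open>\<beta> / (1 + \<beta>)\<close>, and
  by iteration any positive exponent is reached, starting from the trivial bound \<open>\<beta> = 1\<close>. The flat or
  singular point at the origin is handled by dyadic shells: on the shell of radius \<open>l\<close> the
  hypersurface is the graph of \<open>\<lambda>x. h * f (x / l)\<close> with \<open>h = l powr d\<close>, its dual corresponds to the scales
  \<open>h / l\<close> and \<open>h\<close>, and the quantity \<open>max (l / sqrt h) (sqrt h / l)\<close> in the estimate is self-dual.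
\<close>

subsection \<open>Integer points in a box and in its polar body\<close>

text \<open>Take l = h = 1 and m = \<open>CARD('m)\<close>. Caps have radius \<rho> = sqrt (D / Q),
  at which a tangent plane stays within O(D) of the cone, so there are about \<rho>^-m of them, each
  of volume about D (Q \<rho>)^m Q. The zero vector of each polar body yields the main term D
  Q^(m+1). A dual point of height about J lies within O(1 / (Q D J)) of the dual cone; error times
  height is O(1 / (D Q)) = O(1), so there are O(J^(m+\<beta>)) such points, each seen by O((D J)^-m)
  caps. Heights end at J = 1 / D, so their total is O(Q^m D^-\<beta>), using m \<ge> 2 and D Q \<ge>
  1. Equating D Q with D^-\<beta> gives D = Q^(-1/(1+\<beta>)) and the new error
  Q^(\<beta>/(1+\<beta>)). The obstacle is uniformity: the shells produce many pairs (l, h) and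
  duality changes them, so constants must not depend on them. The class 0 < h \<le> l \<le> 1 is
  stable under (l, h) -> (h / l, h). Vertical vectors add a term of order sqrt (D Q), harmless once
  D Q \<ge> 1.\<close>

lemma card_int_interval_le:
  fixes c t :: real
  assumes "t \<ge> 0"
  shows "finite {k::int. \<bar>of_int k - c\<bar> \<le> t}"
    and "real (card {k::int. \<bar>of_int k - c\<bar> \<le> t}) \<le> 2 * t + 1"
proof -
  have eq: "{k::int. \<bar>of_int k - c\<bar> \<le> t} = {\<lceil>c - t\<rceil>..\<lfloor>c + t\<rfloor>}"
    by (auto simp: abs_le_iff le_floor_iff ceiling_le_iff)
  show "finite {k::int. \<bar>of_int k - c\<bar> \<le> t}" unfolding eq by simp
  show "real (card {k::int. \<bar>of_int k - c\<bar> \<le> t}) \<le> 2 * t + 1"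
    unfolding eq using assms by (simp add: of_nat_nat) linarith
qed

lemma card_int_box_le:
  fixes c :: "'m::finite \<Rightarrow> real" and t :: real
  assumes "t \<ge> 0"
  shows "finite {a::'m \<Rightarrow> int. \<forall>i. \<bar>of_int (a i) - c i\<bar> \<le> t}"
    and "real (card {a::'m \<Rightarrow> int. \<forall>i. \<bar>of_int (a i) - c i\<bar> \<le> t}) \<le> (2 * t + 1) ^ CARD('m)"
proof -
  have eq: "{a::'m \<Rightarrow> int. \<forall>i. \<bar>of_int (a i) - c i\<bar> \<le> t}
      = PiE UNIV (\<lambda>i. {k. \<bar>of_int k - c i\<bar> \<le> t})"
    by (auto simp: PiE_def)
  show "finite {a::'m \<Rightarrow> int. \<forall>i. \<bar>of_int (a i) - c i\<bar> \<le> t}"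
    unfolding eq by (intro finite_PiE) (auto intro: card_int_interval_le assms)
  have "real (card {a::'m \<Rightarrow> int. \<forall>i. \<bar>of_int (a i) - c i\<bar> \<le> t})
      = (\<Prod>i\<in>UNIV. real (card {k::int. \<bar>of_int k - c i\<bar> \<le> t}))"
    unfolding eq by (subst card_PiE) auto
  also have "\<dots> \<le> (\<Prod>i\<in>(UNIV::'m set). 2 * t + 1)"
    by (intro prod_mono) (auto intro: card_int_interval_le assms)
  finally show "real (card {a::'m \<Rightarrow> int. \<forall>i. \<bar>of_int (a i) - c i\<bar> \<le> t}) \<le> (2 * t + 1) ^ CARD('m)"
    by simp
qed

section \<open>Exponential sums modulo N and a large sieve inequality\<close>

lemma sum_root_of_unity:
  fixes k :: int and N :: nat
  assumes "N > 0"
  shows "(\<Sum>t\<in>{0..<int N}. cis (2 * pi * of_int (k * t) / N)) = (if int N dvd k then of_nat N else 0)"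
proof -
  define w where "w = cis (2 * pi * of_int k / N)"
  have "(\<Sum>t\<in>{0..<int N}. cis (2 * pi * of_int (k * t) / N)) = (\<Sum>t<N. w ^ t)"
  proof (rule sum.reindex_bij_witness[of _ int nat])
    fix t assume "t \<in> {0..<int N}"
    then show "w ^ nat t = cis (2 * pi * of_int (k * t) / N)"
      by (simp add: w_def Complex.DeMoivre) (simp add: field_simps)
  qed auto
  also have "\<dots> = (if int N dvd k then of_nat N else 0)"
  proof (cases "int N dvd k")
    case True
    then obtain l where "k = int N * l" by auto
    then have "w = cis (2 * pi * of_int l)" using assms by (simp add: w_def mult_ac)
    then have "w = 1" by (simp add: cis_multiple_2pi)
    then show ?thesis using True by simp
  next
    case False
    have "w \<noteq> 1"
    proof
      assume "w = 1"
      then have "cos (2 * pi * of_int k / N) = 1" by (simp add: w_def complex_eq_iff)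
      then obtain n :: int where "2 * pi * of_int k / N = of_int n * (2 * pi)"
        by (auto simp: cos_one_2pi_int)
      then have "real_of_int k = of_int (n * int N)" using assms by (simp add: field_simps)
      then have "k = n * int N" by (simp only: of_int_eq_iff)
      then show False using False by simp
    qed
    moreover have "w ^ N = 1"
    proof -
      have "w ^ N = cis (real N * (2 * pi * of_int k / N))" by (simp add: w_def Complex.DeMoivre)
      also have "real N * (2 * pi * of_int k / N) = 2 * pi * of_int k" using assms by simp
      also have "cis (2 * pi * of_int k) = 1" by (rule cis_multiple_2pi) simp
      finally show ?thesis .
    qed
    ultimately show ?thesis using False by (simp add: sum_gp_strict)
  qed
  finally show ?thesis .
qed

lemma sum_character:
  fixes k :: "'i::finite \<Rightarrow> int" and N :: nat
  assumes "N > 0"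
  shows "(\<Sum>v\<in>PiE UNIV (\<lambda>_. {0..<int N}). cis (2 * pi * of_int (\<Sum>i\<in>UNIV. k i * v i) / N))
     = (if \<forall>i. int N dvd k i then of_nat N ^ CARD('i) else 0)"
proof -
  have cis_sum: "cis (sum h I) = (\<Prod>i\<in>I. cis (h i))" if "finite I" for h and I :: "'i set"
    using that by (induction I rule: finite_induct) (auto simp: cis_mult[symmetric])
  have "(\<Sum>v\<in>PiE UNIV (\<lambda>_. {0..<int N}). cis (2 * pi * of_int (\<Sum>i\<in>UNIV. k i * v i) / N))
     = (\<Sum>v\<in>PiE UNIV (\<lambda>_. {0..<int N}). \<Prod>i\<in>UNIV. cis (2 * pi * of_int (k i * v i) / N))"
    by (simp add: sum_distrib_left sum_divide_distrib cis_sum)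
  also have "\<dots> = (\<Prod>i\<in>(UNIV::'i set). \<Sum>t\<in>{0..<int N}. cis (2 * pi * of_int (k i * t) / N))"
    by (subst prod_sum_PiE) auto
  also have "\<dots> = (\<Prod>i\<in>(UNIV::'i set). if int N dvd k i then of_nat N else 0)"
    by (simp only: sum_root_of_unity[OF assms])
  also have "\<dots> = (if \<forall>i. int N dvd k i then of_nat N ^ CARD('i) else 0)"
    by (auto simp: prod_zero_iff)
  finally show ?thesis .
qed

text \<open>A duality inequality in place of Poisson summation: the exponential sum over \<open>A\<close> is at least
  \<open>card A / 2\<close> on \<open>U\<close>, while its mean square over a full period is \<open>card A\<close>.\<close>

lemma card_dual_le:
  fixes A U :: "('i::finite \<Rightarrow> int) set" and N M :: nat
  assumes N: "N > 0" and fin: "finite A" "finite U"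
    and small: "\<And>z u. z \<in> A \<Longrightarrow> u \<in> U \<Longrightarrow> \<bar>of_int (\<Sum>i\<in>UNIV. z i * u i)\<bar> \<le> real N / 8"
    and inj: "\<And>z z'. z \<in> A \<Longrightarrow> z' \<in> A \<Longrightarrow> (\<forall>i. int N dvd z i - z' i) \<Longrightarrow> z = z'"
    and mult: "\<And>u. u \<in> U \<Longrightarrow> card {u' \<in> U. \<forall>i. int N dvd u' i - u i} \<le> M"
  shows "card A * card U \<le> 4 * M * N ^ CARD('i)"
proof (cases "A = {}")
  case False
  define e where "e = (\<lambda>(z::'i \<Rightarrow> int) (u::'i \<Rightarrow> int). cis (2 * pi * of_int (\<Sum>i\<in>UNIV. z i * u i) / N))"
  define F where "F = (\<lambda>u. \<Sum>z\<in>A. e z u)"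
  define B :: "('i \<Rightarrow> int) set" where "B = PiE UNIV (\<lambda>_. {0..<int N})"
  \<comment> \<open>\<open>F\<close> is periodic modulo N, so U can be folded into the box
    \<open>B\<close>; by \<open>mult\<close>, each residue class is hit at most M times.\<close>
  define red where "red = (\<lambda>(u::'i \<Rightarrow> int) i. u i mod int N)"
  have finB: "finite B" unfolding B_def by (intro finite_PiE) auto
  have e_mult: "e z u * cnj (e z' u) = e (\<lambda>i. z i - z' i) u" for z z' u
    by (simp add: e_def cis_cnj cis_mult flip: diff_divide_distrib)
       (simp add: algebra_simps sum_subtractf)
  have "complex_of_real (\<Sum>v\<in>B. (cmod (F v))\<^sup>2) = (\<Sum>v\<in>B. F v * cnj (F v))"
    by (simp only: of_real_sum complex_norm_square)
  also have "\<dots> = (\<Sum>v\<in>B. \<Sum>z\<in>A. \<Sum>z'\<in>A. e (\<lambda>i. z i - z' i) v)"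
    by (simp add: F_def sum_product e_mult)
  also have "\<dots> = (\<Sum>z\<in>A. \<Sum>v\<in>B. \<Sum>z'\<in>A. e (\<lambda>i. z i - z' i) v)"
    by (rule sum.swap)
  also have "\<dots> = (\<Sum>z\<in>A. \<Sum>z'\<in>A. \<Sum>v\<in>B. e (\<lambda>i. z i - z' i) v)"
    by (intro sum.cong refl sum.swap)
  also have "\<dots> = (\<Sum>z\<in>A. \<Sum>z'\<in>A. if z = z' then of_nat N ^ CARD('i) else 0)"
  proof (intro sum.cong refl)
    fix z z' assume zz: "z \<in> A" "z' \<in> A"
    have "(\<Sum>v\<in>B. e (\<lambda>i. z i - z' i) v) = (if \<forall>i. int N dvd z i - z' i then of_nat N ^ CARD('i) else 0)"
      unfolding e_def B_def by (rule sum_character[OF N])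
    also have "(\<forall>i. int N dvd z i - z' i) \<longleftrightarrow> z = z'" using inj[OF zz] by auto
    finally show "(\<Sum>v\<in>B. e (\<lambda>i. z i - z' i) v) = (if z = z' then of_nat N ^ CARD('i) else 0)" .
  qed
  also have "\<dots> = of_nat (card A) * of_nat N ^ CARD('i)"
    using fin by simp
  finally have "complex_of_real (\<Sum>v\<in>B. (cmod (F v))\<^sup>2) = complex_of_real (real (card A) * real N ^ CARD('i))"
    by simp
  then have upper: "(\<Sum>v\<in>B. (cmod (F v))\<^sup>2) = real (card A) * real N ^ CARD('i)"
    using of_real_eq_iff by blast
  have lower: "(real (card A) / 2)\<^sup>2 \<le> (cmod (F u))\<^sup>2" if u: "u \<in> U" for u
  proof -
    have "real (card A) / 2 = (\<Sum>z\<in>A. 1/2)" by simp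
    also have "\<dots> \<le> (\<Sum>z\<in>A. Re (e z u))"
    proof (rule sum_mono)
      fix z assume z: "z \<in> A"
      define s where "s = 2 * pi * real_of_int (\<Sum>i\<in>UNIV. z i * u i) / N"
      have "\<bar>s\<bar> = 2 * pi * (\<bar>real_of_int (\<Sum>i\<in>UNIV. z i * u i)\<bar> / N)"
        by (simp add: s_def abs_mult del: of_int_sum)
      also have "\<dots> \<le> 2 * pi * (1 / 8)"
        using small[OF z u] N by (intro mult_left_mono) (simp_all add: field_simps)
      finally have s: "\<bar>s\<bar> \<le> pi / 3" using pi_gt_zero by simp
      have "1/2 = cos (pi/3)" by (simp add: cos_60)
      also have "\<dots> \<le> cos \<bar>s\<bar>"
        using s by (intro cos_monotone_0_pi_le) auto
      also have "\<dots> = cos s" by (rule cos_abs_real)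
      also have "\<dots> = Re (e z u)" by (simp add: e_def s_def del: of_int_sum)
      finally show "1/2 \<le> Re (e z u)" .
    qed
    also have "\<dots> = Re (F u)" by (simp add: F_def)
    also have "\<dots> \<le> cmod (F u)" by (rule complex_Re_le_cmod)
    finally show ?thesis by (intro power_mono) auto
  qed
  have Fred: "F (red u) = F u" for u
    unfolding F_def
  proof (intro sum.cong refl)
    fix z
    have "(\<Sum>i\<in>UNIV. z i * u i) = (\<Sum>i\<in>UNIV. z i * red u i) + int N * (\<Sum>i\<in>UNIV. z i * (u i div int N))"
      unfolding sum_distrib_left sum.distrib[symmetric] red_def
    proof (intro sum.cong refl)
      fix x
      have *: "c * r + n * (c * q) = c * (r + n * q)" for c r n q :: int by (simp add: algebra_simps)
      show "z x * u x = z x * (u x mod int N) + int N * (z x * (u x div int N))"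
        unfolding * by simp
    qed
    moreover have "cis (2 * pi * of_int (s + int N * t) / N) = cis (2 * pi * of_int s / N)" for s t
    proof -
      have "2 * pi * of_int (s + int N * t) / N = 2 * pi * of_int s / N + 2 * pi * of_int t"
        using N by (simp add: add_divide_distrib distrib_left)
      then show ?thesis by (simp add: cis_mult[symmetric])
    qed
    ultimately show "e z (red u) = e z u" unfolding e_def by (simp only:)
  qed
  have redB: "red ` U \<subseteq> B" using N by (auto simp: red_def B_def)
  have "real (card U) * (real (card A) / 2)\<^sup>2 = (\<Sum>u\<in>U. (real (card A) / 2)\<^sup>2)" by simp
  also have "\<dots> \<le> (\<Sum>u\<in>U. (cmod (F u))\<^sup>2)" by (intro sum_mono lower)
  also have "\<dots> = (\<Sum>v\<in>B. \<Sum>u\<in>{u \<in> U. red u = v}. (cmod (F u))\<^sup>2)"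
    by (rule sum.group[symmetric]) (use fin finB redB in auto)
  also have "\<dots> \<le> (\<Sum>v\<in>B. real M * (cmod (F v))\<^sup>2)"
  proof (rule sum_mono)
    fix v assume v: "v \<in> B"
    have "(\<Sum>u\<in>{u \<in> U. red u = v}. (cmod (F u))\<^sup>2) = real (card {u \<in> U. red u = v}) * (cmod (F v))\<^sup>2"
    proof -
      have "(\<Sum>u\<in>{u \<in> U. red u = v}. (cmod (F u))\<^sup>2) = (\<Sum>u\<in>{u \<in> U. red u = v}. (cmod (F v))\<^sup>2)"
        by (intro sum.cong refl) (use Fred in \<open>metis (mono_tags, lifting) mem_Collect_eq\<close>)
      then show ?thesis by simp
    qed
    moreover have "card {u \<in> U. red u = v} \<le> M"
    proof (cases "{u \<in> U. red u = v} = {}")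
      case True
      then show ?thesis by (metis card.empty le0)
    next
      case False
      then obtain u where u: "u \<in> U" "red u = v" by auto
      have "{u \<in> U. red u = v} \<subseteq> {u' \<in> U. \<forall>i. int N dvd u' i - u i}"
      proof safe
        fix u' i assume "v = red u'"
        then have "u' i mod int N = u i mod int N" using u(2) by (metis red_def)
        then show "int N dvd u' i - u i" by (simp add: mod_eq_dvd_iff)
      qed
      then have "card {u \<in> U. red u = v} \<le> card {u' \<in> U. \<forall>i. int N dvd u' i - u i}"
        using fin by (intro card_mono) auto
      with mult[OF u(1)] show ?thesis by simp
    qed
    ultimately show "(\<Sum>u\<in>{u \<in> U. red u = v}. (cmod (F u))\<^sup>2) \<le> real M * (cmod (F v))\<^sup>2"
      by (simp add: mult_right_mono)
  qed
  also have "\<dots> = real M * (real (card A) * real N ^ CARD('i))"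
    by (simp add: upper flip: sum_distrib_left)
  finally have "real (card A) * (real (card A) * real (card U)) \<le> real (card A) * (4 * real M * real N ^ CARD('i))"
    by (simp add: power2_eq_square algebra_simps)
  moreover have "real (card A) > 0" using False fin by (simp add: card_gt_0_iff)
  ultimately have "real (card A) * real (card U) \<le> 4 * real M * real N ^ CARD('i)"
    by (simp only: mult_le_cancel_left_pos)
  then have "real (card A * card U) \<le> real (4 * M * N ^ CARD('i))" by simp
  then show ?thesis by (simp only: of_nat_le_iff)
qed simp

text \<open>Triples become integer vectors over a single finite index type with
  \<open>CARD('m) + 2\<close> elements, the form in which \<open>card_dual_le\<close>
  counts.\<close>

definition enc :: "int \<times> ('m::finite \<Rightarrow> int) \<times> int \<Rightarrow> ('m option option \<Rightarrow> int)" where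
  "enc = (\<lambda>(q, a, b) t. case t of None \<Rightarrow> q | Some None \<Rightarrow> b | Some (Some i) \<Rightarrow> a i)"

lemma enc_simps [simp]:
  "enc (q, a, b) None = q" "enc (q, a, b) (Some None) = b" "enc (q, a, b) (Some (Some i)) = a i"
  by (simp_all add: enc_def)

lemma inj_enc: "inj enc"
proof (rule injI)
  fix x y :: "int \<times> ('a \<Rightarrow> int) \<times> int" assume e: "enc x = enc y"
  obtain q a b q' a' b' where xy: "x = (q, a, b)" "y = (q', a', b')" by (cases x, cases y) auto
  have "q = q'" using fun_cong[OF e, of None] by (simp add: xy)
  moreover have "b = b'" using fun_cong[OF e, of "Some None"] by (simp add: xy)
  moreover have "a = a'" 
  proof
    fix i show "a i = a' i" using fun_cong[OF e, of "Some (Some i)"] by (simp add: xy)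
  qed
  ultimately show "x = y" using xy by simp
qed

lemma sum_enc:
  "(\<Sum>t\<in>UNIV. enc (q, a, b) t * enc (q', a', b') t) = q * q' + b * b' + (\<Sum>i\<in>UNIV. a i * a' i)"
  by (simp add: UNIV_option_conv sum.reindex image_iff algebra_simps)

text \<open>For a cap of the cone over a graph, around the point with slope coordinates \<open>X\<close>, height \<open>F\<close>
  and gradient \<open>P\<close>, this is the set of integer points in the polar body.\<close>

definition polar_cap :: "real \<Rightarrow> real \<Rightarrow> real \<Rightarrow> ('m::finite \<Rightarrow> real) \<Rightarrow> real \<Rightarrow> ('m \<Rightarrow> real) \<Rightarrow> (int \<times> ('m \<Rightarrow> int) \<times> int) set" where
  "polar_cap Q R D X F P = {(k0, k, l). \<bar>of_int l\<bar> \<le> 1 / (24 * D)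
      \<and> (\<forall>i. \<bar>of_int (k i) + of_int l * P i\<bar> \<le> 1 / (24 * real CARD('m) * R))
      \<and> \<bar>of_int k0 + (\<Sum>i\<in>UNIV. of_int (k i) * X i) + of_int l * F\<bar> \<le> 1 / (48 * Q)}"

lemma finite_polar_cap:
  fixes X P :: "'m::finite \<Rightarrow> real"
  assumes "Q > 0" "R > 0" "D > 0"
  shows "finite (polar_cap Q R D X F P)"
proof -
  define T where "T = (SIGMA l:{l::int. \<bar>of_int l - 0\<bar> \<le> 1 / (24 * D)}.
     SIGMA k:{k::'m \<Rightarrow> int. \<forall>i. \<bar>of_int (k i) - (- of_int l * P i)\<bar> \<le> 1 / (24 * real CARD('m) * R)}.
     {k0::int. \<bar>of_int k0 - (- (\<Sum>i\<in>UNIV. of_int (k i) * X i) - of_int l * F)\<bar> \<le> 1 / (48 * Q)})"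
  have "finite T" unfolding T_def
    by (intro finite_SigmaI card_int_interval_le card_int_box_le) (use assms in auto)
  moreover have "polar_cap Q R D X F P \<subseteq> (\<lambda>(l, k, k0). (k0, k, l)) ` T"
  proof
    fix z assume z: "z \<in> polar_cap Q R D X F P"
    obtain k0 k l where zz: "z = (k0, k, l)" by (cases z) auto
    have "(l, k, k0) \<in> T" using z by (auto simp: zz polar_cap_def T_def algebra_simps)
    then show "z \<in> (\<lambda>(l, k, k0). (k0, k, l)) ` T" unfolding zz by force
  qed
  ultimately show ?thesis using finite_surj by blast
qed

text \<open>The large sieve is applied to A and to a set \<open>U\<close> of integer points in the
  N-fold dilate of the polar body. Points of \<open>U\<close> congruent modulo N differ by N times
  an integer point of the polar body itself, so the multiplicity is at most the number of such
  points. The size of \<open>U\<close> is of order N^(m+2) / (D R^m Q), and the powers of N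
  cancel.\<close>

lemma card_cap_le:
  fixes X P :: "'m::finite \<Rightarrow> real" and F Q R D :: real and A :: "(int \<times> ('m \<Rightarrow> int) \<times> int) set"
  assumes pos: "Q > 0" "R > 0" "D > 0" and finA: "finite A"
    and A: "\<And>q a b. (q, a, b) \<in> A \<Longrightarrow> \<bar>of_int q\<bar> \<le> 2 * Q \<and> (\<forall>i. \<bar>of_int (a i) - of_int q * X i\<bar> \<le> R)
        \<and> \<bar>of_int b - of_int q * F - (\<Sum>i\<in>UNIV. P i * (of_int (a i) - of_int q * X i))\<bar> \<le> D"
  shows "real (card A) \<le> 4 * 48 * (48 * real CARD('m)) ^ CARD('m) * 96 * (D * R ^ CARD('m) * Q) * card (polar_cap Q R D X F P)"
proof -
  define m where "m = CARD('m)"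
  have m: "m > 0" by (simp add: m_def)
  let ?K = "polar_cap Q R D X F P"
  have finK: "finite ?K" using finite_polar_cap pos by blast
  define B where "B = (\<Union>z\<in>A. range (enc z))"
  have finB: "finite B" unfolding B_def using finA by auto
  obtain b0 where b0: "\<forall>x\<in>B. \<bar>x\<bar> \<le> b0"
    using finB by (metis abs_le_iff bdd_above.E bdd_above_finite finite_imageI imageI)
  \<comment> \<open>N is at least \<open>24 * D\<close>, \<open>24 * m * R\<close> and
    \<open>48 * Q\<close>, so the floors below lose at most a factor 2, and it exceeds
    \<open>2 * b0\<close>, so distinct points of A stay distinct modulo N.\<close>
  define N where "N = nat \<lceil>1 + \<bar>24 * D\<bar> + \<bar>24 * real m * R\<bar> + \<bar>48 * Q\<bar> + 2 * \<bar>of_int b0\<bar>\<rceil>"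
  have Nge: "real N \<ge> 1 + \<bar>24 * D\<bar> + \<bar>24 * real m * R\<bar> + \<bar>48 * Q\<bar> + 2 * \<bar>of_int b0\<bar>"
    unfolding N_def by linarith
  have N: "N > 0" "real N \<ge> 24 * D" "real N \<ge> 24 * real m * R" "real N \<ge> 48 * Q" "int N > 2 * b0"
  proof -
    show "real N \<ge> 24 * D" "real N \<ge> 24 * real m * R" "real N \<ge> 48 * Q"
      using Nge by linarith+
    have "real N > 0" "real N > 2 * of_int b0" using Nge by linarith+
    then show "N > 0" "int N > 2 * b0" by linarith+
  qed
  define n1 where "n1 = nat \<lfloor>N / (24 * D)\<rfloor>"
  define n2 where "n2 = nat \<lfloor>N / (24 * real m * R)\<rfloor>"
  define n3 where "n3 = nat \<lfloor>N / (48 * Q)\<rfloor>"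
  have fl: "x / 2 \<le> real (nat \<lfloor>x\<rfloor>) \<and> real (nat \<lfloor>x\<rfloor>) \<le> x" if "x \<ge> 1" for x :: real
  proof -
    have "\<lfloor>x\<rfloor> \<ge> 1" using that by simp
    then have "real (nat \<lfloor>x\<rfloor>) = of_int \<lfloor>x\<rfloor>" "real_of_int \<lfloor>x\<rfloor> \<ge> 1" by auto
    then show ?thesis by linarith
  qed
  have n1: "N / (48 * D) \<le> n1" "n1 \<le> N / (24 * D)"
    using fl[of "N / (24 * D)"] N pos by (auto simp: n1_def)
  have n2: "N / (48 * real m * R) \<le> n2" "n2 \<le> N / (24 * real m * R)"
    using fl[of "N / (24 * real m * R)"] N pos m by (auto simp: n2_def)
  have n3: "N / (96 * Q) \<le> n3" "n3 \<le> N / (48 * Q)"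
    using fl[of "N / (48 * Q)"] N pos by (auto simp: n3_def)
  define T :: "(int \<times> ('m \<Rightarrow> int) \<times> int) set" where
    "T = {0..<int n1} \<times> PiE UNIV (\<lambda>_. {0..<int n2}) \<times> {0..<int n3}"
  have finT: "finite T" unfolding T_def by (intro finite_cartesian_product finite_PiE) auto
  have cardT: "card T = n1 * (n2 ^ m * n3)" 
    unfolding T_def by (simp add: card_cartesian_product card_PiE m_def)
  \<comment> \<open>The windows start at ceilings, so the linear forms that define the polar body
    take values in [0, N c] instead of [-N c, N c] and differences cost no factor 2. The triangular
    shape (\<open>w\<close> depends on j, \<open>w0\<close> on j and \<open>w\<close>) makes \<phi>
    injective.\<close>
  define w where "w = (\<lambda>(j::int) (s::'m \<Rightarrow> int) i. \<lceil>- of_int j * P i\<rceil> + s i)"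
  define w0 where "w0 = (\<lambda>j s (s0::int). \<lceil>- (\<Sum>i\<in>UNIV. of_int (w j s i) * X i) - of_int j * F\<rceil> + s0)"
  define \<phi> where "\<phi> = (\<lambda>(j, s, s0). (w0 j s s0, w j s, j))"
  have inj\<phi>: "inj \<phi>"
    by (rule injI) (auto simp: \<phi>_def w0_def w_def fun_eq_iff)
  define U where "U = \<phi> ` T"
  have cardU: "card U = n1 * (n2 ^ m * n3)"
    unfolding U_def using inj\<phi> by (subst card_image) (auto simp: cardT intro: inj_on_subset)
  have finU: "finite U" unfolding U_def using finT by simp
  have ceil: "0 \<le> real_of_int (\<lceil>- y\<rceil> + s) + y \<and> real_of_int (\<lceil>- y\<rceil> + s) + y \<le> real n"
    if "0 \<le> s" "s < int n" for y :: real and s n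
    using that by linarith
  have U: "0 \<le> real_of_int j \<and> real_of_int j \<le> N / (24 * D)
      \<and> (\<forall>i. 0 \<le> of_int (v i) + of_int j * P i \<and> of_int (v i) + of_int j * P i \<le> N / (24 * real m * R))
      \<and> 0 \<le> of_int v0 + (\<Sum>i\<in>UNIV. of_int (v i) * X i) + of_int j * F
      \<and> of_int v0 + (\<Sum>i\<in>UNIV. of_int (v i) * X i) + of_int j * F \<le> N / (48 * Q)"
    if vU: "(v0, v, j) \<in> U" for v0 v j
  proof -
    obtain t where t: "t \<in> T" "(v0, v, j) = \<phi> t" using vU unfolding U_def by blast
    obtain j' s s0 where "t = (j', s, s0)" by (cases t)
    with t have s: "(j, s, s0) \<in> T" "v = w j s" "v0 = w0 j s s0" by (auto simp: \<phi>_def)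
    have "0 \<le> j" "j < int n1" "\<And>i. 0 \<le> s i \<and> s i < int n2" "0 \<le> s0" "s0 < int n3"
      using s(1) by (auto simp: T_def PiE_def Pi_def)
    moreover have "0 \<le> of_int (v i) + of_int j * P i \<and> of_int (v i) + of_int j * P i \<le> N / (24 * real m * R)" for i
      using ceil[of "s i" n2 "of_int j * P i"] calculation n2(2) by (auto simp: s w_def)
    moreover have "0 \<le> of_int v0 + ((\<Sum>i\<in>UNIV. of_int (v i) * X i) + of_int j * F)
      \<and> of_int v0 + ((\<Sum>i\<in>UNIV. of_int (v i) * X i) + of_int j * F) \<le> N / (48 * Q)"
      using ceil[of s0 n3 "(\<Sum>i\<in>UNIV. of_int (v i) * X i) + of_int j * F"] calculation(4,5) n3(2)
      by (auto simp: s(3) w0_def s(2)[symmetric])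
    moreover have "real_of_int j \<le> N / (24 * D)" using \<open>j < int n1\<close> n1(2) by linarith
    ultimately show ?thesis by (auto simp: add.assoc)
  qed
  have "card (enc ` A) * card (enc ` U) \<le> 4 * card ?K * N ^ CARD('m option option)"
  proof (rule card_dual_le[OF N(1)])
    show "finite (enc ` A)" "finite (enc ` U)" using finA finU by auto
  next
    fix z u assume "z \<in> enc ` A" "u \<in> enc ` U"
    then obtain q a b v0 v j where z: "z = enc (q, a, b)" "(q, a, b) \<in> A" 
      and u: "u = enc (v0, v, j)" "(v0, v, j) \<in> U" by auto
    let ?x = "\<lambda>i. of_int (a i) - of_int q * X i"
    let ?y = "\<lambda>i. of_int (v i) + of_int j * P i"
    let ?t1 = "of_int q * (of_int v0 + (\<Sum>i\<in>UNIV. of_int (v i) * X i) + of_int j * F)"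
    let ?t2 = "of_int j * (of_int b - of_int q * F - (\<Sum>i\<in>UNIV. P i * ?x i))"
    let ?t3 = "\<Sum>i\<in>UNIV. ?y i * ?x i"
    \<comment> \<open>The pairing of z and u splits into three terms, one per condition in
      \<open>polar_cap\<close>. The constants 24 and 48 there make each term at most N / 24; the 48
      accounts for |q| \<le> 2 Q.\<close>
    have aux: "\<bar>s\<bar> \<le> y" if "s = t1 + t2 + t3" "\<bar>t1\<bar> \<le> y / 3" "\<bar>t2\<bar> \<le> y / 3" "\<bar>t3\<bar> \<le> y / 3" for s t1 t2 t3 y :: real
      using that by linarith
    show "\<bar>of_int (\<Sum>t\<in>UNIV. z t * u t)\<bar> \<le> real N / 8"
    proof (rule aux)
      show "real_of_int (\<Sum>t\<in>UNIV. z t * u t) = ?t1 + ?t2 + ?t3"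
        unfolding z u sum_enc
        by (simp add: algebra_simps sum_distrib_left sum.distrib sum_subtractf)
      have "\<bar>?t1\<bar> \<le> (2 * Q) * (N / (48 * Q))"
        unfolding abs_mult using A[OF z(2)] U[OF u(2)] pos by (intro mult_mono) auto
      then show "\<bar>?t1\<bar> \<le> N / 8 / 3" using pos by simp
      have "\<bar>?t2\<bar> \<le> (N / (24 * D)) * D"
        unfolding abs_mult using A[OF z(2)] U[OF u(2)] pos by (intro mult_mono) auto
      then show "\<bar>?t2\<bar> \<le> N / 8 / 3" using pos by simp
      have "\<bar>?t3\<bar> \<le> (\<Sum>i\<in>(UNIV::'m set). (N / (24 * real m * R)) * R)"
      proof (rule order_trans[OF sum_abs], rule sum_mono)
        fix i :: 'm
        show "\<bar>?y i * ?x i\<bar> \<le> (N / (24 * real m * R)) * R"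
          unfolding abs_mult using A[OF z(2)] U[OF u(2)] pos m by (intro mult_mono) auto
      qed
      also have "\<dots> = N / 24" using m pos by (simp add: m_def)
      finally show "\<bar>?t3\<bar> \<le> N / 8 / 3" by simp
    qed
  next
    fix z z' assume zz: "z \<in> enc ` A" "z' \<in> enc ` A" and d: "\<forall>i. int N dvd z i - z' i"
    show "z = z'"
    proof
      fix i
      have "\<bar>z i\<bar> \<le> b0" "\<bar>z' i\<bar> \<le> b0" using zz b0 by (auto simp: B_def)
      then have "\<bar>z i - z' i\<bar> < int N" using N(5) by linarith
      then show "z i = z' i" using d zdvd_imp_le[of "int N" "\<bar>z i - z' i\<bar>"] by fastforce
    qed
  next
    fix u assume "u \<in> enc ` U"
    then obtain v0 v j where u: "u = enc (v0, v, j)" "(v0, v, j) \<in> U" by auto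
    define \<kappa> where "\<kappa> = (\<lambda>u'. ((u' None - u None) div int N, (\<lambda>i. (u' (Some (Some i)) - u (Some (Some i))) div int N),
        (u' (Some None) - u (Some None)) div int N))"
    let ?V = "{u' \<in> enc ` U. \<forall>i. int N dvd u' i - u i}"
    have "inj_on \<kappa> ?V"
    proof (rule inj_onI)
      fix x y assume x: "x \<in> ?V" and y: "y \<in> ?V" and e: "\<kappa> x = \<kappa> y"
      have "(x t - u t) div int N = (y t - u t) div int N" for t
        using e by (cases t; cases "the t") (auto simp: \<kappa>_def fun_eq_iff)
      moreover have "int N dvd x t - u t" "int N dvd y t - u t" for t
        using x y by blast+
      ultimately have "x t - u t = y t - u t" for t
        by (metis dvd_mult_div_cancel)
      then show "x = y" by (intro ext) (metis diff_add_cancel)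
    qed
    moreover have "\<kappa> ` ?V \<subseteq> ?K"
    proof
      fix k assume "k \<in> \<kappa> ` ?V"
      then obtain u1 where u1: "k = \<kappa> u1" "u1 \<in> enc ` U" "\<forall>i. int N dvd u1 i - u i" by blast
      then obtain u2 where u2: "u1 = enc u2" "u2 \<in> U" by blast
      obtain v0' v' j' where "u2 = (v0', v', j')" by (cases u2)
      with u1 u2 have k: "k = \<kappa> (enc (v0', v', j'))" and u': "(v0', v', j') \<in> U"
        and d: "\<forall>i. int N dvd enc (v0', v', j') i - u i" by simp_all
      obtain k0 kk l where kk: "v0' = v0 + int N * k0" "j' = j + int N * l" "\<And>i. v' i = v i + int N * kk i"
      proof -
        have d': "int N dvd v' i - v i" for i using d[rule_format, of "Some (Some i)"] by (simp add: u(1))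
        moreover have "int N dvd v0' - v0" using d[rule_format, of None] by (simp add: u(1))
        moreover have "int N dvd j' - j" using d[rule_format, of "Some None"] by (simp add: u(1))
        ultimately show ?thesis
          by (intro that[of "(v0' - v0) div int N" "(j' - j) div int N" "\<lambda>i. (v' i - v i) div int N"]) simp_all
      qed
      have k_eq: "k = (k0, kk, l)" using N(1) by (simp add: k \<kappa>_def u(1) kk)
      have r: "real_of_int v0' = of_int v0 + N * of_int k0" "real_of_int j' = of_int j + N * of_int l"
         "\<And>i. real_of_int (v' i) = of_int (v i) + N * of_int (kk i)"
        by (simp_all add: kk)
      have diff: "\<bar>x\<bar> \<le> c" if "0 \<le> y" "y \<le> N * c" "0 \<le> y'" "y' \<le> N * c" "y' = y + N * x" for x y y' c :: real
      proof -
        have "\<bar>N * x\<bar> \<le> N * c" using that by linarith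
        then show ?thesis using N(1) by (simp add: abs_mult)
      qed
      have "\<bar>of_int l\<bar> \<le> 1 / (24 * D)"
        by (rule diff[of "of_int j" _ "of_int j'"]) (use U[OF u'] U[OF u(2)] r in auto)
      moreover have "\<bar>of_int (kk i) + of_int l * P i\<bar> \<le> 1 / (24 * real m * R)" for i
        by (rule diff[of "of_int (v i) + of_int j * P i" _ "of_int (v' i) + of_int j' * P i"])
           (use U[OF u'] U[OF u(2)] r in \<open>auto simp: algebra_simps\<close>)
      moreover have "\<bar>of_int k0 + (\<Sum>i\<in>UNIV. of_int (kk i) * X i) + of_int l * F\<bar> \<le> 1 / (48 * Q)"
        by (rule diff[of "of_int v0 + (\<Sum>i\<in>UNIV. of_int (v i) * X i) + of_int j * F" _
               "of_int v0' + (\<Sum>i\<in>UNIV. of_int (v' i) * X i) + of_int j' * F"])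
           (use U[OF u'] U[OF u(2)] in \<open>auto simp: r algebra_simps sum.distrib sum_distrib_left\<close>)
      ultimately show "k \<in> ?K" unfolding k_eq polar_cap_def m_def by auto
    qed
    ultimately show "card ?V \<le> card ?K" using finK by (intro card_inj_on_le)
  qed
  moreover have "card (enc ` A) = card A" "card (enc ` U) = card U"
    by (auto intro!: card_image inj_on_subset[OF inj_enc])
  ultimately have le: "card A * (n1 * (n2 ^ m * n3)) \<le> 4 * card ?K * N ^ (m + 2)"
    by (simp add: cardU m_def)
  have "real (card A) * ((N / (48 * D)) * ((N / (48 * real m * R)) ^ m * (N / (96 * Q))))
      \<le> real (card A) * (real n1 * (real n2 ^ m * real n3))"
    by (intro mult_left_mono mult_mono power_mono n1(1) n2(1) n3(1)) (use pos in simp_all)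
  also have "\<dots> \<le> 4 * card ?K * real N ^ (m + 2)"
    using le by (metis (no_types, lifting) of_nat_le_iff of_nat_mult of_nat_numeral of_nat_power)
  finally have "real (card A) * real N ^ (m + 2) \<le> 4 * 48 * (48 * real m) ^ m * 96 * (D * R ^ m * Q) * card ?K * real N ^ (m + 2)"
    using pos m N(1) by (simp add: power_divide power_mult_distrib field_simps)
  then show ?thesis using N(1) by (simp add: m_def)
qed

subsection \<open>Integer points near cones\<close>

definition rvec :: "('m::finite \<Rightarrow> int) \<Rightarrow> real^'m" where
  "rvec a = (\<chi> i. of_int (a i))"

lemma rvec_nth [simp]: "rvec a $ i = of_int (a i)"
  by (simp add: rvec_def)

text \<open>The cone is the one over the graph of \<open>\<lambda>x. h * f (x / l)\<close>.\<close>

definition near_cone ::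
  "(real^'m \<Rightarrow> real) \<Rightarrow> (real^'m) set \<Rightarrow> real \<Rightarrow> real \<Rightarrow> real \<Rightarrow> real \<Rightarrow> (int \<times> ('m \<Rightarrow> int) \<times> int) set" where
  "near_cone f S l h Q D = {(q, a, b). Q \<le> of_int q \<and> of_int q \<le> 2 * Q \<and> rvec a /\<^sub>R (of_int q * l) \<in> S
      \<and> \<bar>of_int b - of_int q * h * f (rvec a /\<^sub>R (of_int q * l))\<bar> \<le> D}"

text \<open>Legendre duality between \<open>f\<close> on \<open>U\<close> and \<open>g\<close> on \<open>V\<close>: here \<open>p\<close> is the gradient of \<open>f\<close> and \<open>p'\<close>
  that of \<open>g\<close>, which enter only through second-order Taylor estimates. The two coordinate
  conditions keep \<open>U\<close> and \<open>V\<close> away from the origin.\<close>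

definition dual_pair ::
  "(real^'m) set \<Rightarrow> (real^'m) set \<Rightarrow> (real^'m \<Rightarrow> real) \<Rightarrow> (real^'m \<Rightarrow> real) \<Rightarrow>
   (real^'m \<Rightarrow> real^'m) \<Rightarrow> (real^'m \<Rightarrow> real^'m) \<Rightarrow> real \<Rightarrow> bool" where
  "dual_pair U V f g p p' L \<longleftrightarrow> open U \<and> open V \<and> L \<ge> 1 \<and>
    (\<forall>x\<in>U. p x \<in> V \<and> p' (p x) = x \<and> f x + g (p x) = x \<bullet> p x \<and>
       norm x \<le> L \<and> norm (p x) \<le> L \<and> \<bar>f x\<bar> \<le> L \<and> \<bar>g (p x)\<bar> \<le> L) \<and>
    (\<forall>y\<in>V. p' y \<in> U \<and> p (p' y) = y) \<and>
    (\<forall>x\<in>U. \<forall>x'\<in>U. norm (p x - p x') \<le> L * norm (x - x') \<and> norm (x - x') \<le> L * norm (p x - p x') \<and>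
       \<bar>f x' - f x - p x \<bullet> (x' - x)\<bar> \<le> L * (norm (x' - x))\<^sup>2 \<and>
       \<bar>g (p x') - g (p x) - x \<bullet> (p x' - p x)\<bar> \<le> L * (norm (p x' - p x))\<^sup>2) \<and>
    (\<exists>i. \<forall>x\<in>U. \<bar>p x $ i\<bar> \<ge> 1 / L) \<and> (\<exists>i. \<forall>x\<in>U. \<bar>x $ i\<bar> \<ge> 1 / L)"

lemma dual_pairD:
  assumes "dual_pair U V f g p p' L"
  shows "open U" "open V" "L \<ge> 1"
    and "\<And>x. x \<in> U \<Longrightarrow> p x \<in> V" "\<And>x. x \<in> U \<Longrightarrow> p' (p x) = x" "\<And>x. x \<in> U \<Longrightarrow> f x + g (p x) = x \<bullet> p x"
    and "\<And>x. x \<in> U \<Longrightarrow> norm x \<le> L" "\<And>x. x \<in> U \<Longrightarrow> norm (p x) \<le> L" "\<And>x. x \<in> U \<Longrightarrow> \<bar>f x\<bar> \<le> L"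
    and "\<And>x x'. x \<in> U \<Longrightarrow> x' \<in> U \<Longrightarrow> norm (p x - p x') \<le> L * norm (x - x')"
    and "\<And>x x'. x \<in> U \<Longrightarrow> x' \<in> U \<Longrightarrow> norm (x - x') \<le> L * norm (p x - p x')"
    and "\<And>x x'. x \<in> U \<Longrightarrow> x' \<in> U \<Longrightarrow> \<bar>f x' - f x - p x \<bullet> (x' - x)\<bar> \<le> L * (norm (x' - x))\<^sup>2"
    and "\<And>y. y \<in> V \<Longrightarrow> p' y \<in> U" "\<And>y. y \<in> V \<Longrightarrow> p (p' y) = y"
    and "\<exists>i. \<forall>x\<in>U. \<bar>p x $ i\<bar> \<ge> 1 / L" "\<exists>i. \<forall>x\<in>U. \<bar>x $ i\<bar> \<ge> 1 / L"
  using assms unfolding dual_pair_def by simp_all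

text \<open>The estimates for g in \<open>dual_pair\<close> are stated at points \<open>p x\<close>,
  with gradient x. Since p maps U onto V, they are precisely the estimates required of the swapped
  pair.\<close>

lemma dual_pair_swap:
  assumes "dual_pair U V f g p p' L"
  shows "dual_pair V U g f p' p L"
proof -
  note D = assms[unfolded dual_pair_def]
  have V: "\<exists>x\<in>U. y = p x" if "y \<in> V" for y using D that by metis
  have "\<forall>y\<in>V. p' y \<in> U \<and> p (p' y) = y \<and> g y + f (p' y) = y \<bullet> p' y \<and>
       norm y \<le> L \<and> norm (p' y) \<le> L \<and> \<bar>g y\<bar> \<le> L \<and> \<bar>f (p' y)\<bar> \<le> L"
  proof
    fix y assume "y \<in> V"
    then obtain x where x: "x \<in> U" "y = p x" using V by blast
    have "p' y = x" "f x + g (p x) = x \<bullet> p x" using x D by auto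
    then show "p' y \<in> U \<and> p (p' y) = y \<and> g y + f (p' y) = y \<bullet> p' y \<and>
       norm y \<le> L \<and> norm (p' y) \<le> L \<and> \<bar>g y\<bar> \<le> L \<and> \<bar>f (p' y)\<bar> \<le> L"
      using x D by (auto simp: inner_commute)
  qed
  moreover have "\<forall>y\<in>V. \<forall>y'\<in>V. norm (p' y - p' y') \<le> L * norm (y - y') \<and> norm (y - y') \<le> L * norm (p' y - p' y') \<and>
       \<bar>g y' - g y - p' y \<bullet> (y' - y)\<bar> \<le> L * (norm (y' - y))\<^sup>2 \<and>
       \<bar>f (p' y') - f (p' y) - y \<bullet> (p' y' - p' y)\<bar> \<le> L * (norm (p' y' - p' y))\<^sup>2"
  proof (intro ballI)
    fix y y' assume "y \<in> V" "y' \<in> V"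
    then obtain x x' where x: "x \<in> U" "y = p x" "x' \<in> U" "y' = p x'" using V by blast
    have "p' y = x" "p' y' = x'" using x D by auto
    then show "norm (p' y - p' y') \<le> L * norm (y - y') \<and> norm (y - y') \<le> L * norm (p' y - p' y') \<and>
       \<bar>g y' - g y - p' y \<bullet> (y' - y)\<bar> \<le> L * (norm (y' - y))\<^sup>2 \<and>
       \<bar>f (p' y') - f (p' y) - y \<bullet> (p' y' - p' y)\<bar> \<le> L * (norm (p' y' - p' y))\<^sup>2"
      using x D by simp
  qed
  moreover have "\<exists>i. \<forall>y\<in>V. \<bar>p' y $ i\<bar> \<ge> 1 / L" "\<exists>i. \<forall>y\<in>V. \<bar>y $ i\<bar> \<ge> 1 / L"
    using D V by metis+
  ultimately show ?thesis using D unfolding dual_pair_def by blast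
qed

text \<open>The window for a may move with q and that for b with q and a, so the count runs fibre by
  fibre.\<close>

lemma card_int_triples_le:
  fixes u :: "int \<Rightarrow> 'm::finite \<Rightarrow> real" and v :: "int \<Rightarrow> ('m \<Rightarrow> int) \<Rightarrow> real"
  assumes "r \<ge> 0" "t \<ge> 0" "s \<ge> 0"
    and sub: "T \<subseteq> {(q, a, b). \<bar>of_int q - c\<bar> \<le> r \<and> (\<forall>i. \<bar>of_int (a i) - u q i\<bar> \<le> t) \<and> \<bar>of_int b - v q a\<bar> \<le> s}"
  shows "finite T" and "real (card T) \<le> (2 * r + 1) * ((2 * t + 1) ^ CARD('m) * (2 * s + 1))"
proof -
  define W where "W = (SIGMA q:{q::int. \<bar>of_int q - c\<bar> \<le> r}. SIGMA a:{a. \<forall>i. \<bar>of_int (a i) - u q i\<bar> \<le> t}.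
     {b::int. \<bar>of_int b - v q a\<bar> \<le> s})"
  have fin: "finite {q::int. \<bar>of_int q - c\<bar> \<le> r}" "finite {a. \<forall>i. \<bar>of_int (a i) - u q i\<bar> \<le> t}"
     "finite {b::int. \<bar>of_int b - v q a\<bar> \<le> s}" for q a
    by (auto intro!: card_int_interval_le card_int_box_le assms(1-3))
  have finW: "finite W" unfolding W_def by (intro finite_SigmaI fin)
  have TW: "T \<subseteq> W" using sub by (auto simp: W_def)
  then show "finite T" using finW finite_subset by blast
  have inner: "real (card (SIGMA a:{a. \<forall>i. \<bar>of_int (a i) - u q i\<bar> \<le> t}. {b::int. \<bar>of_int b - v q a\<bar> \<le> s}))
      \<le> (2 * t + 1) ^ CARD('m) * (2 * s + 1)" for q
  proof -
    have "real (card (SIGMA a:{a. \<forall>i. \<bar>of_int (a i) - u q i\<bar> \<le> t}. {b::int. \<bar>of_int b - v q a\<bar> \<le> s}))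
      = (\<Sum>a\<in>{a. \<forall>i. \<bar>of_int (a i) - u q i\<bar> \<le> t}. real (card {b::int. \<bar>of_int b - v q a\<bar> \<le> s}))"
      by (subst card_SigmaI) (use fin in auto)
    also have "\<dots> \<le> (\<Sum>a\<in>{a. \<forall>i. \<bar>of_int (a i) - u q i\<bar> \<le> t}. 2 * s + 1)"
      by (intro sum_mono card_int_interval_le assms)
    also have "\<dots> = real (card {a. \<forall>i. \<bar>of_int (a i) - u q i\<bar> \<le> t}) * (2 * s + 1)" by simp
    also have "\<dots> \<le> (2 * t + 1) ^ CARD('m) * (2 * s + 1)"
      by (intro mult_right_mono card_int_box_le) (use assms in auto)
    finally show ?thesis .
  qed
  have "real (card T) \<le> real (card W)" using TW finW card_mono by (simp add: card_mono)
  also have "\<dots> = (\<Sum>q\<in>{q::int. \<bar>of_int q - c\<bar> \<le> r}.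
      real (card (SIGMA a:{a. \<forall>i. \<bar>of_int (a i) - u q i\<bar> \<le> t}. {b::int. \<bar>of_int b - v q a\<bar> \<le> s})))"
    unfolding W_def by (subst card_SigmaI) (use fin in auto)
  also have "\<dots> \<le> (\<Sum>q\<in>{q::int. \<bar>of_int q - c\<bar> \<le> r}. (2 * t + 1) ^ CARD('m) * (2 * s + 1))"
    by (intro sum_mono inner)
  also have "\<dots> = real (card {q::int. \<bar>of_int q - c\<bar> \<le> r}) * ((2 * t + 1) ^ CARD('m) * (2 * s + 1))" by simp
  also have "\<dots> \<le> (2 * r + 1) * ((2 * t + 1) ^ CARD('m) * (2 * s + 1))"
    by (intro mult_right_mono card_int_interval_le) (use assms in auto)
  finally show "real (card T) \<le> (2 * r + 1) * ((2 * t + 1) ^ CARD('m) * (2 * s + 1))" .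
qed

text \<open>The lower bound on one coordinate forces |a i| \<ge> 1, hence 1 \<le> 2 Q l L as soon as
  the set is nonempty. The + 1 from counting integers in an interval is thereby absorbed, even for
  tiny l.\<close>

lemma near_cone_trivial:
  fixes S :: "(real^'m) set"
  assumes L: "L \<ge> 1" and S: "\<And>x. x \<in> S \<Longrightarrow> norm x \<le> L \<and> \<bar>x $ i\<bar> \<ge> 1 / L"
    and pos: "l > 0" "Q \<ge> 1" "D \<ge> 0"
  shows "finite (near_cone f S l h Q D)"
    and "real (card (near_cone f S l h Q D)) \<le> 4 * (6 * L) ^ CARD('m) * ((D + 1) * Q * (Q * l) ^ CARD('m))"
proof -
  have coord: "\<bar>of_int (a j)\<bar> \<le> 2 * (Q * l) * L" if "(q, a, b) \<in> near_cone f S l h Q D" for q a b j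
  proof -
    have q: "Q \<le> of_int q" "of_int q \<le> 2 * Q" and x: "rvec a /\<^sub>R (of_int q * l) \<in> S"
      using that by (auto simp: near_cone_def)
    have "\<bar>(rvec a /\<^sub>R (of_int q * l)) $ j\<bar> \<le> L" using S[OF x] component_le_norm_cart order_trans by blast
    then have "\<bar>of_int (a j)\<bar> \<le> L * (of_int q * l)" using q pos
      by (simp add: abs_mult divide_simps split: if_splits)
    also have "\<dots> \<le> L * ((2 * Q) * l)" using q pos L by (intro mult_left_mono mult_right_mono) auto
    finally show ?thesis by (simp add: mult_ac)
  qed
  have sub: "near_cone f S l h Q D \<subseteq> {(q, a, b). \<bar>of_int q - 3/2 * Q\<bar> \<le> Q / 2 \<and> (\<forall>j. \<bar>of_int (a j) - 0\<bar> \<le> 2 * (Q * l) * L)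
       \<and> \<bar>of_int b - of_int q * h * f (rvec a /\<^sub>R (of_int q * l))\<bar> \<le> D}"
  proof safe
    fix q a b assume z: "(q, a, b) \<in> near_cone f S l h Q D"
    then have "Q \<le> of_int q" "of_int q \<le> 2 * Q" by (auto simp: near_cone_def)
    then show "\<bar>of_int q - 3/2 * Q\<bar> \<le> Q / 2" by linarith
    show "\<bar>of_int b - of_int q * h * f (rvec a /\<^sub>R (of_int q * l))\<bar> \<le> D"
      using z by (auto simp: near_cone_def)
    fix j show "\<bar>of_int (a j) - 0\<bar> \<le> 2 * (Q * l) * L" using coord[OF z] by simp
  qed
  have nn: "Q / 2 \<ge> 0" "2 * (Q * l) * L \<ge> 0" using pos L by auto
  show "finite (near_cone f S l h Q D)" using card_int_triples_le(1)[OF nn pos(3) sub] .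
  show "real (card (near_cone f S l h Q D)) \<le> 4 * (6 * L) ^ CARD('m) * ((D + 1) * Q * (Q * l) ^ CARD('m))"
  proof (cases "near_cone f S l h Q D = {}")
    case True
    then show ?thesis using pos L by simp
  next
    case False
    then obtain q a b where z: "(q, a, b) \<in> near_cone f S l h Q D" by auto
    then have q: "Q \<le> of_int q" and x: "rvec a /\<^sub>R (of_int q * l) \<in> S" by (auto simp: near_cone_def)
    have "\<bar>(rvec a /\<^sub>R (of_int q * l)) $ i\<bar> > 0" using S[OF x] L by (smt (verit) divide_pos_pos)
    then have "a i \<noteq> 0" by auto
    then have "1 \<le> \<bar>a i\<bar>" by linarith
    then have "1 \<le> \<bar>real_of_int (a i)\<bar>" by linarith
    then have one: "1 \<le> 2 * (Q * l) * L" using coord[OF z, of i] by linarith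
    have "real (card (near_cone f S l h Q D)) \<le> (2 * (Q / 2) + 1) * ((2 * (2 * (Q * l) * L) + 1) ^ CARD('m) * (2 * D + 1))"
      using card_int_triples_le(2)[OF nn pos(3) sub] .
    also have "\<dots> \<le> (2 * Q) * ((6 * L * (Q * l)) ^ CARD('m) * (2 * (D + 1)))"
    proof (intro mult_mono power_mono)
      show "2 * (2 * (Q * l) * L) + 1 \<le> 6 * L * (Q * l)" using one by (simp add: mult_ac)
    qed (use one pos L in auto)
    also have "\<dots> = 4 * (6 * L) ^ CARD('m) * ((D + 1) * Q * (Q * l) ^ CARD('m))"
      by (simp add: power_mult_distrib algebra_simps)
    finally show ?thesis .
  qed
qed

section \<open>Grid points in balls and in sublevel sets\<close>

lemma card_grid_ball_le:
  fixes v :: "real^'m"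
  assumes "\<rho> > 0" "\<sigma> \<ge> 0"
  shows "finite {z. norm (\<rho> *\<^sub>R rvec z - v) \<le> \<sigma>}"
    and "real (card {z. norm (\<rho> *\<^sub>R rvec z - v) \<le> \<sigma>}) \<le> (2 * \<sigma> / \<rho> + 1) ^ CARD('m)"
proof -
  have sub: "{z. norm (\<rho> *\<^sub>R rvec z - v) \<le> \<sigma>} \<subseteq> {z. \<forall>i. \<bar>of_int (z i) - v $ i / \<rho>\<bar> \<le> \<sigma> / \<rho>}"
  proof safe
    fix z i assume "norm (\<rho> *\<^sub>R rvec z - v) \<le> \<sigma>"
    then have "\<bar>(\<rho> *\<^sub>R rvec z - v) $ i\<bar> \<le> \<sigma>" using component_le_norm_cart order_trans by blast
    then have *: "\<bar>\<rho> * of_int (z i) - v $ i\<bar> / \<rho> \<le> \<sigma> / \<rho>" using assms by (intro divide_right_mono) auto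
    have "of_int (z i) - v $ i / \<rho> = (\<rho> * of_int (z i) - v $ i) / \<rho>" using assms by (simp add: field_simps)
    with * show "\<bar>of_int (z i) - v $ i / \<rho>\<bar> \<le> \<sigma> / \<rho>" using assms by (simp add: abs_divide)
  qed
  have nn: "\<sigma> / \<rho> \<ge> 0" using assms by simp
  show "finite {z. norm (\<rho> *\<^sub>R rvec z - v) \<le> \<sigma>}"
    using finite_subset[OF sub card_int_box_le(1)[OF nn]] .
  have "real (card {z. norm (\<rho> *\<^sub>R rvec z - v) \<le> \<sigma>}) \<le> real (card {z. \<forall>i. \<bar>of_int (z i) - v $ i / \<rho>\<bar> \<le> \<sigma> / \<rho>})"
    using card_mono[OF card_int_box_le(1)[OF nn] sub] by simp
  also have "\<dots> \<le> (2 * (\<sigma> / \<rho>) + 1) ^ CARD('m)" by (rule card_int_box_le(2)[OF nn])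
  finally show "real (card {z. norm (\<rho> *\<^sub>R rvec z - v) \<le> \<sigma>}) \<le> (2 * \<sigma> / \<rho> + 1) ^ CARD('m)" by simp
qed

lemma card_grid_le:
  fixes U :: "(real^'m) set"
  assumes U: "\<And>x. x \<in> U \<Longrightarrow> norm x \<le> L" and L: "L \<ge> 0" and \<rho>: "0 < \<rho>" "\<rho> \<le> 1"
  shows "finite {z. \<rho> *\<^sub>R rvec z \<in> U}"
    and "real (card {z. \<rho> *\<^sub>R rvec z \<in> U}) \<le> ((2 * L + 1) / \<rho>) ^ CARD('m)"
proof -
  have sub: "{z. \<rho> *\<^sub>R rvec z \<in> U} \<subseteq> {z. norm (\<rho> *\<^sub>R rvec z - 0) \<le> L}"
    unfolding diff_0_right using U by blast
  note b = card_grid_ball_le[OF \<rho>(1) L, of "0 :: real^'m"]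
  show "finite {z. \<rho> *\<^sub>R rvec z \<in> U}" using finite_subset[OF sub b(1)] .
  have "real (card {z. \<rho> *\<^sub>R rvec z \<in> U}) \<le> (2 * L / \<rho> + 1) ^ CARD('m)"
    using card_mono[OF b(1) sub] b(2) by linarith
  also have "\<dots> \<le> ((2 * L + 1) / \<rho>) ^ CARD('m)"
    using \<rho> L by (intro power_mono) (auto simp: field_simps)
  finally show "real (card {z. \<rho> *\<^sub>R rvec z \<in> U}) \<le> ((2 * L + 1) / \<rho>) ^ CARD('m)" .
qed

lemma norm_axis_real: "norm (axis i y :: real^'m) = \<bar>y\<bar>"
proof -
  have "axis i y = (y *\<^sub>R axis i 1 :: real^'m)" by (auto simp: vec_eq_iff axis_def)
  then show ?thesis by simp
qed

text \<open>Along a coordinate in which the derivative of \<open>f\<close> does not vanish, suitable translates of a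
  sublevel set of \<open>\<bar>f\<bar>\<close> are disjoint.\<close>

lemma card_grid_sublevel_le:
  fixes U :: "(real^'m) set"
  assumes dp: "dual_pair U V f g p p' L" and \<rho>: "0 < \<rho>" "\<rho> \<le> 1" and \<eta>: "\<rho>\<^sup>2 \<le> 2 * \<eta>"
  shows "real (card {z. \<rho> *\<^sub>R rvec z \<in> U \<and> \<bar>f (\<rho> *\<^sub>R rvec z)\<bar> \<le> \<eta>})
     \<le> 6 * L\<^sup>2 * (2 * L + 3) ^ CARD('m) * (sqrt \<eta> / \<rho> ^ CARD('m))"
proof -
  note D = dual_pairD[OF dp]
  have L: "L \<ge> 1" and nU: "\<And>x. x \<in> U \<Longrightarrow> norm x \<le> L" using D(3,7) by auto
  have \<eta>0: "\<eta> > 0" using \<eta> \<rho> by (smt (verit) zero_less_power)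
  define G where "G = {z. \<rho> *\<^sub>R rvec z \<in> U \<and> \<bar>f (\<rho> *\<^sub>R rvec z)\<bar> \<le> \<eta>}"
  have Gsub: "G \<subseteq> {z. \<rho> *\<^sub>R rvec z \<in> U}" by (auto simp: G_def)
  have LL: "L \<ge> 0" using L by simp
  have gr: "finite {z. \<rho> *\<^sub>R rvec z \<in> U}" "real (card {z. \<rho> *\<^sub>R rvec z \<in> U}) \<le> ((2 * L + 1) / \<rho>) ^ CARD('m)"
    using card_grid_le[OF nU LL \<rho>] by auto
  have finG: "finite G" using finite_subset[OF Gsub gr(1)] by simp
  have "real (card G) \<le> 6 * L\<^sup>2 * sqrt \<eta> * ((2 * L + 3) / \<rho>) ^ CARD('m)"
  proof (cases "sqrt \<eta> < 1 / (4 * L)")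
    case False
    then have "1 \<le> 4 * L * sqrt \<eta>" using L by (simp add: field_simps)
    also have "\<dots> \<le> 6 * L\<^sup>2 * sqrt \<eta>"
      using L \<eta>0 by (intro mult_right_mono) (auto simp: power2_eq_square)
    finally have one: "1 \<le> 6 * L\<^sup>2 * sqrt \<eta>" .
    have "real (card G) \<le> ((2 * L + 1) / \<rho>) ^ CARD('m)"
      using card_mono[OF gr(1) Gsub] gr(2) by simp
    also have "\<dots> \<le> ((2 * L + 3) / \<rho>) ^ CARD('m)"
      using \<rho> L by (intro power_mono divide_right_mono) auto
    also have "\<dots> \<le> 6 * L\<^sup>2 * sqrt \<eta> * ((2 * L + 3) / \<rho>) ^ CARD('m)"
      using mult_right_mono[OF one, of "((2 * L + 3) / \<rho>) ^ CARD('m)"] \<rho> L by simp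
    finally show ?thesis .
  next
    case True
    obtain i where i: "\<And>x. x \<in> U \<Longrightarrow> \<bar>p x $ i\<bar> \<ge> 1 / L" using D(15) by auto
    \<comment> \<open>Translations must be multiples of \<rho>, which may exceed \<eta>; what is
      available is \<open>\<rho> \<le> 2 * sqrt \<eta>\<close>. Hence the translation step t is of
      size sqrt \<eta>, and the bound contains sqrt \<eta>.\<close>
    define T :: int where "T = \<lceil>sqrt \<eta> / \<rho>\<rceil>"
    define t where "t = \<rho> * of_int T"
    have Tge: "real_of_int T \<ge> sqrt \<eta> / \<rho>" "real_of_int T < sqrt \<eta> / \<rho> + 1" unfolding T_def by linarith+
    have t1: "t \<ge> sqrt \<eta>" using mult_left_mono[OF Tge(1), of \<rho>] \<rho> by (simp add: t_def)
    have tpos: "t > 0" using t1 \<eta>0 by (smt (verit) real_sqrt_gt_zero)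
    have "\<rho> \<le> sqrt (2 * \<eta>)" using \<eta> by (rule real_le_rsqrt)
    also have "\<dots> \<le> 2 * sqrt \<eta>" using \<eta>0 by (intro real_le_lsqrt) (auto simp: power_mult_distrib)
    finally have "\<rho> \<le> 2 * sqrt \<eta>" .
    moreover have "t < sqrt \<eta> + \<rho>" using mult_strict_left_mono[OF Tge(2), of \<rho>] \<rho> by (simp add: t_def algebra_simps)
    ultimately have t3: "t \<le> 3 * sqrt \<eta>" by simp
    \<comment> \<open>All K translations stay within 1 / (2 L^2), so the quadratic Taylor term is at
      most half of the linear one; K is at least a constant times 1 / sqrt \<eta>.\<close>
    define K where "K = nat \<lceil>1 / (2 * L\<^sup>2 * t)\<rceil>"
    have Kge: "real K \<ge> 1 / (2 * L\<^sup>2 * t)" and Klt: "real K < 1 / (2 * L\<^sup>2 * t) + 1"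
    proof -
      have "1 / (2 * L\<^sup>2 * t) > 0" using L tpos by simp
      then show "real K \<ge> 1 / (2 * L\<^sup>2 * t)" "real K < 1 / (2 * L\<^sup>2 * t) + 1" unfolding K_def by linarith+
    qed
    have kt: "real k * t \<le> 1 / (2 * L\<^sup>2)" if "k < K" for k
    proof -
      have "real k \<le> 1 / (2 * L\<^sup>2 * t)" using that Klt by linarith
      then have "real k * t \<le> 1 / (2 * L\<^sup>2 * t) * t" using tpos by (intro mult_right_mono) auto
      then show ?thesis using tpos by simp
    qed
    define \<tau> where "\<tau> = (\<lambda>(z::'m \<Rightarrow> int, k::nat). z(i := z i + int k * T))"
    have rv: "\<rho> *\<^sub>R rvec (\<tau> (z, k)) = \<rho> *\<^sub>R rvec z + axis i (real k * t)" for z k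
      by (auto simp: vec_eq_iff \<tau>_def axis_def t_def algebra_simps)
    \<comment> \<open>A translation by y changes f by at least y / (2 L), while two points of
      \<open>G\<close> differ by at most 2 \<eta> in value. As y \<ge> sqrt \<eta>, this would give
      sqrt \<eta> / L \<le> 4 \<eta>, contrary to sqrt \<eta> < 1 / (4 L).\<close>
    have separated: False if z: "z \<in> G" and z': "z' \<in> G" and e: "\<rho> *\<^sub>R rvec z' - \<rho> *\<^sub>R rvec z = axis i (real k * t)"
       and k: "k \<ge> 1" "k < K" for z z' k
    proof -
      let ?x = "\<rho> *\<^sub>R rvec z" and ?x' = "\<rho> *\<^sub>R rvec z'" and ?y = "real k * t"
      have x: "?x \<in> U" "?x' \<in> U" "\<bar>f ?x\<bar> \<le> \<eta>" "\<bar>f ?x'\<bar> \<le> \<eta>" using z z' by (auto simp: G_def)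
      have y: "?y \<ge> t" "?y > 0" using k tpos by auto
      have "\<bar>f ?x' - f ?x - p ?x \<bullet> axis i ?y\<bar> \<le> L * (norm (axis i ?y :: real^'m))\<^sup>2"
        using D(12)[OF x(1,2)] unfolding e .
      then have le: "\<bar>f ?x' - f ?x - p ?x $ i * ?y\<bar> \<le> L * ?y\<^sup>2"
        using y by (simp add: inner_axis norm_axis_real)
      have "?y / L \<le> \<bar>p ?x $ i\<bar> * ?y" using mult_right_mono[OF i[OF x(1)], of ?y] y by simp
      also have "\<dots> = \<bar>p ?x $ i * ?y\<bar>" using tpos by (simp add: abs_mult)
      finally have a: "?y / L \<le> \<bar>p ?x $ i * ?y\<bar>" .
      have "L * ?y\<^sup>2 = L * ?y * ?y" by (simp add: power2_eq_square)
      also have "\<dots> \<le> L * (1 / (2 * L\<^sup>2)) * ?y"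
        using kt[OF k(2)] y L by (intro mult_right_mono mult_left_mono) auto
      also have "\<dots> = ?y / L / 2" using L by (simp add: power2_eq_square)
      finally have b: "L * ?y\<^sup>2 \<le> ?y / L / 2" .
      have "Y / 2 \<le> 2 * \<eta>" if "\<bar>A - B - E\<bar> \<le> W" "W \<le> Y / 2" "Y \<le> \<bar>E\<bar>" "\<bar>B\<bar> \<le> \<eta>" "\<bar>A\<bar> \<le> \<eta>" for A B E W Y
        using that by linarith
      from this[OF le b a x(3,4)] have c: "?y / L / 2 \<le> 2 * \<eta>" .
      have "sqrt \<eta> / L \<le> t / L" using t1 L by (intro divide_right_mono) auto
      also have "\<dots> \<le> ?y / L" using y L by (intro divide_right_mono) auto
      also have "\<dots> = 2 * (?y / L / 2)" by simp
      also have "\<dots> \<le> 2 * (2 * \<eta>)" using c by (intro mult_left_mono) auto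
      also have "\<dots> = 4 * \<eta>" by simp
      also have "\<dots> = 4 * sqrt \<eta> * sqrt \<eta>" using \<eta>0 by simp
      also have "\<dots> < 4 * sqrt \<eta> * (1 / (4 * L))" using True \<eta>0 by (intro mult_strict_left_mono) auto
      finally show False by simp
    qed
    have inj: "inj_on \<tau> (G \<times> {..<K})"
    proof (rule inj_onI, clarify)
      fix z z' k k' assume z: "z \<in> G" "z' \<in> G" and k: "k < K" "k' < K" and e: "\<tau> (z, k) = \<tau> (z', k')"
      have e1: "\<rho> *\<^sub>R rvec z + axis i (real k * t) = \<rho> *\<^sub>R rvec z' + axis i (real k' * t)"
        using arg_cong[OF e, of "\<lambda>z. \<rho> *\<^sub>R rvec z"] by (simp add: rv)
      have ax: "axis i a - axis i b = (axis i (a - b) :: real^'m)" for a b :: real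
        by (auto simp: vec_eq_iff axis_def)
      have "k = k'"
      proof (rule linorder_cases[of k k'])
        assume "k < k'"
        have "\<rho> *\<^sub>R rvec z - \<rho> *\<^sub>R rvec z' = axis i (real k' * t) - axis i (real k * t)"
          using e1 by (simp add: algebra_simps)
        also have "\<dots> = axis i (real (k' - k) * t)" using \<open>k < k'\<close> by (simp add: ax of_nat_diff left_diff_distrib)
        finally show ?thesis using separated[OF z(2,1)] \<open>k < k'\<close> k by fastforce
      next
        assume "k' < k"
        have "\<rho> *\<^sub>R rvec z' - \<rho> *\<^sub>R rvec z = axis i (real k * t) - axis i (real k' * t)"
          using e1 by (simp add: algebra_simps)
        also have "\<dots> = axis i (real (k - k') * t)" using \<open>k' < k\<close> by (simp add: ax of_nat_diff left_diff_distrib)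
        finally show ?thesis using separated[OF z] \<open>k' < k\<close> k by fastforce
      qed
      moreover from this have "z = z'" using e unfolding \<tau>_def
        by (auto simp: fun_eq_iff split: if_splits)
      ultimately show "z = z' \<and> k = k'" by simp
    qed
    have img: "\<tau> ` (G \<times> {..<K}) \<subseteq> {z. norm (\<rho> *\<^sub>R rvec z - 0) \<le> L + 1}"
    proof clarify
      fix z k assume z: "z \<in> G" and k: "k < K"
      have "norm (\<rho> *\<^sub>R rvec (\<tau> (z, k))) \<le> norm (\<rho> *\<^sub>R rvec z) + norm (axis i (real k * t) :: real^'m)"
        unfolding rv by (rule norm_triangle_ineq)
      moreover have "norm (\<rho> *\<^sub>R rvec z) \<le> L" using nU z unfolding G_def by blast
      moreover have "norm (axis i (real k * t) :: real^'m) = real k * t" using tpos by (simp add: norm_axis_real)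
      moreover have "real k * t \<le> 1"
      proof -
        have "L\<^sup>2 \<ge> 1" using L by (rule one_le_power)
        then have "1 / (2 * L\<^sup>2) \<le> 1" by (subst divide_le_eq_1_pos) linarith+
        then show ?thesis using kt[OF k] by linarith
      qed
      ultimately show "norm (\<rho> *\<^sub>R rvec (\<tau> (z, k)) - 0) \<le> L + 1" by simp
    qed
    have L1: "L + 1 \<ge> 0" using L by simp
    have "real (card G) * real K = real (card (\<tau> ` (G \<times> {..<K})))"
      by (simp add: card_image[OF inj] card_cartesian_product)
    also have "\<dots> \<le> (2 * (L + 1) / \<rho> + 1) ^ CARD('m)"
      using card_mono[OF card_grid_ball_le(1)[OF \<rho>(1) L1] img] card_grid_ball_le(2)[OF \<rho>(1) L1, of "0 :: real^'m"] by linarith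
    also have "\<dots> \<le> ((2 * L + 3) / \<rho>) ^ CARD('m)"
      using \<rho> L by (intro power_mono) (auto simp: field_simps)
    finally have GK: "real (card G) * real K \<le> ((2 * L + 3) / \<rho>) ^ CARD('m)" .
    have "1 / (6 * L\<^sup>2 * sqrt \<eta>) \<le> 1 / (2 * L\<^sup>2 * t)"
      using t3 tpos L by (intro divide_left_mono) (auto intro!: mult_pos_pos simp: mult_ac \<eta>0)
    then have "real (card G) * (1 / (6 * L\<^sup>2 * sqrt \<eta>)) \<le> real (card G) * real K"
      using Kge by (intro mult_left_mono) auto
    also note GK
    finally show ?thesis using L \<eta>0 by (simp add: field_simps)
  qed
  then show ?thesis by (simp add: G_def power_divide mult_ac)
qed

subsection \<open>Duality\<close>

text \<open>The polar body is symmetric, so positive heights represent negative ones; at height 0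
  all remaining bounds are below 1 and leave only the zero vector.\<close>

lemma card_polar_cap_le:
  fixes X P :: "'m::finite \<Rightarrow> real"
  assumes "Q \<ge> 1" "R \<ge> 1" "D > 0"
  shows "card (polar_cap Q R D X F P) \<le> 1 + 2 * card {(k0, k, j). (k0, k, j) \<in> polar_cap Q R D X F P \<and> j \<ge> 1}"
proof -
  let ?K = "polar_cap Q R D X F P" and ?K1 = "{(k0, k, j). (k0, k, j) \<in> polar_cap Q R D X F P \<and> j \<ge> 1}"
  define \<nu> where "\<nu> = (\<lambda>(k0::int, k::'m \<Rightarrow> int, j::int). (- k0, (\<lambda>i. - k i), - j))"
  have fin: "finite ?K" using finite_polar_cap assms by (metis less_le_trans zero_less_one)
  have fin1: "finite ?K1" by (rule finite_subset[OF _ fin]) auto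
  have "?K \<subseteq> insert (0, (\<lambda>_. 0), 0) (?K1 \<union> \<nu> ` ?K1)"
  proof
    fix z assume z: "z \<in> ?K"
    obtain k0 k j where zz: "z = (k0, k, j)" by (cases z)
    consider "j \<ge> 1" | "j = 0" | "j \<le> -1" by linarith
    then show "z \<in> insert (0, (\<lambda>_. 0), 0) (?K1 \<union> \<nu> ` ?K1)"
    proof cases
      case 1
      then show ?thesis using z zz by simp
    next
      case 2
      have "k i = 0" for i
      proof -
        have "\<bar>real_of_int (k i)\<bar> \<le> 1 / (24 * real CARD('m) * R)"
          using z by (auto simp: zz polar_cap_def 2)
        also have "\<dots> < 1"
        proof -
          have "1 \<le> real CARD('m)" by (simp add: Suc_leI)
          then have "1 * 1 \<le> real CARD('m) * R" using assms by (intro mult_mono) auto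
          then have "1 < 24 * real CARD('m) * R" by linarith
          then show ?thesis by (subst divide_less_eq_1_pos) linarith+
        qed
        finally show ?thesis by linarith
      qed
      then have k: "k = (\<lambda>_. 0)" by auto
      have "\<bar>real_of_int k0\<bar> \<le> 1 / (48 * Q)" using z by (auto simp: zz polar_cap_def 2 k)
      also have "\<dots> < 1" using assms by (simp add: divide_less_eq)
      finally have "k0 = 0" by linarith
      then show ?thesis using zz k 2 by simp
    next
      case 3
      have eq: "\<nu> (- k0, (\<lambda>i. - k i), - j) = z" by (simp add: \<nu>_def zz)
      have "(- k0, (\<lambda>i. - k i), - j) \<in> ?K"
      proof -
        have a: "\<bar>- x - y\<bar> = \<bar>x + y\<bar>" "\<bar>- x - y - t\<bar> = \<bar>x + y + t\<bar>" for x y t :: real by linarith+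
        show ?thesis using z by (simp add: zz polar_cap_def sum_negf a add_ac)
      qed
      then have "(- k0, (\<lambda>i. - k i), - j) \<in> ?K1" using 3 by simp
      then have "\<nu> (- k0, (\<lambda>i. - k i), - j) \<in> \<nu> ` ?K1" by (rule imageI)
      then show ?thesis unfolding eq by blast
    qed
  qed
  then have "card ?K \<le> card (insert (0, (\<lambda>_. 0), 0) (?K1 \<union> \<nu> ` ?K1))"
    using fin1 by (intro card_mono) auto
  also have "\<dots> \<le> Suc (card (?K1 \<union> \<nu> ` ?K1))" by (rule card_insert_le_m1) auto
  also have "\<dots> \<le> Suc (card ?K1 + card (\<nu> ` ?K1))" using card_Un_le by auto
  also have "\<dots> \<le> Suc (card ?K1 + card ?K1)" using card_image_le[OF fin1] by auto
  finally show ?thesis by simp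
qed

text \<open>This treats the vertical vectors. In a coordinate where the gradient is bounded below,
  the middle condition of \<open>polar_cap\<close> makes j h at most L / (24 R). Then j h f x is at
  most 1 / 24 in absolute value, which forces k0 = 0, and the last condition puts x near the zero
  set of f.\<close>

lemma polar_cap_horizontal:
  fixes x :: "real^'m"
  assumes dp: "dual_pair U V f g p p' L" and x: "x \<in> U"
    and pos: "0 < h" "h \<le> l" "Q \<ge> 1" "R \<ge> L\<^sup>2" "j \<ge> 1"
    and k: "(k0, (\<lambda>_. 0), j) \<in> polar_cap Q R D (\<lambda>i. l * x $ i) (h * f x) (\<lambda>i. h / l * p x $ i)"
    and l1: "l \<le> 1"
  shows "k0 = 0" "\<bar>f x\<bar> \<le> 1 / (48 * Q * of_int j * h)"
proof -
  note d = dual_pairD[OF dp]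
  let ?m = "real CARD('m)"
  have m: "?m \<ge> 1" by (simp add: Suc_leI)
  have L: "L \<ge> 1" by (rule d(3))
  have "1 \<le> L\<^sup>2" using L by (rule one_le_power)
  then have R: "R \<ge> 1" using pos by linarith
  have l: "l > 0" using pos by simp
  have j: "real_of_int j \<ge> 1" using pos by simp
  obtain i where i: "\<bar>p x $ i\<bar> \<ge> 1 / L" using d(15) x by auto
  have A: "\<bar>of_int j * (h / l * p x $ i)\<bar> \<le> 1 / (24 * ?m * R)" and B: "\<bar>of_int k0 + of_int j * (h * f x)\<bar> \<le> 1 / (48 * Q)"
    using k by (auto simp: polar_cap_def)
  have "of_int j * (h / l) * (1 / L) \<le> of_int j * (h / l) * \<bar>p x $ i\<bar>"
    using j pos l i by (intro mult_left_mono) auto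
  also have "\<dots> = \<bar>of_int j * (h / l * p x $ i)\<bar>" using j pos l by (simp add: abs_mult)
  also have "\<dots> \<le> 1 / (24 * ?m * R)" by (rule A)
  also have "\<dots> \<le> 1 / (24 * 1 * R)" using m R by (intro divide_left_mono mult_mono) auto
  finally have "of_int j * (h / l) * (1 / L) * L \<le> 1 / (24 * 1 * R) * L" using L by (intro mult_right_mono) auto
  then have "of_int j * (h / l) \<le> L / (24 * R)" using L by simp
  then have "of_int j * (h / l) * l \<le> L / (24 * R) * 1" using l l1 R L by (intro mult_mono) auto
  then have jh: "of_int j * h \<le> L / (24 * R)" using l by simp
  have "\<bar>of_int j * (h * f x)\<bar> = of_int j * h * \<bar>f x\<bar>" using j pos by (simp add: abs_mult)
  also have "\<dots> \<le> L / (24 * R) * L" using jh d(9)[OF x] R L pos j by (intro mult_mono) auto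
  also have "\<dots> = L\<^sup>2 / (24 * R)" by (simp add: power2_eq_square)
  also have "\<dots> \<le> R / (24 * R)" using pos R by (intro divide_right_mono) auto
  also have "\<dots> = 1 / 24" using R by simp
  finally have "\<bar>of_int j * (h * f x)\<bar> \<le> 1 / 24" .
  moreover have "1 / (48 * Q) \<le> 1 / 48" using pos by simp
  ultimately have "\<bar>real_of_int k0\<bar> < 1" using B by linarith
  then show "k0 = 0" by linarith
  then have "of_int j * h * \<bar>f x\<bar> \<le> 1 / (48 * Q)" using B j pos by (simp add: abs_mult mult_ac)
  then show "\<bar>f x\<bar> \<le> 1 / (48 * Q * of_int j * h)" using j pos by (simp add: field_simps)
qed

text \<open>The middle condition of \<open>polar_cap\<close> puts y near the gradient
  \<open>p x\<close>, so y is the gradient of f at a nearby point x' = \<open>p' y\<close>. By the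
  Legendre identity the last linear form equals k0 - j h g y plus j h times the Taylor remainder of
  f at x', which is quadratic in x - x'.\<close>

lemma polar_cap_dual:
  fixes x :: "real^'m"
  assumes dp: "dual_pair U V f g p p' L" and x: "x \<in> U"
    and pos: "0 < h" "0 < l" "Q \<ge> 1" "R \<ge> 1" "j \<ge> 1"
    and k: "(k0, k, j) \<in> polar_cap Q R D (\<lambda>i. l * x $ i) (h * f x) (\<lambda>i. h / l * p x $ i)"
    and nz: "k \<noteq> (\<lambda>_. 0)"
  defines "y \<equiv> rvec (\<lambda>i. - k i) /\<^sub>R (of_int j * (h / l))"
  shows "norm (y - p x) \<le> L / (12 * R)"
    and "y \<in> V \<Longrightarrow> norm (x - p' y) \<le> L * l / (24 * R * of_int j * h)"
    and "y \<in> V \<Longrightarrow> \<bar>of_int k0 - of_int j * h * g y\<bar> \<le> 1 / (48 * Q) + of_int j * h * (L * (L * l / (24 * R * of_int j * h))\<^sup>2)"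
proof -
  note d = dual_pairD[OF dp]
  define m where "m = real CARD('m)"
  have m: "m \<ge> 1" by (simp add: m_def Suc_leI)
  have L: "L \<ge> 1" by (rule d(3))
  have j: "real_of_int j \<ge> 1" using pos by simp
  define c where "c = of_int j * (h / l)"
  have c: "c > 0" using j pos by (simp add: c_def)
  have A: "\<bar>of_int (k i) + c * p x $ i\<bar> \<le> 1 / (24 * m * R)" for i
    using k by (auto simp: polar_cap_def m_def c_def mult.assoc)
  have B: "\<bar>of_int k0 + (\<Sum>i\<in>UNIV. of_int (k i) * (l * x $ i)) + of_int j * (h * f x)\<bar> \<le> 1 / (48 * Q)"
    using k by (auto simp: polar_cap_def)
  have yc: "c *\<^sub>R y = rvec (\<lambda>i. - k i)" using c unfolding y_def c_def[symmetric] by simp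
  have "c * norm (y - p x) = norm (c *\<^sub>R (y - p x))" using c by simp
  also have "\<dots> \<le> (\<Sum>i\<in>UNIV. \<bar>(c *\<^sub>R (y - p x)) $ i\<bar>)" by (rule norm_le_l1_cart)
  also have "\<dots> \<le> (\<Sum>i\<in>(UNIV::'m set). 1 / (24 * m * R))"
  proof (rule sum_mono)
    fix i
    have "(c *\<^sub>R (y - p x)) $ i = - (of_int (k i) + c * p x $ i)"
      by (simp add: scaleR_diff_right yc)
    then show "\<bar>(c *\<^sub>R (y - p x)) $ i\<bar> \<le> 1 / (24 * m * R)" using A[of i] by (simp only: abs_minus_cancel)
  qed
  also have "\<dots> = 1 / (24 * R)" using m by (simp add: m_def[symmetric])
  finally have c_le: "c * norm (y - p x) \<le> 1 / (24 * R)" .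
  then have "c * norm (y - p x) / c \<le> 1 / (24 * R) / c" using c by (intro divide_right_mono) auto
  then have near: "norm (y - p x) \<le> 1 / (24 * R * c)" using c by simp
  \<comment> \<open>A nonzero integer coordinate forces c L \<ge> 1 / 2, so dividing by c costs at
    most 2 L and the distance from y to \<open>p x\<close> is controlled by R alone.\<close>
  obtain i where "k i \<noteq> 0" using nz by auto
  then have "\<bar>real_of_int (k i)\<bar> \<ge> 1" by linarith
  moreover have "1 / (24 * m * R) \<le> 1 / 24"
  proof -
    have "1 * 1 \<le> m * R" using m pos by (intro mult_mono) auto
    then show ?thesis by (simp add: divide_le_eq mult.assoc)
  qed
  ultimately have "1 / 2 \<le> \<bar>c * p x $ i\<bar>" using A[of i] by linarith
  also have "\<dots> = c * \<bar>p x $ i\<bar>" using c by (simp add: abs_mult)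
  also have "\<dots> \<le> c * L" using c d(8)[OF x] component_le_norm_cart[of "p x" i] by (intro mult_left_mono) auto
  finally have "1 \<le> c * (2 * L)" by simp
  then have "1 * norm (y - p x) \<le> (c * (2 * L)) * norm (y - p x)" by (intro mult_right_mono) auto
  also have "\<dots> = 2 * L * (c * norm (y - p x))" by simp
  also have "\<dots> \<le> 2 * L * (1 / (24 * R))" using c_le L by (intro mult_left_mono) auto
  finally show "norm (y - p x) \<le> L / (12 * R)" by simp
  assume y: "y \<in> V"
  define x' where "x' = p' y"
  have x': "x' \<in> U" "p x' = y" using d(13,14)[OF y] by (auto simp: x'_def)
  have "norm (x - x') \<le> L * norm (p x - p x')" using d(11)[OF x x'(1)] .
  also have "\<dots> \<le> L * (1 / (24 * R * c))" using near L by (intro mult_left_mono) (auto simp: x' norm_minus_commute)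
  also have "\<dots> = L * l / (24 * R * of_int j * h)" using pos by (simp add: c_def)
  finally have xx: "norm (x - x') \<le> L * l / (24 * R * of_int j * h)" .
  then show "norm (x - p' y) \<le> L * l / (24 * R * of_int j * h)" by (simp add: x'_def)
  have gy: "g y = x' \<bullet> y - f x'" using d(6)[OF x'(1)] x'(2) by simp
  have "(\<Sum>i\<in>UNIV. of_int (k i) * (l * x $ i)) = - l * (rvec (\<lambda>i. - k i) \<bullet> x)"
    by (simp add: inner_vec_def sum_distrib_left sum_negf mult_ac)
  also have "\<dots> = - (l * c) * (y \<bullet> x)" by (simp add: yc[symmetric])
  also have "l * c = of_int j * h" using pos by (simp add: c_def)
  finally have "of_int k0 + (\<Sum>i\<in>UNIV. of_int (k i) * (l * x $ i)) + of_int j * (h * f x)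
     = (of_int k0 - of_int j * h * g y) + of_int j * h * (f x - f x' - p x' \<bullet> (x - x'))"
    by (simp add: gy x'(2) algebra_simps inner_commute)
  then have "of_int k0 - of_int j * h * g y = (of_int k0 + (\<Sum>i\<in>UNIV. of_int (k i) * (l * x $ i)) + of_int j * (h * f x))
     - of_int j * h * (f x - f x' - p x' \<bullet> (x - x'))" by linarith
  also have "\<bar>\<dots>\<bar> \<le> 1 / (48 * Q) + of_int j * h * (L * (L * l / (24 * R * of_int j * h))\<^sup>2)"
  proof -
    have "\<bar>of_int j * h * (f x - f x' - p x' \<bullet> (x - x'))\<bar> = of_int j * h * \<bar>f x - f x' - p x' \<bullet> (x - x')\<bar>"
      using j pos by (simp add: abs_mult)
    also have "\<dots> \<le> of_int j * h * (L * (norm (x - x'))\<^sup>2)"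
      using d(12)[OF x'(1) x] j pos by (intro mult_left_mono) auto
    also have "\<dots> \<le> of_int j * h * (L * (L * l / (24 * R * of_int j * h))\<^sup>2)"
      using xx j pos L by (intro mult_left_mono power_mono) auto
    finally show ?thesis using B by linarith
  qed
  finally show "\<bar>of_int k0 - of_int j * h * g y\<bar> \<le> 1 / (48 * Q) + of_int j * h * (L * (L * l / (24 * R * of_int j * h))\<^sup>2)" .
qed

lemma sum_card_swap:
  assumes "finite A" "finite B"
  shows "(\<Sum>x\<in>A. card {y \<in> B. P x y}) = (\<Sum>y\<in>B. card {x \<in> A. P x y})"
  using sum.swap_restrict[OF assms, of "\<lambda>_ _. 1::nat" P] by simp

lemma sum_inverse_sqrt_le: "(\<Sum>j=1..n. 1 / sqrt (real j)) \<le> 2 * sqrt (real n)"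
proof (induction n)
  case (Suc n)
  have "1 \<le> 2 * sqrt (Suc n) * (sqrt (Suc n) - sqrt n)"
  proof -
    have "0 \<le> (sqrt (Suc n) - sqrt n)\<^sup>2" by simp
    also have "\<dots> = 2 * sqrt (Suc n) * (sqrt (Suc n) - sqrt n) - 1"
      by (simp add: power2_eq_square algebra_simps)
    finally show ?thesis by simp
  qed
  then have "1 / sqrt (Suc n) \<le> 2 * (sqrt (Suc n) - sqrt n)"
    by (subst divide_le_eq) (auto simp: algebra_simps)
  then show ?case using Suc by simp
qed simp

text \<open>The radius satisfies \<open>Q * h * \<rho>\<^sup>2 = D\<close>, so over a cap the
  second-order Taylor error has the same order D as the thickness of the neighbourhood. With
  \<open>card_cap_le\<close> for each cap, the three summands collect the zero vectors, the vertical
  vectors and the dual points of all polar bodies. The conditions on \<rho> keep the cap centres in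
  U, those on R keep the dual points in \<open>S2\<close> and exclude k0 \<noteq> 0 for vertical
  vectors.\<close>

lemma cone_duality:
  fixes S :: "(real^'m) set"
  assumes dp: "dual_pair U V f g p p' L"
    and e: "e > 0" "(\<Union>x\<in>S. cball x e) \<subseteq> U"
    and S2: "\<And>x. x \<in> (\<Union>x\<in>S. cball x e) \<Longrightarrow> cball (p x) e' \<subseteq> S2" "S2 \<subseteq> V"
    and pos: "0 < h" "h \<le> l" "l \<le> 1" "Q \<ge> 1" "D > 0"
    and \<rho>: "\<rho> = sqrt (D / (Q * h))" "\<rho> \<le> 1" "real CARD('m) * \<rho> \<le> e"
    and R: "R = 2 * Q * l * \<rho>" "L\<^sup>2 \<le> R" "L / (12 * R) \<le> e'"
    and m: "m = CARD('m)"
  shows "real (card (near_cone f S l h Q D)) \<le>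
     4 * 48 * (48 * real m) ^ m * 96 * ((1 + 2 * L * (real m)\<^sup>2) * D * R ^ m * Q) *
     (((2 * L + 1) / \<rho>) ^ m + 2 * (6 * L\<^sup>2 * (2 * L + 3) ^ m) / (\<rho> ^ m * sqrt (D * Q * h))
       + 2 * (\<Sum>i\<in>{i::nat. 2 ^ i * D \<le> 1}. (2 * L / (D * 2 ^ i)) ^ m
            * real (card (near_cone g S2 (h / l) h (2 ^ i) (L ^ 3 / (Q * D * 2 ^ i))))))"
proof -
  note d = dual_pairD[OF dp]
  have L: "L \<ge> 1" by (rule d(3))
  have m1: "real m \<ge> 1" by (simp add: m Suc_leI)
  have l: "l > 0" using pos by simp
  have \<rho>0: "\<rho> > 0" using pos by (simp add: \<rho>)
  have Qh: "Q * h * \<rho>\<^sup>2 = D" using pos by (simp add: \<rho>)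
  have "1 \<le> L\<^sup>2" using L by (rule one_le_power)
  then have R1: "R \<ge> 1" using R by linarith
  define S1 where "S1 = (\<Union>x\<in>S. cball x e)"
  have S1U: "S1 \<subseteq> U" using e by (simp add: S1_def)
  \<comment> \<open>Thickness of a cap around its tangent plane: D plus the Taylor error 2 Q h L (m
    \<rho>)^2 = 2 L m^2 D.\<close>
  define D' where "D' = (1 + 2 * L * (real m)\<^sup>2) * D"
  have "1 + 0 \<le> 1 + 2 * L * (real m)\<^sup>2" using L by (intro add_left_mono) auto
  then have D'D: "D \<le> D'" unfolding D'_def using mult_right_mono[of 1 "1 + 2 * L * (real m)\<^sup>2" D] pos by simp
  have D'0: "D' > 0" using D'D pos by linarith
  define X where "X = {z. \<rho> *\<^sub>R rvec z \<in> S1}"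
  have nS1: "norm x \<le> L" if "x \<in> S1" for x using that d(7) S1U by blast
  have L0: "L \<ge> 0" using L by simp
  have finX: "finite X" and cardX: "real (card X) \<le> ((2 * L + 1) / \<rho>) ^ m"
    unfolding X_def m by (rule card_grid_le[OF nS1 L0 \<rho>0 \<rho>(2)]; assumption)+
  obtain i0 where "\<forall>x\<in>U. \<bar>x $ i0\<bar> \<ge> 1 / L" using d(16) by auto
  then have trivS: "norm x \<le> L \<and> \<bar>x $ i0\<bar> \<ge> 1 / L" if "x \<in> S" for x
    using that d(7) e by (metis S1U S1_def UN_iff centre_in_cball less_imp_le subsetD)
  note d' = dual_pairD[OF dual_pair_swap[OF dp]]
  obtain i1 where "\<forall>x\<in>V. \<bar>x $ i1\<bar> \<ge> 1 / L" using d'(16) by auto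
  then have trivS2: "norm x \<le> L \<and> \<bar>x $ i1\<bar> \<ge> 1 / L" if "x \<in> S2" for x
    using that d'(7) S2(2) by blast
  define Nr where "Nr = near_cone f S l h Q D"
  have finNr: "finite Nr" unfolding Nr_def by (rule near_cone_trivial(1)[OF L trivS]) (use pos l in auto)
  define slope where "slope = (\<lambda>(q, a :: 'm \<Rightarrow> int, b::int). rvec a /\<^sub>R (real_of_int q * l))"
  define A where "A = (\<lambda>z. {t \<in> Nr. \<forall>i. \<bar>slope t $ i - (\<rho> *\<^sub>R rvec z) $ i\<bar> \<le> \<rho>})"
  define K where "K = (\<lambda>z::'m \<Rightarrow> int. polar_cap Q R D' (\<lambda>i. l * (\<rho> *\<^sub>R rvec z) $ i) (h * f (\<rho> *\<^sub>R rvec z))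
      (\<lambda>i. h / l * p (\<rho> *\<^sub>R rvec z) $ i))"
  have dist: "norm (y - \<rho> *\<^sub>R rvec z) \<le> real m * \<rho>" if "\<forall>i. \<bar>y $ i - (\<rho> *\<^sub>R rvec z) $ i\<bar> \<le> \<rho>" for y :: "real^'m" and z
  proof -
    have "norm (y - \<rho> *\<^sub>R rvec z) \<le> (\<Sum>i\<in>UNIV. \<bar>(y - \<rho> *\<^sub>R rvec z) $ i\<bar>)" by (rule norm_le_l1_cart)
    also have "\<dots> \<le> (\<Sum>i\<in>(UNIV::'m set). \<rho>)" by (rule sum_mono) (use that in simp)
    finally show ?thesis by (simp add: m)
  qed
  have "Nr \<subseteq> (\<Union>z\<in>X. A z)"
  proof
    fix t assume t: "t \<in> Nr"
    define y where "y = slope t"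
    have yS: "y \<in> S" using t by (auto simp: Nr_def near_cone_def y_def slope_def)
    define z where "z = (\<lambda>i. round (y $ i / \<rho>))"
    have c: "\<bar>y $ i - (\<rho> *\<^sub>R rvec z) $ i\<bar> \<le> \<rho>" for i
    proof -
      have "\<bar>y $ i / \<rho> - of_int (z i)\<bar> \<le> 1" unfolding z_def using of_int_round_abs_le[of "y $ i / \<rho>"]
        by (simp add: abs_minus_commute)
      then have "\<rho> * \<bar>y $ i / \<rho> - of_int (z i)\<bar> \<le> \<rho> * 1" using \<rho>0 by (intro mult_left_mono) auto
      also have "\<rho> * \<bar>y $ i / \<rho> - of_int (z i)\<bar> = \<bar>\<rho> * (y $ i / \<rho> - of_int (z i))\<bar>" using \<rho>0 by (simp add: abs_mult)
      also have "\<rho> * (y $ i / \<rho> - of_int (z i)) = y $ i - (\<rho> *\<^sub>R rvec z) $ i" using \<rho>0 by (simp add: right_diff_distrib)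
      finally show ?thesis by simp
    qed
    then have "norm (y - \<rho> *\<^sub>R rvec z) \<le> e" using dist[of y z] \<rho>(3) by (simp add: m)
    then have "\<rho> *\<^sub>R rvec z \<in> S1" unfolding S1_def using yS by (auto simp: dist_norm)
    moreover have "t \<in> A z" using c t by (simp add: A_def y_def)
    ultimately show "t \<in> (\<Union>z\<in>X. A z)" by (auto simp: X_def)
  qed
  then have "card Nr \<le> card (\<Union>z\<in>X. A z)"
    using finX finNr by (intro card_mono) (auto simp: A_def)
  also have "\<dots> \<le> (\<Sum>z\<in>X. card (A z))" by (rule card_UN_le[OF finX])
  finally have cardNr: "real (card Nr) \<le> (\<Sum>z\<in>X. real (card (A z)))" by (metis of_nat_le_iff of_nat_sum)
  have cardA: "real (card (A z)) \<le> 4 * 48 * (48 * real m) ^ m * 96 * (D' * R ^ m * Q) * card (K z)" if z: "z \<in> X" for z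
    unfolding K_def m
  proof (rule card_cap_le)
    show "Q > 0" "R > 0" "D' > 0" using pos R1 D'0 by auto
    show "finite (A z)" using finNr by (simp add: A_def)
    fix q a b assume t: "(q, a, b) \<in> A z"
    define x where "x = \<rho> *\<^sub>R rvec z"
    define y where "y = rvec a /\<^sub>R (real_of_int q * l)"
    have q: "Q \<le> of_int q" "of_int q \<le> 2 * Q" and yS: "y \<in> S" and b: "\<bar>of_int b - of_int q * h * f y\<bar> \<le> D"
      and c: "\<forall>i. \<bar>y $ i - x $ i\<bar> \<le> \<rho>"
      using t by (auto simp: A_def Nr_def near_cone_def slope_def y_def x_def)
    have q0: "real_of_int q > 0" using q pos by linarith
    have x: "x \<in> U" using z S1U by (auto simp: X_def x_def)
    have "y \<in> cball y e" using e(1) by simp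
    then have y: "y \<in> U" using yS e(2) by blast
    have "(of_int q * l) * inverse (of_int q * l) = 1" using q0 l by (intro right_inverse) simp
    then have ql: "rvec a = (of_int q * l) *\<^sub>R y"
      unfolding y_def by (simp only: scaleR_scaleR scaleR_one)
    have a: "of_int (a i) - of_int q * (l * x $ i) = of_int q * l * (y $ i - x $ i)" for i
      using arg_cong[OF ql, of "\<lambda>v. v $ i"] by (simp add: algebra_simps)
    have "\<bar>of_int q * l * (y $ i - x $ i)\<bar> \<le> R" for i
    proof -
      have "\<bar>of_int q * l * (y $ i - x $ i)\<bar> = of_int q * l * \<bar>y $ i - x $ i\<bar>" using q0 l by (simp add: abs_mult)
      also have "\<dots> \<le> (2 * Q) * l * \<rho>" using q q0 l c by (intro mult_mono) auto
      finally show ?thesis by (simp add: R)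
    qed
    moreover have "\<bar>of_int q\<bar> \<le> 2 * Q" using q q0 by simp
    moreover have "\<bar>of_int b - of_int q * (h * f x) - (\<Sum>i\<in>UNIV. h / l * p x $ i * (of_int q * l * (y $ i - x $ i)))\<bar> \<le> D'"
    proof -
      have "(\<Sum>i\<in>UNIV. h / l * p x $ i * (of_int q * l * (y $ i - x $ i))) = of_int q * h * (p x \<bullet> (y - x))"
        using l by (simp add: inner_vec_def sum_distrib_left mult_ac)
      then have "of_int b - of_int q * (h * f x) - (\<Sum>i\<in>UNIV. h / l * p x $ i * (of_int q * l * (y $ i - x $ i)))
        = (of_int b - of_int q * h * f y) + of_int q * h * (f y - f x - p x \<bullet> (y - x))"
        by (simp add: algebra_simps)
      also have "\<bar>\<dots>\<bar> \<le> D + (2 * Q) * h * (L * (real m * \<rho>)\<^sup>2)"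
      proof -
        have "\<bar>of_int q * h * (f y - f x - p x \<bullet> (y - x))\<bar> = of_int q * h * \<bar>f y - f x - p x \<bullet> (y - x)\<bar>"
          using q0 pos by (simp add: abs_mult)
        also have "\<dots> \<le> (2 * Q) * h * (L * (norm (y - x))\<^sup>2)"
          using q q0 pos d(12)[OF x y] by (intro mult_mono) auto
        also have "\<dots> \<le> (2 * Q) * h * (L * (real m * \<rho>)\<^sup>2)"
          using dist[of y z] c pos L by (intro mult_left_mono power_mono) (auto simp: x_def)
        finally show ?thesis using b by linarith
      qed
      also have "D + (2 * Q) * h * (L * (real m * \<rho>)\<^sup>2) = D + 2 * L * (real m)\<^sup>2 * (Q * h * \<rho>\<^sup>2)"
        by (simp add: power_mult_distrib)
      also have "\<dots> = D'" unfolding Qh D'_def by (simp add: distrib_right)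
      finally show ?thesis .
    qed
    ultimately show "\<bar>of_int q\<bar> \<le> 2 * Q \<and> (\<forall>i. \<bar>of_int (a i) - of_int q * (l * (\<rho> *\<^sub>R rvec z) $ i)\<bar> \<le> R)
        \<and> \<bar>of_int b - of_int q * (h * f (\<rho> *\<^sub>R rvec z)) - (\<Sum>i\<in>UNIV. h / l * p (\<rho> *\<^sub>R rvec z) $ i
             * (of_int (a i) - of_int q * (l * (\<rho> *\<^sub>R rvec z) $ i)))\<bar> \<le> D'"
      unfolding x_def[symmetric] a by blast
  qed
  define I where "I = {i::nat. 2 ^ i * D \<le> 1}"
  define n where "n = nat \<lfloor>1 / (24 * D')\<rfloor>"
  have n_le: "real n \<le> 1 / (24 * D')" unfolding n_def using D'0 by simp
  define \<eta> where "\<eta> = (\<lambda>j::nat. 1 / (48 * Q * real j * h))"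
  define W where "W = (\<lambda>i::nat. near_cone g S2 (h / l) h (2 ^ i) (L ^ 3 / (Q * D * 2 ^ i)))"
  define \<sigma> where "\<sigma> = (\<lambda>i::nat. L * l / (24 * R * 2 ^ i * h))"
  define base where "base = (\<lambda>(j, a :: 'm \<Rightarrow> int, b::int). p' (rvec a /\<^sub>R (real_of_int j * (h / l))) :: real^'m)"
  have finI: "finite I"
  proof -
    obtain N :: nat where N: "1 / D < 2 ^ N" using real_arch_pow[of 2 "1 / D"] by auto
    have "I \<subseteq> {..N}"
    proof
      fix i assume "i \<in> I"
      then have "2 ^ i \<le> 1 / D" using pos by (simp add: I_def field_simps)
      then have "(2::real) ^ i < 2 ^ N" using N by linarith
      then show "i \<in> {..N}" by simp
    qed
    then show ?thesis using finite_subset by blast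
  qed
  have finW: "finite (W i)" for i
    unfolding W_def by (rule near_cone_trivial(1)[OF L trivS2]) (use pos l L in auto)
  \<comment> \<open>A vertical vector is recorded by its height j, a dual point by its dyadic range
    2^i \<le> j < 2^(i+1). The first condition of \<open>polar_cap\<close> gives j \<le> 1 / (24
    D'), which confines i to \<open>I\<close>.\<close>
  have Kpos: "card {(k0, k, j). (k0, k, j) \<in> K z \<and> j \<ge> 1}
      \<le> card {j \<in> {1..n}. \<bar>f (\<rho> *\<^sub>R rvec z)\<bar> \<le> \<eta> j} + (\<Sum>i\<in>I. card {t \<in> W i. norm (\<rho> *\<^sub>R rvec z - base t) \<le> \<sigma> i})"
    if z: "z \<in> X" for z
  proof -
    define x where "x = \<rho> *\<^sub>R rvec z"
    have xS1: "x \<in> S1" and x: "x \<in> U" using z S1U by (auto simp: X_def x_def)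
    define E where "E = {j \<in> {1..n}. \<bar>f x\<bar> \<le> \<eta> j}"
    define G where "G = (\<lambda>i. {t \<in> W i. norm (x - base t) \<le> \<sigma> i})"
    have "{(k0, k, j). (k0, k, j) \<in> K z \<and> j \<ge> 1}
       \<subseteq> (\<lambda>j::nat. (0, (\<lambda>_. 0), int j)) ` E \<union> (\<lambda>(j, a, b). (b, (\<lambda>i. - a i), j)) ` (\<Union>i\<in>I. G i)"
    proof clarify
      fix k0 k j assume k: "(k0, k, j) \<in> K z" and j: "j \<ge> (1::int)"
        and not: "(k0, k, j) \<notin> (\<lambda>(j, a, b). (b, (\<lambda>i. - a i), j)) ` (\<Union>i\<in>I. G i)"
      have k': "(k0, k, j) \<in> polar_cap Q R D' (\<lambda>i. l * x $ i) (h * f x) (\<lambda>i. h / l * p x $ i)"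
        using k by (simp add: K_def x_def)
      have jr: "real_of_int j \<ge> 1" using j by simp
      have jD: "real_of_int j \<le> 1 / (24 * D')" using k' j by (auto simp: polar_cap_def)
      also have "\<dots> \<le> 1 / (24 * D)" using D'D pos by (intro divide_left_mono) auto
      finally have jD2: "24 * (real_of_int j * D) \<le> 1" using pos by (simp add: field_simps)
      show "(k0, k, j) \<in> (\<lambda>j::nat. (0, (\<lambda>_. 0), int j)) ` E"
      proof (cases "k = (\<lambda>_. 0)")
        case True
        note hz = polar_cap_horizontal[OF dp x pos(1,2,4) R(2) j k'[unfolded True] pos(3)]
        have "j \<le> \<lfloor>1 / (24 * D')\<rfloor>" using jD by (simp only: le_floor_iff)
        then have "nat j \<le> n" unfolding n_def by (rule nat_mono)
        moreover have "\<bar>f x\<bar> \<le> \<eta> (nat j)" using hz(2) j by (simp add: \<eta>_def)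
        ultimately have "nat j \<in> E" using j by (simp add: E_def)
        then show ?thesis using hz(1) True j by (intro image_eqI[of _ _ "nat j"]) auto
      next
        case False
        define y where "y = rvec (\<lambda>i. - k i) /\<^sub>R (of_int j * (h / l))"
        note du = polar_cap_dual[OF dp x pos(1) l pos(4) R1 j k' False, folded y_def]
        have "y \<in> cball (p x) e'" using du(1) R(3) by (simp add: dist_norm norm_minus_commute)
        then have yS2: "y \<in> S2" using S2(1) xS1 unfolding S1_def by blast
        then have yV: "y \<in> V" using S2(2) by blast
        have "\<exists>i. 2 ^ i \<le> nat j \<and> nat j < 2 ^ (i + 1)" using j by (intro ex_power_ivl1) auto
        then obtain i where i: "2 ^ i \<le> nat j" "nat j < 2 ^ (i + 1)" by blast
        have "real (2 ^ i) \<le> real (nat j)" "real (nat j) \<le> real (2 ^ (i + 1))"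
          using i by (simp_all only: of_nat_le_iff less_imp_le)
        then have ij: "2 ^ i \<le> real_of_int j" "real_of_int j \<le> 2 * 2 ^ i" using j by auto
        have iD: "24 * (2 ^ i * D) \<le> 1"
          using jD2 mult_right_mono[OF ij(1), of D] pos by linarith
        then have iI: "i \<in> I" using pos by (simp add: I_def)
        have "L * l / (24 * R * of_int j * h) \<le> \<sigma> i" unfolding \<sigma>_def
          using ij R1 l L pos jr by (intro divide_left_mono mult_right_mono mult_left_mono mult_pos_pos) auto
        then have near: "norm (x - p' y) \<le> \<sigma> i" using du(2)[OF yV] by linarith
        \<comment> \<open>With \<open>Q * h * \<rho>\<^sup>2 = D\<close> the Taylor error becomes
          L^3 / (2304 Q D j), and 1 / (48 Q) is absorbed because D 2^i \<le> 1.\<close>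
        have "\<bar>of_int k0 - of_int j * h * g y\<bar> \<le> 1 / (48 * Q) + of_int j * h * (L * (L * l / (24 * R * of_int j * h))\<^sup>2)"
          by (rule du(3)[OF yV])
        also have "L * l / (24 * R * of_int j * h) = L / (48 * Q * \<rho> * of_int j * h)" using l by (simp add: R)
        also have "of_int j * h * (L * (L / (48 * Q * \<rho> * of_int j * h))\<^sup>2) = L ^ 3 / (2304 * (Q * (Q * h * \<rho>\<^sup>2) * of_int j))"
          using pos jr by (simp add: power2_eq_square power3_eq_cube mult_ac)
        also have "\<dots> = L ^ 3 / (2304 * (Q * D * of_int j))" by (simp add: Qh)
        also have "\<dots> \<le> L ^ 3 / (2304 * (Q * D * 2 ^ i))"
          using ij pos L jr by (intro divide_left_mono mult_left_mono mult_pos_pos) auto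
        also have "1 / (48 * Q) + L ^ 3 / (2304 * (Q * D * 2 ^ i)) \<le> L ^ 3 / (Q * D * 2 ^ i)"
        proof -
          define u where "u = L ^ 3 / (Q * D * 2 ^ i)"
          have "L ^ 3 \<ge> 1" using L by (rule one_le_power)
          moreover have "Q * (D * 2 ^ i) \<le> Q * 1" using iD pos by (intro mult_left_mono) (auto simp: mult.commute)
          ultimately have "1 / (Q * 1) \<le> L ^ 3 / (Q * (D * 2 ^ i))" using pos L by (intro frac_le) auto
          then have "1 / Q \<le> u" by (simp add: u_def mult.assoc)
          moreover have "1 / (48 * Q) = (1 / Q) / 48" "L ^ 3 / (2304 * (Q * D * 2 ^ i)) = u / 2304"
            by (simp_all add: u_def)
          moreover have "u \<ge> 0" using pos L by (simp add: u_def)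
          ultimately show ?thesis unfolding u_def[symmetric] by linarith
        qed
        finally have h: "\<bar>of_int k0 - of_int j * h * g y\<bar> \<le> L ^ 3 / (Q * D * 2 ^ i)" by simp
        have "(j, \<lambda>i. - k i, k0) \<in> W i" 
          using ij h yS2 by (simp add: W_def near_cone_def y_def)
        then have "(j, \<lambda>i. - k i, k0) \<in> G i" using near by (simp add: G_def base_def y_def)
        then have "(j, \<lambda>i. - k i, k0) \<in> (\<Union>i\<in>I. G i)" using iI by blast
        then have "(\<lambda>(j, a, b). (b, (\<lambda>i. - a i), j)) (j, \<lambda>i. - k i, k0) \<in> (\<lambda>(j, a, b). (b, (\<lambda>i. - a i), j)) ` (\<Union>i\<in>I. G i)"
          by (rule imageI)
        then show ?thesis using not by simp
      qed
    qed
    then have "card {(k0, k, j). (k0, k, j) \<in> K z \<and> j \<ge> 1}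
       \<le> card ((\<lambda>j::nat. (0::int, (\<lambda>_. 0) :: 'm \<Rightarrow> int, int j)) ` E \<union> (\<lambda>(j, a, b). (b, (\<lambda>i. - a i), j)) ` (\<Union>i\<in>I. G i))"
      using finI finW by (intro card_mono) (auto simp: E_def G_def)
    also have "\<dots> \<le> card ((\<lambda>j::nat. (0::int, (\<lambda>_. 0) :: 'm \<Rightarrow> int, int j)) ` E)
        + card ((\<lambda>(j, a, b). (b, (\<lambda>i. - a i), j)) ` (\<Union>i\<in>I. G i))" by (rule card_Un_le)
    also have "\<dots> \<le> card E + card (\<Union>i\<in>I. G i)"
      using finI finW by (intro add_mono card_image_le) (auto simp: E_def G_def)
    also have "card (\<Union>i\<in>I. G i) \<le> (\<Sum>i\<in>I. card (G i))" by (rule card_UN_le[OF finI])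
    finally show ?thesis by (simp add: E_def G_def x_def)
  qed
  \<comment> \<open>After interchanging the sums, \<open>card_grid_sublevel_le\<close> applies for
    each j, since j \<le> 1 / (24 D) gives \<open>\<rho>\<^sup>2 \<le> 2 * \<eta> j\<close>. As
    \<eta> j is proportional to 1 / j, what remains is the sum of 1 / sqrt j up to 1 / (24
    D).\<close>
  have sumE: "real (\<Sum>z\<in>X. card {j \<in> {1..n}. \<bar>f (\<rho> *\<^sub>R rvec z)\<bar> \<le> \<eta> j})
      \<le> 6 * L\<^sup>2 * (2 * L + 3) ^ m / (\<rho> ^ m * sqrt (D * Q * h))"
  proof -
    let ?c = "6 * L\<^sup>2 * (2 * L + 3) ^ m"
    have c0: "?c \<ge> 0" using L by simp
    have "real (\<Sum>z\<in>X. card {j \<in> {1..n}. \<bar>f (\<rho> *\<^sub>R rvec z)\<bar> \<le> \<eta> j})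
      = (\<Sum>j\<in>{1..n}. real (card {z \<in> X. \<bar>f (\<rho> *\<^sub>R rvec z)\<bar> \<le> \<eta> j}))"
      by (subst sum_card_swap[OF finX]) auto
    also have "\<dots> \<le> (\<Sum>j\<in>{1..n}. ?c * (sqrt (\<eta> j) / \<rho> ^ m))"
    proof (rule sum_mono)
      fix j assume j: "j \<in> {1..n}"
      have "real j \<le> 1 / (24 * D')" using j n_le by (meson atLeastAtMost_iff of_nat_le_iff order_trans)
      also have "\<dots> \<le> 1 / (24 * D)" using D'D pos by (intro divide_left_mono) auto
      finally have jD: "24 * (real j * D) \<le> 1" using pos by (simp add: field_simps)
      have "\<rho>\<^sup>2 = D / (Q * h)" using pos by (simp add: \<rho>)
      also have "\<dots> \<le> 2 * \<eta> j" using jD pos j by (simp add: \<eta>_def field_simps)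
      finally have le: "\<rho>\<^sup>2 \<le> 2 * \<eta> j" .
      have fin: "finite {z. \<rho> *\<^sub>R rvec z \<in> U \<and> \<bar>f (\<rho> *\<^sub>R rvec z)\<bar> \<le> \<eta> j}"
        by (rule finite_subset[OF _ card_grid_le(1)[OF d(7) L0 \<rho>0 \<rho>(2)]]) auto
      have "card {z \<in> X. \<bar>f (\<rho> *\<^sub>R rvec z)\<bar> \<le> \<eta> j} \<le> card {z. \<rho> *\<^sub>R rvec z \<in> U \<and> \<bar>f (\<rho> *\<^sub>R rvec z)\<bar> \<le> \<eta> j}"
        using S1U by (intro card_mono fin) (auto simp: X_def)
      then show "real (card {z \<in> X. \<bar>f (\<rho> *\<^sub>R rvec z)\<bar> \<le> \<eta> j}) \<le> ?c * (sqrt (\<eta> j) / \<rho> ^ m)"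
        using card_grid_sublevel_le[OF dp \<rho>0 \<rho>(2) le] unfolding m by linarith
    qed
    also have "\<dots> = (\<Sum>j\<in>{1..n}. ?c / \<rho> ^ m / sqrt (48 * Q * h) * (1 / sqrt (real j)))"
      by (intro sum.cong refl) (simp add: \<eta>_def real_sqrt_mult real_sqrt_divide mult_ac)
    also have "\<dots> = ?c / \<rho> ^ m / sqrt (48 * Q * h) * (\<Sum>j\<in>{1..n}. 1 / sqrt (real j))"
      by (simp only: sum_distrib_left)
    also have "\<dots> \<le> ?c / \<rho> ^ m / sqrt (48 * Q * h) * (2 * sqrt (1 / (24 * D)))"
    proof (rule mult_left_mono)
      have "1 / (24 * D') \<le> 1 / (24 * D)" using D'D pos by (intro divide_left_mono) auto
      then have "real n \<le> 1 / (24 * D)" using n_le by (rule order_trans[rotated])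
      then have "sqrt (real n) \<le> sqrt (1 / (24 * D))" by simp
      then show "(\<Sum>j\<in>{1..n}. 1 / sqrt (real j)) \<le> 2 * sqrt (1 / (24 * D))" using sum_inverse_sqrt_le[of n] by linarith
      show "0 \<le> ?c / \<rho> ^ m / sqrt (48 * Q * h)" using c0 \<rho>0 pos by simp
    qed
    also have "\<dots> = ?c / (\<rho> ^ m * sqrt (D * Q * h)) * (2 / (sqrt 48 * sqrt 24))"
      by (simp add: real_sqrt_mult real_sqrt_divide mult_ac)
    also have "\<dots> \<le> ?c / (\<rho> ^ m * sqrt (D * Q * h)) * 1"
    proof (rule mult_left_mono)
      have "2 * 1 \<le> sqrt 48 * sqrt (24::real)"
        by (intro mult_mono) (auto intro!: real_le_rsqrt)
      then show "2 / (sqrt 48 * sqrt 24) \<le> (1::real)" by simp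
      show "0 \<le> ?c / (\<rho> ^ m * sqrt (D * Q * h))" using c0 \<rho>0 pos by simp
    qed
    finally show ?thesis by simp
  qed
  \<comment> \<open>A dual point t fixes the position of the cap up to \<sigma> i, so it is seen
    only from grid points in a ball of radius \<sigma> i, and the ratio \<sigma> i / \<rho> equals L
    / (48 D 2^i).\<close>
  have sumW: "real (\<Sum>z\<in>X. card {t \<in> W i. norm (\<rho> *\<^sub>R rvec z - base t) \<le> \<sigma> i}) \<le> (2 * L / (D * 2 ^ i)) ^ m * card (W i)"
    if i: "i \<in> I" for i
  proof -
    have \<sigma>0: "\<sigma> i \<ge> 0" using L l R1 pos by (simp add: \<sigma>_def)
    have "\<sigma> i / \<rho> = L / (48 * (Q * h * \<rho>\<^sup>2) * 2 ^ i)"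
      using l by (simp add: \<sigma>_def R power2_eq_square)
    also have "\<dots> = L / (48 * D * 2 ^ i)" by (simp add: Qh)
    finally have "2 * \<sigma> i / \<rho> + 1 = L / (24 * (D * 2 ^ i)) + 1" by simp
    also have "\<dots> \<le> L / (D * 2 ^ i) + L / (D * 2 ^ i)"
    proof (rule add_mono)
      have "D * 2 ^ i \<le> 1" using i by (simp add: I_def mult.commute)
      then have "1 / 1 \<le> L / (D * 2 ^ i)" using L pos by (intro frac_le) auto
      then show "1 \<le> L / (D * 2 ^ i)" by simp
      show "L / (24 * (D * 2 ^ i)) \<le> L / (D * 2 ^ i)" using L pos by (intro divide_left_mono) auto
    qed
    finally have le: "2 * \<sigma> i / \<rho> + 1 \<le> 2 * L / (D * 2 ^ i)" by simp
    have "real (\<Sum>z\<in>X. card {t \<in> W i. norm (\<rho> *\<^sub>R rvec z - base t) \<le> \<sigma> i})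
       = (\<Sum>t\<in>W i. real (card {z \<in> X. norm (\<rho> *\<^sub>R rvec z - base t) \<le> \<sigma> i}))"
      by (subst sum_card_swap[OF finX finW]) simp
    also have "\<dots> \<le> (\<Sum>t\<in>W i. (2 * L / (D * 2 ^ i)) ^ m)"
    proof (rule sum_mono)
      fix t
      have "card {z \<in> X. norm (\<rho> *\<^sub>R rvec z - base t) \<le> \<sigma> i} \<le> card {z. norm (\<rho> *\<^sub>R rvec z - base t) \<le> \<sigma> i}"
        by (intro card_mono card_grid_ball_le(1) \<rho>0 \<sigma>0) auto
      then have "real (card {z \<in> X. norm (\<rho> *\<^sub>R rvec z - base t) \<le> \<sigma> i}) \<le> (2 * \<sigma> i / \<rho> + 1) ^ m"
        using card_grid_ball_le(2)[OF \<rho>0 \<sigma>0, of "base t"] unfolding m by linarith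
      also have "\<dots> \<le> (2 * L / (D * 2 ^ i)) ^ m" using le \<sigma>0 \<rho>0 by (intro power_mono) auto
      finally show "real (card {z \<in> X. norm (\<rho> *\<^sub>R rvec z - base t) \<le> \<sigma> i}) \<le> (2 * L / (D * 2 ^ i)) ^ m" .
    qed
    also have "\<dots> = (2 * L / (D * 2 ^ i)) ^ m * card (W i)" by simp
    finally show ?thesis .
  qed
  have sumK: "(\<Sum>z\<in>X. real (card (K z))) \<le> ((2 * L + 1) / \<rho>) ^ m + 2 * (6 * L\<^sup>2 * (2 * L + 3) ^ m) / (\<rho> ^ m * sqrt (D * Q * h))
       + 2 * (\<Sum>i\<in>I. (2 * L / (D * 2 ^ i)) ^ m * real (card (W i)))"
  proof -
    let ?a = "\<lambda>z. card {j \<in> {1..n}. \<bar>f (\<rho> *\<^sub>R rvec z)\<bar> \<le> \<eta> j}"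
    let ?b = "\<lambda>z i. card {t \<in> W i. norm (\<rho> *\<^sub>R rvec z - base t) \<le> \<sigma> i}"
    have "(\<Sum>z\<in>X. card (K z)) \<le> (\<Sum>z\<in>X. 1 + 2 * (?a z + (\<Sum>i\<in>I. ?b z i)))"
    proof (rule sum_mono)
      fix z assume z: "z \<in> X"
      have "card (K z) \<le> 1 + 2 * card {(k0, k, j). (k0, k, j) \<in> K z \<and> j \<ge> 1}"
        unfolding K_def by (rule card_polar_cap_le[OF pos(4) R1 D'0])
      also have "\<dots> \<le> 1 + 2 * (?a z + (\<Sum>i\<in>I. ?b z i))"
        by (intro add_left_mono mult_left_mono Kpos[OF z]) simp
      finally show "card (K z) \<le> 1 + 2 * (?a z + (\<Sum>i\<in>I. ?b z i))" .
    qed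
    also have "\<dots> = card X + 2 * ((\<Sum>z\<in>X. ?a z) + (\<Sum>z\<in>X. \<Sum>i\<in>I. ?b z i))"
      by (simp only: sum.distrib sum_distrib_left[symmetric] card_eq_sum)
    also have "(\<Sum>z\<in>X. \<Sum>i\<in>I. ?b z i) = (\<Sum>i\<in>I. \<Sum>z\<in>X. ?b z i)" by (rule sum.swap)
    finally have "real (\<Sum>z\<in>X. card (K z)) \<le> real (card X) + 2 * (real (\<Sum>z\<in>X. ?a z) + (\<Sum>i\<in>I. real (\<Sum>z\<in>X. ?b z i)))"
      unfolding of_nat_le_iff[where 'a=real, symmetric] by (simp only: of_nat_add of_nat_mult of_nat_sum of_nat_numeral)
    moreover have "(\<Sum>i\<in>I. real (\<Sum>z\<in>X. ?b z i)) \<le> (\<Sum>i\<in>I. (2 * L / (D * 2 ^ i)) ^ m * real (card (W i)))"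
      by (intro sum_mono sumW)
    ultimately show ?thesis using cardX sumE by simp
  qed
  have c: "0 \<le> 4 * 48 * (48 * real m) ^ m * 96 * (D' * R ^ m * Q)" using D'0 R1 pos by simp
  have "real (card Nr) \<le> (\<Sum>z\<in>X. 4 * 48 * (48 * real m) ^ m * 96 * (D' * R ^ m * Q) * real (card (K z)))"
    using cardNr sum_mono[OF cardA] by (rule order_trans)
  also have "\<dots> = 4 * 48 * (48 * real m) ^ m * 96 * (D' * R ^ m * Q) * (\<Sum>z\<in>X. real (card (K z)))"
    by (simp only: sum_distrib_left)
  also note mult_left_mono[OF sumK c]
  finally show ?thesis unfolding Nr_def D'_def W_def I_def .
qed

subsection \<open>Improving the error exponent\<close>

text \<open>In order: the expected number of points, the error whose exponent \<beta> is to be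
  lowered, and the contribution of the vertical vectors in the polar bodies.\<close>

definition cone_bound :: "nat \<Rightarrow> real \<Rightarrow> real \<Rightarrow> real \<Rightarrow> real \<Rightarrow> real \<Rightarrow> real" where
  "cone_bound m \<beta> l h Q D = Q ^ m * (D * Q * l ^ m + Q powr \<beta> * (l ^ (m - 1) * max (l / sqrt h) (sqrt h / l))
      + sqrt (D * Q) * (l ^ m / sqrt h))"

text \<open>All dual pairs and compact sets are quantified together because the inductive step
  invokes the estimate for the swapped pair, on a neighbourhood of the image of S. The constant
  precedes l and h because duality changes them. The \<open>itself\<close> argument carries the
  dimension.\<close>

definition cone_estimate :: "'m::finite itself \<Rightarrow> real \<Rightarrow> bool" where
  "cone_estimate _ \<beta> \<longleftrightarrow> (\<forall>U V (f :: real^'m \<Rightarrow> real) g p p' L S. dual_pair U V f g p p' L \<longrightarrow> compact S \<longrightarrow> S \<subseteq> U \<longrightarrow>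
     (\<exists>C. \<forall>l h Q D. 0 < h \<longrightarrow> h \<le> l \<longrightarrow> l \<le> 1 \<longrightarrow> 1 \<le> Q \<longrightarrow> 0 < D \<longrightarrow>
        real (card (near_cone f S l h Q D)) \<le> C * cone_bound CARD('m) \<beta> l h Q D))"

lemma aspect_ge_1:
  assumes "0 < h" "0 < l"
  shows "max (l / sqrt h) (sqrt h / l) \<ge> 1"
proof (cases "sqrt h \<le> l")
  case True
  then have "1 \<le> l / sqrt h" using assms by simp
  then show ?thesis by simp
next
  case False
  then have "1 \<le> sqrt h / l" using assms by simp
  then show ?thesis by simp
qed

lemma aspect_dual:
  assumes "0 < h" "0 < l"
  shows "max (h / l / sqrt h) (sqrt h / (h / l)) = max (l / sqrt h) (sqrt h / l)"
proof -
  obtain s where s: "s > 0" "h = s * s" "sqrt h = s" using assms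
    by (metis real_sqrt_gt_zero real_sqrt_mult_self abs_of_pos)
  then have "h / l / sqrt h = sqrt h / l" "sqrt h / (h / l) = l / sqrt h" by simp_all
  then show ?thesis by (simp add: max.commute)
qed

lemma sum_dyadic_powr_le:
  fixes D \<beta> :: real
  assumes "\<beta> > 0" "D > 0"
  shows "finite {i::nat. 2 ^ i * D \<le> 1}"
    and "(\<Sum>i\<in>{i::nat. 2 ^ i * D \<le> 1}. (2 ^ i) powr \<beta>) \<le> 2 powr \<beta> / (2 powr \<beta> - 1) * D powr (- \<beta>)"
proof -
  let ?I = "{i::nat. 2 ^ i * D \<le> 1}"
  define r where "r = 2 powr \<beta>"
  have r: "r > 1" using assms by (simp add: r_def)
  obtain N :: nat where N: "1 / D < 2 ^ N" using real_arch_pow[of 2 "1 / D"] by auto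
  have "?I \<subseteq> {..N}"
  proof
    fix i assume "i \<in> ?I"
    then have "2 ^ i \<le> 1 / D" using assms by (simp add: field_simps)
    then have "(2::real) ^ i < 2 ^ N" using N by linarith
    then show "i \<in> {..N}" by simp
  qed
  then show fin: "finite ?I" using finite_subset by blast
  have rp: "(2 ^ i) powr \<beta> = r ^ i" for i
    by (simp add: r_def powr_realpow[symmetric] powr_powr mult.commute) 
  show "(\<Sum>i\<in>?I. (2 ^ i) powr \<beta>) \<le> 2 powr \<beta> / (2 powr \<beta> - 1) * D powr (- \<beta>)"
  proof (cases "?I = {}")
    case True
    then show ?thesis using r by (simp add: r_def[symmetric])
  next
    case False
    define M where "M = Max ?I"
    have M: "M \<in> ?I" unfolding M_def using Max_in[OF fin False] .
    have "(\<Sum>i\<in>?I. (2 ^ i) powr \<beta>) \<le> (\<Sum>i\<le>M. r ^ i)"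
      unfolding rp using r fin by (intro sum_mono2) (auto simp: M_def)
    also have "\<dots> = (r ^ Suc M - 1) / (r - 1)" using r power_diff_1_eq[of r "Suc M"] by (simp add: lessThan_Suc_atMost)
    also have "\<dots> \<le> r ^ Suc M / (r - 1)" using r by (intro divide_right_mono) auto
    also have "\<dots> = r / (r - 1) * (2 ^ M) powr \<beta>" by (simp add: rp)
    also have "\<dots> \<le> r / (r - 1) * (1 / D) powr \<beta>"
      using M assms r by (intro mult_left_mono powr_mono2) (auto simp: field_simps)
    also have "(1 / D) powr \<beta> = D powr (- \<beta>)" using assms by (simp add: powr_minus_divide powr_divide)
    finally show ?thesis by (simp add: r_def)
  qed
qed

text \<open>At height J = 2^i the dual error times J is L^3 / (D Q) \<le> L^3, so the first and
  third terms of the dual bound are dominated by the one with J^\<beta>. The factor J^m cancels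
  against the number of caps that see a dual point. What remains is a geometric sum with largest J
  at most 1 / D, and \<open>aspect_dual\<close> restores the aspect ratio of the original
  hypersurface.\<close>

lemma cone_dual_sum_le:
  assumes \<beta>: "\<beta> > 0" and L: "L \<ge> 1" and pos: "0 < h" "h \<le> l" "Q \<ge> 1" "D > 0" "D * Q \<ge> 1" and m: "m \<ge> 1"
    and C: "C \<ge> 0" and N: "\<And>i. 2 ^ i * D \<le> 1 \<Longrightarrow> N i \<le> C * cone_bound m \<beta> (h / l) h (2 ^ i) (L ^ 3 / (Q * D * 2 ^ i))"
  shows "(\<Sum>i\<in>{i::nat. 2 ^ i * D \<le> 1}. (2 * L / (D * 2 ^ i)) ^ m * N i)
    \<le> (2 * L) ^ m * C * (1 + 2 * L ^ 3) * (2 powr \<beta> / (2 powr \<beta> - 1)) *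
      (1 / D ^ m * (h / l) ^ (m - 1) * max (l / sqrt h) (sqrt h / l) * D powr (- \<beta>))"
proof -
  define k where "k = h / l"
  define \<tau> where "\<tau> = max (l / sqrt h) (sqrt h / l)"
  have l: "l > 0" using pos by simp
  have k: "0 < k" "k \<le> 1" using pos l by (auto simp: k_def)
  have \<tau>: "\<tau> \<ge> 1" unfolding \<tau>_def by (rule aspect_ge_1[OF pos(1) l])
  have \<tau>': "max (k / sqrt h) (sqrt h / k) = \<tau>" unfolding k_def \<tau>_def by (rule aspect_dual[OF pos(1) l])
  have L3: "L ^ 3 \<ge> 1" using L by (rule one_le_power)
  have km: "k ^ m = k ^ (m - 1) * k" using m by (cases m) auto
  have km0: "k ^ (m - 1) \<ge> 0" using k by simp
  have bound: "(2 * L / (D * 2 ^ i)) ^ m * N i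
      \<le> (2 * L) ^ m * C * (1 + 2 * L ^ 3) * (1 / D ^ m * k ^ (m - 1) * \<tau>) * (2 ^ i) powr \<beta>" if i: "2 ^ i * D \<le> 1" for i
  proof -
    define J :: real where "J = 2 ^ i"
    have J: "J \<ge> 1" by (simp add: J_def)
    have J\<beta>: "J powr \<beta> \<ge> 1" using J \<beta> by (simp add: ge_one_powr_ge_zero)
    have "L ^ 3 / (Q * D * J) * J = L ^ 3 / (D * Q)" using J by simp
    also have "\<dots> \<le> L ^ 3 / 1" using pos L by (intro divide_left_mono) auto
    finally have DJ: "L ^ 3 / (Q * D * J) * J \<le> L ^ 3" by simp
    have "sqrt (L ^ 3 / (Q * D * J) * J) \<le> sqrt (L ^ 3)" using DJ by simp
    also have "\<dots> \<le> L ^ 3" using L L3 self_le_power[OF L3, of 2] by (intro real_le_lsqrt) simp_all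
    finally have sDJ: "sqrt (L ^ 3 / (Q * D * J) * J) \<le> L ^ 3" .
    have kt: "k ^ m \<le> J powr \<beta> * (k ^ (m - 1) * \<tau>)"
    proof -
      have "k \<le> J powr \<beta> * \<tau>" using mult_mono[OF J\<beta> \<tau>] k \<tau> by simp
      then have "k ^ (m - 1) * k \<le> k ^ (m - 1) * (J powr \<beta> * \<tau>)" using km0 by (intro mult_left_mono) auto
      then show ?thesis by (simp add: km mult_ac)
    qed
    have ks: "k ^ m / sqrt h \<le> J powr \<beta> * (k ^ (m - 1) * \<tau>)"
    proof -
      have "k / sqrt h \<le> \<tau>" using \<tau>' by (metis max.cobounded1)
      also have "1 * \<tau> \<le> J powr \<beta> * \<tau>" using J\<beta> \<tau> by (intro mult_right_mono) auto
      finally have "k / sqrt h \<le> J powr \<beta> * \<tau>" by simp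
      then have "k ^ (m - 1) * (k / sqrt h) \<le> k ^ (m - 1) * (J powr \<beta> * \<tau>)" using km0 by (intro mult_left_mono) auto
      then show ?thesis by (simp add: km mult_ac)
    qed
    have "cone_bound m \<beta> k h J (L ^ 3 / (Q * D * J))
       = J ^ m * (L ^ 3 / (Q * D * J) * J * k ^ m + J powr \<beta> * (k ^ (m - 1) * \<tau>) + sqrt (L ^ 3 / (Q * D * J) * J) * (k ^ m / sqrt h))"
      by (simp only: cone_bound_def \<tau>')
    also have "\<dots> \<le> J ^ m * (L ^ 3 * (J powr \<beta> * (k ^ (m - 1) * \<tau>)) + 1 * (J powr \<beta> * (k ^ (m - 1) * \<tau>)) + L ^ 3 * (J powr \<beta> * (k ^ (m - 1) * \<tau>)))"
    proof (intro mult_left_mono add_mono)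
      show "L ^ 3 / (Q * D * J) * J * k ^ m \<le> L ^ 3 * (J powr \<beta> * (k ^ (m - 1) * \<tau>))"
        using DJ kt k L by (intro mult_mono) auto
      show "sqrt (L ^ 3 / (Q * D * J) * J) * (k ^ m / sqrt h) \<le> L ^ 3 * (J powr \<beta> * (k ^ (m - 1) * \<tau>))"
        using sDJ ks k L pos by (intro mult_mono) auto
    qed (use J in auto)
    also have "\<dots> = J ^ m * ((1 + 2 * L ^ 3) * (J powr \<beta> * (k ^ (m - 1) * \<tau>)))" by (simp add: algebra_simps)
    finally have cb: "cone_bound m \<beta> k h J (L ^ 3 / (Q * D * J)) \<le> J ^ m * ((1 + 2 * L ^ 3) * (J powr \<beta> * (k ^ (m - 1) * \<tau>)))" .
    have "N i \<le> C * cone_bound m \<beta> k h J (L ^ 3 / (Q * D * J))" using N[OF i] by (simp add: k_def J_def)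
    also have "\<dots> \<le> C * (J ^ m * ((1 + 2 * L ^ 3) * (J powr \<beta> * (k ^ (m - 1) * \<tau>))))"
      by (rule mult_left_mono[OF cb C])
    finally have "(2 * L / (D * J)) ^ m * N i \<le> (2 * L / (D * J)) ^ m * (C * (J ^ m * ((1 + 2 * L ^ 3) * (J powr \<beta> * (k ^ (m - 1) * \<tau>)))))"
      using L J pos by (intro mult_left_mono) auto
    also have "\<dots> = (2 * L) ^ m * C * (1 + 2 * L ^ 3) * (1 / D ^ m * k ^ (m - 1) * \<tau>) * J powr \<beta>"
      using J by (simp add: power_divide power_mult_distrib)
    finally show ?thesis by (simp add: J_def)
  qed
  have "(\<Sum>i\<in>{i::nat. 2 ^ i * D \<le> 1}. (2 * L / (D * 2 ^ i)) ^ m * N i)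
     \<le> (\<Sum>i\<in>{i::nat. 2 ^ i * D \<le> 1}. (2 * L) ^ m * C * (1 + 2 * L ^ 3) * (1 / D ^ m * k ^ (m - 1) * \<tau>) * (2 ^ i) powr \<beta>)"
    by (intro sum_mono bound) auto
  also have "\<dots> = (2 * L) ^ m * C * (1 + 2 * L ^ 3) * (1 / D ^ m * k ^ (m - 1) * \<tau>) * (\<Sum>i\<in>{i::nat. 2 ^ i * D \<le> 1}. (2 ^ i) powr \<beta>)"
    by (simp only: sum_distrib_left)
  also have "\<dots> \<le> (2 * L) ^ m * C * (1 + 2 * L ^ 3) * (1 / D ^ m * k ^ (m - 1) * \<tau>) * (2 powr \<beta> / (2 powr \<beta> - 1) * D powr (- \<beta>))"
    using L C pos k \<tau> by (intro mult_left_mono sum_dyadic_powr_le(2)[OF \<beta> pos(4)]) auto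
  finally show ?thesis by (simp add: k_def \<tau>_def mult_ac)
qed

text \<open>With w = \<rho> / D and k = h / l, hypothesis \<open>hl\<close> says w k \<le> 1. Two of
  the m factors w cancel D Q exactly, and the others occur in products w k. This is where
  \<open>m \<ge> 2\<close> enters.\<close>

lemma dual_term_le:
  assumes pos: "0 < h" "0 < l" "Q > 0" "D > 0" and hl: "h \<le> D * Q * l\<^sup>2" and m: "m \<ge> 2"
    and \<rho>: "\<rho> = sqrt (D / (Q * h))"
  shows "D * (2 * Q * l * \<rho>) ^ m * Q * (1 / D ^ m * (h / l) ^ (m - 1)) \<le> 2 ^ m * (Q ^ m * l ^ (m - 1))"
proof -
  obtain n where n: "m = Suc (Suc n)" using m by (metis add_2_eq_Suc le_Suc_ex)
  define w where "w = \<rho> / D"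
  define k where "k = h / l"
  have \<rho>0: "\<rho> > 0" using pos by (simp add: \<rho>)
  have w0: "w > 0" using \<rho>0 pos by (simp add: w_def)
  have k0: "k > 0" using pos by (simp add: k_def)
  have "\<rho>\<^sup>2 = D / (Q * h)" using pos by (simp add: \<rho>)
  then have w2: "w\<^sup>2 = 1 / (Q * h * D)" using pos by (simp add: w_def power_divide power2_eq_square)
  have "(w * k)\<^sup>2 = h / (D * Q * l\<^sup>2)"
    using pos by (simp add: power_mult_distrib w2) (simp add: k_def power2_eq_square)
  also have "\<dots> \<le> 1" using hl pos by (simp add: divide_le_eq)
  finally have wk: "w * k \<le> 1" using w0 k0 by (simp add: abs_square_le_1)
  have main: "D * Q * ((Q * l)\<^sup>2 * w\<^sup>2) * k = Q\<^sup>2 * l"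
    using pos by (simp add: w2) (simp add: k_def power2_eq_square)
  have "D * (2 * Q * l * \<rho>) ^ m * Q * (1 / D ^ m * k ^ (m - 1)) = 2 ^ m * (D * Q * ((Q * l * w) ^ m * k ^ (m - 1)))"
    using pos by (simp add: w_def power_mult_distrib power_divide)
  also have "(Q * l * w) ^ m * k ^ (m - 1) = ((Q * l)\<^sup>2 * w\<^sup>2) * k * ((Q * l) ^ n * (w * k) ^ n)"
    by (simp add: n power_mult_distrib power2_eq_square)
  also have "D * Q * \<dots> = Q\<^sup>2 * l * ((Q * l) ^ n * (w * k) ^ n)"
    unfolding main[symmetric] by (simp only: mult_ac)
  also have "2 ^ m * \<dots> \<le> 2 ^ m * (Q\<^sup>2 * l * ((Q * l) ^ n * 1))"
    using wk w0 k0 pos by (intro mult_left_mono power_le_one) auto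
  also have "\<dots> = 2 ^ m * (Q ^ m * l ^ (m - 1))"
    by (simp add: n power_mult_distrib power2_eq_square)
  finally show ?thesis by (simp add: k_def)
qed

text \<open>The admissible range of D: since R^2 = 4 D Q l^2 / h, the condition with
  \<open>R0\<close> makes R large, and \<open>D \<le> c * Q * h\<close> makes the caps small. The
  error D^-\<beta> decreases in D while the main term grows, so the choice of D is left to the next
  step.\<close>

lemma cone_step_interior:
  fixes S :: "(real^'m) set"
  assumes H: "cone_estimate TYPE('m) \<beta>" and \<beta>: "\<beta> > 0" and m2: "CARD('m) \<ge> 2"
    and dp: "dual_pair U V f g p p' L" and S: "compact S" "S \<subseteq> U"
  obtains C R0 c where "C \<ge> 0" "R0 \<ge> 1" "0 < c"
    "\<And>l h Q D. 0 < h \<Longrightarrow> h \<le> l \<Longrightarrow> l \<le> 1 \<Longrightarrow> 1 \<le> Q \<Longrightarrow> 0 < D \<Longrightarrow> 1 \<le> D * Q \<Longrightarrow> R0 * h \<le> D * Q * l\<^sup>2 \<Longrightarrow> D \<le> c * Q * h \<Longrightarrow>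
       real (card (near_cone f S l h Q D)) \<le> C * (Q ^ CARD('m) * (D * Q * l ^ CARD('m) + sqrt (D * Q) * (l ^ CARD('m) / sqrt h)
         + D powr (- \<beta>) * (l ^ (CARD('m) - 1) * max (l / sqrt h) (sqrt h / l))))"
proof -
  define m where "m = CARD('m)"
  have m: "m \<ge> 2" using m2 by (simp add: m_def)
  note d = dual_pairD[OF dp]
  have L: "L \<ge> 1" by (rule d(3))
  obtain e where e: "e > 0" "(\<Union>x\<in>S. cball x e) \<subseteq> U"
    using compact_subset_open_imp_cball_epsilon_subset[OF S(1) d(1) S(2)] by blast
  define S1 where "S1 = (\<Union>x\<in>S. cball x e)"
  have cS1: "compact S1" unfolding S1_def using S(1) by (rule compact_minkowski_sum_cball)
  have S1U: "S1 \<subseteq> U" using e by (simp add: S1_def)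
  have "continuous_on U p"
    using d(10) by (intro lipschitz_on_continuous_on[of L] lipschitz_onI) (use L in \<open>auto simp: dist_norm\<close>)
  then have cp: "compact (p ` S1)" using cS1 S1U by (intro compact_continuous_image) (auto intro: continuous_on_subset)
  have pV: "p ` S1 \<subseteq> V" using d(4) S1U by auto
  obtain e' where e': "e' > 0" "(\<Union>y\<in>p ` S1. cball y e') \<subseteq> V"
    using compact_subset_open_imp_cball_epsilon_subset[OF cp d(2) pV] by blast
  define S2 where "S2 = (\<Union>y\<in>p ` S1. cball y e')"
  have cS2: "compact S2" unfolding S2_def using cp by (rule compact_minkowski_sum_cball)
  have S2V: "S2 \<subseteq> V" using e' by (simp add: S2_def)
  obtain C2' where C2': "\<And>l h Q D. 0 < h \<Longrightarrow> h \<le> l \<Longrightarrow> l \<le> 1 \<Longrightarrow> 1 \<le> Q \<Longrightarrow> 0 < D \<Longrightarrow>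
        real (card (near_cone g S2 l h Q D)) \<le> C2' * cone_bound m \<beta> l h Q D"
    using H dual_pair_swap[OF dp] cS2 S2V unfolding cone_estimate_def m_def by metis
  define C2 where "C2 = max C2' 0"
  have cb0: "cone_bound m \<beta> l h Q D \<ge> 0" if "0 < h" "h \<le> l" "1 \<le> Q" "0 < D" for l h Q D
  proof -
    have "0 \<le> max (l / sqrt h) (sqrt h / l)" using that by (simp add: le_max_iff_disj)
    then show ?thesis using that by (simp add: cone_bound_def)
  qed
  have C2: "real (card (near_cone g S2 l h Q D)) \<le> C2 * cone_bound m \<beta> l h Q D"
    if "0 < h" "h \<le> l" "l \<le> 1" "1 \<le> Q" "0 < D" for l h Q D
  proof -
    have "C2' * cone_bound m \<beta> l h Q D \<le> C2 * cone_bound m \<beta> l h Q D"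
      using cb0 that by (intro mult_right_mono) (auto simp: C2_def)
    then show ?thesis using C2'[OF that] by linarith
  qed
  \<comment> \<open>\<open>e\<close> is the room for cap centres around S and \<open>e'\<close> the
    room for dual points around the gradients. \<open>Rm\<close> converts \<open>e'\<close> into a
    lower bound for R, and squaring gives the threshold \<open>R0\<close>.\<close>
  define Rm where "Rm = max (L\<^sup>2) (L / (12 * e'))"
  have Rm: "Rm \<ge> L\<^sup>2" "Rm \<ge> L / (12 * e')" by (auto simp: Rm_def)
  have L2: "L\<^sup>2 \<ge> 1" using L by (rule one_le_power)
  define R0 where "R0 = Rm\<^sup>2"
  have "Rm \<ge> 1" using Rm L2 by linarith
  then have R01: "R0 \<ge> 1" unfolding R0_def by (rule one_le_power)
  define c where "c = min 1 ((e / real m)\<^sup>2)"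
  have c: "c > 0" using e m by (simp add: c_def)
  define K1 where "K1 = 4 * 48 * (48 * real m) ^ m * 96 * (1 + 2 * L * (real m)\<^sup>2)"
  define K2 where "K2 = (2 * L) ^ m * C2 * (1 + 2 * L ^ 3) * (2 powr \<beta> / (2 powr \<beta> - 1))"
  define K3 where "K3 = 6 * L\<^sup>2 * (2 * L + 3) ^ m"
  define C where "C = K1 * 2 ^ m * ((2 * L + 1) ^ m + 2 * K3 + 2 * K2)"
  have K1: "K1 \<ge> 0" using L by (simp add: K1_def)
  have "2 powr \<beta> > 1" using \<beta> by simp
  then have K2: "K2 \<ge> 0" using L by (simp add: K2_def C2_def)
  have K3: "K3 \<ge> 0" using L by (simp add: K3_def)
  have "C \<ge> 0" using K1 K2 K3 L by (simp add: C_def)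
  moreover have "real (card (near_cone f S l h Q D)) \<le> C * (Q ^ m * (D * Q * l ^ m + sqrt (D * Q) * (l ^ m / sqrt h)
         + D powr (- \<beta>) * (l ^ (m - 1) * max (l / sqrt h) (sqrt h / l))))"
    if pos: "0 < h" "h \<le> l" "l \<le> 1" "1 \<le> Q" "0 < D" and DQ: "1 \<le> D * Q" and R0: "R0 * h \<le> D * Q * l\<^sup>2" and Dc: "D \<le> c * Q * h"
    for l h Q D
  proof -
    define \<rho> where "\<rho> = sqrt (D / (Q * h))"
    define R where "R = 2 * Q * l * \<rho>"
    define \<tau> where "\<tau> = max (l / sqrt h) (sqrt h / l)"
    define k where "k = h / l"
    have l: "l > 0" using pos by simp
    have \<tau>0: "\<tau> \<ge> 0" using aspect_ge_1[OF pos(1) l] by (simp add: \<tau>_def)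
    have \<rho>0: "\<rho> > 0" using pos by (simp add: \<rho>_def)
    have "D / (Q * h) \<le> c" using Dc pos by (simp add: divide_le_eq mult.assoc)
    then have "D / (Q * h) \<le> 1" "D / (Q * h) \<le> (e / real m)\<^sup>2" by (auto simp: c_def)
    then have \<rho>1: "\<rho> \<le> 1" "\<rho> \<le> e / real m" using e m unfolding \<rho>_def by (auto intro!: real_le_lsqrt)
    have \<rho>e: "real CARD('m) * \<rho> \<le> e" using \<rho>1(2) m by (simp add: field_simps flip: m_def)
    have nn: "0 \<le> D * Q * l\<^sup>2 / h" using pos by simp
    have "Rm\<^sup>2 * 1 \<le> D * Q * l\<^sup>2 / h" using R0 pos by (simp add: R0_def pos_le_divide_eq)
    also have "\<dots> \<le> 4 * (D * Q * l\<^sup>2 / h)" using nn by linarith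
    also have "\<dots> = 4 * Q\<^sup>2 * l\<^sup>2 * (D / (Q * h))" using pos by (simp add: power2_eq_square)
    also have "D / (Q * h) = \<rho>\<^sup>2" using pos by (simp add: \<rho>_def)
    also have "4 * Q\<^sup>2 * l\<^sup>2 * \<rho>\<^sup>2 = R\<^sup>2" by (simp add: R_def power_mult_distrib)
    finally have "Rm\<^sup>2 \<le> R\<^sup>2" by simp
    moreover have R_0: "R > 0" using \<rho>0 l pos by (simp add: R_def)
    ultimately have RmR: "Rm \<le> R" by (meson less_imp_le power2_le_imp_le)
    have R1: "L\<^sup>2 \<le> R" and "L / (12 * e') \<le> R" using Rm RmR by linarith+
    then have R2: "L / (12 * R) \<le> e'" using R_0 e'(1) by (simp add: field_simps)
    have cball_e': "cball (p x) e' \<subseteq> S2" if "x \<in> (\<Union>x\<in>S. cball x e)" for x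
      using that unfolding S2_def S1_def by blast
    have dual: "(\<Sum>i\<in>{i::nat. 2 ^ i * D \<le> 1}. (2 * L / (D * 2 ^ i)) ^ m * real (card (near_cone g S2 (h / l) h (2 ^ i) (L ^ 3 / (Q * D * 2 ^ i)))))
       \<le> K2 * (1 / D ^ m * k ^ (m - 1) * \<tau> * D powr (- \<beta>))"
      unfolding K2_def k_def \<tau>_def
    proof (rule cone_dual_sum_le[OF \<beta> L pos(1,2,4,5) DQ])
      show "m \<ge> 1" "C2 \<ge> 0" using m by (auto simp: C2_def)
      fix i :: nat
      have "h \<le> h / l" "h / l \<le> 1" using pos l by (auto simp: field_simps)
      then show "real (card (near_cone g S2 (h / l) h (2 ^ i) (L ^ 3 / (Q * D * 2 ^ i)))) \<le> C2 * cone_bound m \<beta> (h / l) h (2 ^ i) (L ^ 3 / (Q * D * 2 ^ i))"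
        using pos l L by (intro C2) auto
    qed
    have R\<rho>: "R ^ m / \<rho> ^ m = 2 ^ m * (Q ^ m * l ^ m)"
      using \<rho>0 by (simp add: R_def power_mult_distrib)
    have t1: "(D * R ^ m * Q) * ((2 * L + 1) / \<rho>) ^ m = 2 ^ m * (2 * L + 1) ^ m * (Q ^ m * (D * Q * l ^ m))"
    proof -
      have "(D * R ^ m * Q) * ((2 * L + 1) / \<rho>) ^ m = D * Q * (2 * L + 1) ^ m * (R ^ m / \<rho> ^ m)"
        by (simp add: power_divide)
      then show ?thesis unfolding R\<rho> by (simp only: mult_ac)
    qed
    have t2: "(D * R ^ m * Q) * (2 * K3 / (\<rho> ^ m * sqrt (D * Q * h))) = 2 ^ m * (2 * K3) * (Q ^ m * (sqrt (D * Q) * (l ^ m / sqrt h)))"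
    proof -
      have s: "D * Q / sqrt (D * Q * h) = sqrt (D * Q) / sqrt h"
        using pos by (simp add: real_sqrt_mult field_simps)
      have "(D * R ^ m * Q) * (2 * K3 / (\<rho> ^ m * sqrt (D * Q * h))) = 2 * K3 * (R ^ m / \<rho> ^ m) * (D * Q / sqrt (D * Q * h))"
        by simp
      then show ?thesis unfolding R\<rho> s by simp
    qed
    have t3: "(D * R ^ m * Q) * (2 * (K2 * (1 / D ^ m * k ^ (m - 1) * \<tau> * D powr (- \<beta>))))
        \<le> 2 ^ m * (2 * K2) * (Q ^ m * (D powr (- \<beta>) * (l ^ (m - 1) * \<tau>)))"
    proof -
      have "h \<le> R0 * h" using R01 pos by simp
      then have hl: "h \<le> D * Q * l\<^sup>2" using R0 by linarith
      have "D * R ^ m * Q * (1 / D ^ m * k ^ (m - 1)) \<le> 2 ^ m * (Q ^ m * l ^ (m - 1))"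
        unfolding R_def k_def by (rule dual_term_le[OF _ l _ _ hl m \<rho>_def]) (use pos in auto)
      then have "D * R ^ m * Q * (1 / D ^ m * k ^ (m - 1)) * (2 * K2 * \<tau> * D powr (- \<beta>)) \<le> 2 ^ m * (Q ^ m * l ^ (m - 1)) * (2 * K2 * \<tau> * D powr (- \<beta>))"
        using K2 \<tau>0 by (intro mult_right_mono) auto
      then show ?thesis by (simp add: mult_ac)
    qed
    have nonneg: "0 \<le> Q ^ m * (D * Q * l ^ m)" "0 \<le> Q ^ m * (sqrt (D * Q) * (l ^ m / sqrt h))" "0 \<le> Q ^ m * (D powr (- \<beta>) * (l ^ (m - 1) * \<tau>))"
      using pos l \<tau>0 by auto
    have "real (card (near_cone f S l h Q D)) \<le>
     4 * 48 * (48 * real m) ^ m * 96 * ((1 + 2 * L * (real m)\<^sup>2) * D * R ^ m * Q) *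
     (((2 * L + 1) / \<rho>) ^ m + 2 * (6 * L\<^sup>2 * (2 * L + 3) ^ m) / (\<rho> ^ m * sqrt (D * Q * h))
       + 2 * (\<Sum>i\<in>{i::nat. 2 ^ i * D \<le> 1}. (2 * L / (D * 2 ^ i)) ^ m
            * real (card (near_cone g S2 (h / l) h (2 ^ i) (L ^ 3 / (Q * D * 2 ^ i))))))"
      by (rule cone_duality[OF dp e cball_e' S2V pos \<rho>_def \<rho>1(1) \<rho>e R_def R1 R2 m_def])
    also have "\<dots> \<le> 4 * 48 * (48 * real m) ^ m * 96 * ((1 + 2 * L * (real m)\<^sup>2) * D * R ^ m * Q) *
     (((2 * L + 1) / \<rho>) ^ m + 2 * K3 / (\<rho> ^ m * sqrt (D * Q * h)) + 2 * (K2 * (1 / D ^ m * k ^ (m - 1) * \<tau> * D powr (- \<beta>))))"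
      unfolding K3_def using dual L pos R_0 by (intro mult_left_mono add_mono order_refl) auto
    also have "\<dots> = K1 * ((D * R ^ m * Q) * ((2 * L + 1) / \<rho>) ^ m + (D * R ^ m * Q) * (2 * K3 / (\<rho> ^ m * sqrt (D * Q * h)))
        + (D * R ^ m * Q) * (2 * (K2 * (1 / D ^ m * k ^ (m - 1) * \<tau> * D powr (- \<beta>)))))"
      unfolding K1_def by (simp only: distrib_left mult_ac)
    also have "\<dots> \<le> K1 * (2 ^ m * (2 * L + 1) ^ m * (Q ^ m * (D * Q * l ^ m)) + 2 ^ m * (2 * K3) * (Q ^ m * (sqrt (D * Q) * (l ^ m / sqrt h)))
        + 2 ^ m * (2 * K2) * (Q ^ m * (D powr (- \<beta>) * (l ^ (m - 1) * \<tau>))))"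
      unfolding t1 t2 using t3 K1 by (intro mult_left_mono add_mono order_refl) auto
    also have "\<dots> \<le> K1 * (2 ^ m * ((2 * L + 1) ^ m + 2 * K3 + 2 * K2) * (Q ^ m * (D * Q * l ^ m))
        + 2 ^ m * ((2 * L + 1) ^ m + 2 * K3 + 2 * K2) * (Q ^ m * (sqrt (D * Q) * (l ^ m / sqrt h)))
        + 2 ^ m * ((2 * L + 1) ^ m + 2 * K3 + 2 * K2) * (Q ^ m * (D powr (- \<beta>) * (l ^ (m - 1) * \<tau>))))"
      using K1 K2 K3 L nonneg by (intro mult_left_mono add_mono mult_right_mono) auto
    also have "\<dots> = C * (Q ^ m * (D * Q * l ^ m + sqrt (D * Q) * (l ^ m / sqrt h) + D powr (- \<beta>) * (l ^ (m - 1) * \<tau>)))"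
      unfolding C_def by (simp only: distrib_left mult_ac)
    finally show ?thesis by (simp add: \<tau>_def)
  qed
  ultimately show ?thesis using that[of C R0 c] R01 c by (simp add: m_def)
qed

lemma near_cone_mono: "D \<le> D' \<Longrightarrow> near_cone f S l h Q D \<subseteq> near_cone f S l h Q D'"
  by (auto simp: near_cone_def)

lemma dual_pair_trivial_bound:
  fixes S :: "(real^'m) set"
  assumes dp: "dual_pair U V f g p p' L" and S: "S \<subseteq> U" and pos: "l > 0" "Q \<ge> 1" "D \<ge> 0"
  shows "finite (near_cone f S l h Q D)"
    and "real (card (near_cone f S l h Q D)) \<le> 4 * (6 * L) ^ CARD('m) * ((D + 1) * Q * (Q * l) ^ CARD('m))"
proof -
  note d = dual_pairD[OF dp]
  obtain i where "\<forall>x\<in>U. \<bar>x $ i\<bar> \<ge> 1 / L" using d(16) by auto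
  then have "norm x \<le> L \<and> \<bar>x $ i\<bar> \<ge> 1 / L" if "x \<in> S" for x
    using that d(7) S by blast
  note nt = near_cone_trivial[OF d(3) this pos]
  show "finite (near_cone f S l h Q D)" by (rule nt(1))
  show "real (card (near_cone f S l h Q D)) \<le> 4 * (6 * L) ^ CARD('m) * ((D + 1) * Q * (Q * l) ^ CARD('m))" by (rule nt(2))
qed

text \<open>The trivial count has the main term and Q l^m; the latter is at most Q l^(m-1) times the
  aspect ratio, because l \<le> 1 and the ratio is at least 1.\<close>

lemma cone_estimate_1: "cone_estimate TYPE('m::finite) 1"
  unfolding cone_estimate_def
proof (intro allI impI)
  fix U V :: "(real^'m) set" and f g p p' L S
  assume dp: "dual_pair U V f g p p' L" and S: "compact S" "S \<subseteq> U"
  let ?C = "4 * (6 * L) ^ CARD('m)"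
  have L: "L \<ge> 1" using dp dual_pairD(3) by blast
  have "real (card (near_cone f S l h Q D)) \<le> ?C * cone_bound CARD('m) 1 l h Q D"
    if pos: "0 < h" "h \<le> l" "l \<le> 1" "1 \<le> Q" "0 < D" for l h Q D
  proof -
    have l: "l > 0" using pos by simp
    have \<tau>: "max (l / sqrt h) (sqrt h / l) \<ge> 1" using aspect_ge_1[OF pos(1) l] .
    have "l ^ CARD('m) = l ^ (CARD('m) - 1) * l" by (metis One_nat_def Suc_pred' mult.commute power_Suc zero_less_card_finite)
    also have "\<dots> \<le> l ^ (CARD('m) - 1) * max (l / sqrt h) (sqrt h / l)"
      using \<tau> l pos by (intro mult_left_mono) auto
    finally have le: "l ^ CARD('m) \<le> l ^ (CARD('m) - 1) * max (l / sqrt h) (sqrt h / l)" .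
    have "(D + 1) * Q * (Q * l) ^ CARD('m) = Q ^ CARD('m) * (D * Q * l ^ CARD('m) + Q * l ^ CARD('m) + 0)"
      by (simp add: power_mult_distrib algebra_simps)
    also have "\<dots> \<le> cone_bound CARD('m) 1 l h Q D"
      unfolding cone_bound_def using le pos l by (intro mult_left_mono add_mono) auto
    finally have "?C * ((D + 1) * Q * (Q * l) ^ CARD('m)) \<le> ?C * cone_bound CARD('m) 1 l h Q D"
      using L by (intro mult_left_mono) auto
    then show ?thesis using dual_pair_trivial_bound(2)[OF dp S(2) l pos(4), of D h] pos by linarith
  qed
  then show "\<exists>C. \<forall>l h Q D. 0 < h \<longrightarrow> h \<le> l \<longrightarrow> l \<le> 1 \<longrightarrow> 1 \<le> Q \<longrightarrow> 0 < D \<longrightarrow>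
        real (card (near_cone f S l h Q D)) \<le> C * cone_bound CARD('m) 1 l h Q D" by blast
qed

text \<open>The threshold \<open>D0\<close> below balances the main term against the contribution of the dual hypersurface.\<close>

lemma cone_estimate_step:
  assumes H: "cone_estimate TYPE('m::finite) \<beta>" and \<beta>: "\<beta> > 0" and m2: "CARD('m) \<ge> 2"
  shows "cone_estimate TYPE('m) (\<beta> / (1 + \<beta>))"
  unfolding cone_estimate_def
proof (intro allI impI)
  fix U V :: "(real^'m) set" and f g p p' L S
  assume dp: "dual_pair U V f g p p' L" and S: "compact S" "S \<subseteq> U"
  obtain C R0 c where C: "C \<ge> 0" "R0 \<ge> 1" "0 < c" and
    step: "\<And>l h Q D. 0 < h \<Longrightarrow> h \<le> l \<Longrightarrow> l \<le> 1 \<Longrightarrow> 1 \<le> Q \<Longrightarrow> 0 < D \<Longrightarrow> 1 \<le> D * Q \<Longrightarrow> R0 * h \<le> D * Q * l\<^sup>2 \<Longrightarrow> D \<le> c * Q * h \<Longrightarrow>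
       real (card (near_cone f S l h Q D)) \<le> C * (Q ^ CARD('m) * (D * Q * l ^ CARD('m) + sqrt (D * Q) * (l ^ CARD('m) / sqrt h)
         + D powr (- \<beta>) * (l ^ (CARD('m) - 1) * max (l / sqrt h) (sqrt h / l))))"
    by (rule cone_step_interior[OF H \<beta> m2 dp S]) (rule that)
  define m where "m = CARD('m)"
  have m: "m \<ge> 2" using m2 by (simp add: m_def)
  define \<gamma> where "\<gamma> = \<beta> / (1 + \<beta>)"
  \<comment> \<open>The last equation is the balance: for D0 = Q^(\<gamma>-1), both D0 Q and
    D0^-\<beta> equal Q^\<gamma>.\<close>
  have \<gamma>: "0 < \<gamma>" "\<gamma> < 1" "\<beta> * (1 - \<gamma>) = \<gamma>" using \<beta> by (auto simp: \<gamma>_def field_simps)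
  have L: "L \<ge> 1" using dp dual_pairD(3) by blast
  define Ct where "Ct = 4 * (6 * L) ^ m"
  have Ct: "Ct \<ge> 0" using L by (simp add: Ct_def)
  define K where "K = 2 * Ct + 2 * Ct * (2 + R0) / sqrt c + C * (5 + 2 * R0)"
  have "real (card (near_cone f S l h Q D)) \<le> K * cone_bound m \<gamma> l h Q D"
    if pos: "0 < h" "h \<le> l" "l \<le> 1" "1 \<le> Q" "0 < D" for l h Q D
  proof -
    define \<tau> where "\<tau> = max (l / sqrt h) (sqrt h / l)"
    define B where "B = D * Q * l ^ m + Q powr \<gamma> * (l ^ (m - 1) * \<tau>) + sqrt (D * Q) * (l ^ m / sqrt h)"
    have l: "l > 0" using pos by simp
    have \<tau>: "\<tau> \<ge> 1" "l / sqrt h \<le> \<tau>" using aspect_ge_1[OF pos(1) l] by (auto simp: \<tau>_def)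
    have lm: "l ^ m = l ^ (m - 1) * l" using m by (cases m) auto
    have Qg: "Q powr \<gamma> \<ge> 1" using pos \<gamma> by (simp add: ge_one_powr_ge_zero)
    have B0: "D * Q * l ^ m \<ge> 0" "Q powr \<gamma> * (l ^ (m - 1) * \<tau>) \<ge> 0" "sqrt (D * Q) * (l ^ m / sqrt h) \<ge> 0"
      using pos l \<tau> by auto
    then have Bge: "D * Q * l ^ m \<le> B" "Q powr \<gamma> * (l ^ (m - 1) * \<tau>) \<le> B" "sqrt (D * Q) * (l ^ m / sqrt h) \<le> B" "B \<ge> 0"
      unfolding B_def by linarith+
    have second: "x * l ^ (m - 1) * y \<le> B" if "0 \<le> x" "x \<le> Q powr \<gamma>" "0 \<le> y" "y \<le> \<tau>" for x y
    proof -
      have "x * (l ^ (m - 1) * y) \<le> Q powr \<gamma> * (l ^ (m - 1) * \<tau>)"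
        using that l by (intro mult_mono mult_left_mono) auto
      then show ?thesis using Bge(2) by (simp add: mult.assoc)
    qed
    have triv: "real (card (near_cone f S l h Q D)) \<le> Ct * ((D + 1) * Q * (Q * l) ^ m)"
      unfolding Ct_def m_def by (rule dual_pair_trivial_bound(2)[OF dp S(2) l pos(4)]) (use pos in auto)
    have "real (card (near_cone f S l h Q D)) \<le> K * (Q ^ m * B)"
    proof (cases "D \<ge> 1")
      case True
      have "(D + 1) * Q * (Q * l) ^ m \<le> (2 * D) * Q * (Q * l) ^ m"
        using True pos l by (intro mult_right_mono) auto
      also have "\<dots> = 2 * (Q ^ m * (D * Q * l ^ m))" by (simp add: power_mult_distrib)
      also have "\<dots> \<le> 2 * (Q ^ m * B)" using Bge pos by (intro mult_left_mono) auto
      finally have "Ct * ((D + 1) * Q * (Q * l) ^ m) \<le> Ct * (2 * (Q ^ m * B))" using Ct by (intro mult_left_mono)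
      also have "\<dots> \<le> K * (Q ^ m * B)"
      proof -
        have "2 * Ct \<le> K" unfolding K_def using Ct C by simp
        then have "2 * Ct * (Q ^ m * B) \<le> K * (Q ^ m * B)" using Bge pos by (intro mult_right_mono) auto
        then show ?thesis by simp
      qed
      finally show ?thesis using triv by linarith
    next
      case False
      define D0 where "D0 = Q powr (\<gamma> - 1)"
      \<comment> \<open>\<open>near_cone\<close> grows with D, so D may be enlarged. The second
        summand reaches the threshold D0, the third meets the lower bound on D in
        \<open>cone_step_interior\<close>; \<open>E1\<close> to \<open>E3\<close> show that each
        term remains O(B).\<close>
      define D1 where "D1 = D + D0 + R0 * h / (l\<^sup>2 * Q)"
      have D0: "D0 > 0" "D0 * Q = Q powr \<gamma>" using pos by (auto simp: D0_def powr_diff)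
      have D3: "R0 * h / (l\<^sup>2 * Q) > 0" "R0 * h / (l\<^sup>2 * Q) * Q = R0 * h / l\<^sup>2" using pos l C by auto
      have D1: "D \<le> D1" "D0 \<le> D1" "R0 * h / (l\<^sup>2 * Q) \<le> D1" "D1 > 0"
        using D0 D3 pos unfolding D1_def by linarith+
      have D1Q: "D1 * Q = D * Q + Q powr \<gamma> + R0 * h / l\<^sup>2"
        using D0 D3 by (simp add: D1_def distrib_right)
      have hl: "R0 * h / l\<^sup>2 * l ^ m \<le> R0 * B"
      proof -
        have "R0 * h / l\<^sup>2 * l ^ m = R0 * (l ^ (m - 1) * (h / l))" using l by (simp add: lm power2_eq_square)
        also have "h / l \<le> 1" using pos l by simp
        then have "R0 * (l ^ (m - 1) * (h / l)) \<le> R0 * (l ^ (m - 1) * 1)"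
          using C l by (intro mult_left_mono) auto
        also have "\<dots> \<le> R0 * B" using second[of 1 1] Qg \<tau> C by (intro mult_left_mono) auto
        finally show ?thesis .
      qed
      have E1: "D1 * Q * l ^ m \<le> (2 + R0) * B"
      proof -
        have "D1 * Q * l ^ m = D * Q * l ^ m + Q powr \<gamma> * l ^ m + R0 * h / l\<^sup>2 * l ^ m"
          unfolding D1Q by (simp only: distrib_right)
        also have "\<dots> \<le> B + B + R0 * B"
        proof (intro add_mono hl Bge(1))
          show "Q powr \<gamma> * l ^ m \<le> B" using second[of "Q powr \<gamma>" l] Qg \<tau> pos l by (simp add: lm mult.assoc)
        qed
        finally show ?thesis by (simp add: algebra_simps)
      qed
      have E2: "sqrt (D1 * Q) * (l ^ m / sqrt h) \<le> (2 + R0) * B"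
      proof -
        have "sqrt (D1 * Q) \<le> sqrt (D * Q) + sqrt (Q powr \<gamma>) + sqrt (R0 * h / l\<^sup>2)"
        proof -
          have s: "sqrt (a + b + c) \<le> sqrt a + sqrt b + sqrt c" if "a \<ge> 0" "b \<ge> 0" "c \<ge> 0" for a b c :: real
            using sqrt_add_le_add_sqrt[of "a + b" c] sqrt_add_le_add_sqrt[of a b] that by linarith
          show ?thesis unfolding D1Q using pos C by (intro s) auto
        qed
        then have "sqrt (D1 * Q) * (l ^ m / sqrt h) \<le> (sqrt (D * Q) + sqrt (Q powr \<gamma>) + sqrt (R0 * h / l\<^sup>2)) * (l ^ m / sqrt h)"
          using pos l by (intro mult_right_mono) auto
        also have "\<dots> = sqrt (D * Q) * (l ^ m / sqrt h) + sqrt (Q powr \<gamma>) * l ^ (m - 1) * (l / sqrt h) + sqrt R0 * (1 * l ^ (m - 1) * 1)"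
        proof -
          have "sqrt (Q powr \<gamma>) * (l ^ m / sqrt h) = sqrt (Q powr \<gamma>) * l ^ (m - 1) * (l / sqrt h)"
            by (simp add: lm)
          moreover have "sqrt (R0 * h / l\<^sup>2) * (l ^ m / sqrt h) = sqrt R0 * (1 * l ^ (m - 1) * 1)"
            using pos l C by (simp add: lm real_sqrt_mult real_sqrt_divide)
          ultimately show ?thesis by (simp only: distrib_right)
        qed
        also have "\<dots> \<le> B + B + R0 * B"
        proof (intro add_mono Bge(3) mult_mono)
          have "Q powr \<gamma> * 1 \<le> Q powr \<gamma> * Q powr \<gamma>" using Qg by (intro mult_left_mono) auto
          then have "sqrt (Q powr \<gamma>) \<le> Q powr \<gamma>" using Qg by (intro real_le_lsqrt) (auto simp: power2_eq_square)
          then show "sqrt (Q powr \<gamma>) * l ^ (m - 1) * (l / sqrt h) \<le> B"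
            using \<tau> pos l by (intro second) auto
          show "1 * l ^ (m - 1) * 1 \<le> B" using second[of 1 1] Qg \<tau> by simp
          show "sqrt R0 \<le> R0" using C(2) self_le_power[OF C(2), of 2] by (intro real_le_lsqrt) auto
        qed (use C l in auto)
        finally show ?thesis by (simp add: algebra_simps)
      qed
      have E3: "D1 powr (- \<beta>) * (l ^ (m - 1) * \<tau>) \<le> B"
      proof -
        have "D1 powr (- \<beta>) \<le> D0 powr (- \<beta>)" using D1(2) D0(1) \<beta> by (intro powr_mono2') auto
        also have "\<dots> = Q powr (\<beta> * (1 - \<gamma>))" by (simp add: D0_def powr_powr algebra_simps)
        finally have "D1 powr (- \<beta>) \<le> Q powr \<gamma>" by (simp only: \<gamma>(3))
        then show ?thesis using second[of "D1 powr (- \<beta>)" \<tau>] \<tau> by (simp add: mult.assoc)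
      qed
      show ?thesis
      proof (cases "D1 \<le> c * Q * h")
        case True
        have DQ1: "1 \<le> D1 * Q" using Qg pos l C unfolding D1Q by (smt (verit) divide_nonneg_nonneg mult_nonneg_nonneg zero_le_power2)
        have "R0 * h = R0 * h / (l\<^sup>2 * Q) * Q * l\<^sup>2" using l pos by simp
        also have "\<dots> \<le> D1 * Q * l\<^sup>2" using D1(3) pos by (intro mult_right_mono) auto
        finally have R0h: "R0 * h \<le> D1 * Q * l\<^sup>2" .
        have fin: "finite (near_cone f S l h Q D1)"
          by (rule dual_pair_trivial_bound(1)[OF dp S(2) l pos(4)]) (use D1 in auto)
        have "real (card (near_cone f S l h Q D)) \<le> real (card (near_cone f S l h Q D1))"
          using card_mono[OF fin near_cone_mono[OF D1(1)]] by simp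
        also have "\<dots> \<le> C * (Q ^ m * (D1 * Q * l ^ m + sqrt (D1 * Q) * (l ^ m / sqrt h) + D1 powr (- \<beta>) * (l ^ (m - 1) * \<tau>)))"
          using step[OF pos(1-4) D1(4) DQ1 R0h True] by (simp add: m_def \<tau>_def)
        also have "\<dots> \<le> C * (Q ^ m * ((2 + R0) * B + (2 + R0) * B + B))"
          using C pos by (intro mult_left_mono add_mono E1 E2 E3) auto
        also have "\<dots> = C * (5 + 2 * R0) * (Q ^ m * B)" by (simp add: algebra_simps)
        also have "\<dots> \<le> K * (Q ^ m * B)" unfolding K_def using Ct C Bge pos by (intro mult_right_mono) auto
        finally show ?thesis .
      next
        \<comment> \<open>Here D1 > c Q h, so Q \<le> sqrt (D1 Q / (c h)): the trivial count is
          already dominated by the term with sqrt (D1 Q).\<close>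
        case c': False
        have "c * Q * h * Q \<le> D1 * Q" using c' pos by (intro mult_right_mono) auto
        then have "Q\<^sup>2 \<le> D1 * Q / (c * h)" using C pos by (simp add: pos_le_divide_eq power2_eq_square mult_ac)
        then have "Q \<le> sqrt (D1 * Q / (c * h))" by (rule real_le_rsqrt)
        also have "\<dots> = sqrt (D1 * Q) / sqrt h / sqrt c" by (simp add: real_sqrt_mult real_sqrt_divide)
        finally have "Q * l ^ m \<le> sqrt (D1 * Q) / sqrt h / sqrt c * l ^ m" using l by (intro mult_right_mono) auto
        also have "\<dots> = sqrt (D1 * Q) * (l ^ m / sqrt h) / sqrt c" by simp
        also have "\<dots> \<le> (2 + R0) * B / sqrt c" using C by (intro divide_right_mono E2) auto
        finally have Ql: "Q * l ^ m \<le> (2 + R0) * B / sqrt c" .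
        have "(D + 1) * Q * (Q * l) ^ m \<le> 2 * Q * (Q * l) ^ m"
          using False pos l by (intro mult_right_mono) auto
        also have "\<dots> = 2 * (Q ^ m * (Q * l ^ m))" by (simp add: power_mult_distrib)
        also have "\<dots> \<le> 2 * (Q ^ m * ((2 + R0) * B / sqrt c))" using Ql pos by (intro mult_left_mono) auto
        finally have "Ct * ((D + 1) * Q * (Q * l) ^ m) \<le> Ct * (2 * (Q ^ m * ((2 + R0) * B / sqrt c)))"
          using Ct by (rule mult_left_mono)
        also have "\<dots> = 2 * Ct * (2 + R0) / sqrt c * (Q ^ m * B)" by simp
        also have "\<dots> \<le> K * (Q ^ m * B)" unfolding K_def using Ct C Bge pos by (intro mult_right_mono) auto
        finally show ?thesis using triv by linarith
      qed
    qed
    then show ?thesis by (simp add: cone_bound_def B_def \<tau>_def)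
  qed
  then show "\<exists>C. \<forall>l h Q D. 0 < h \<longrightarrow> h \<le> l \<longrightarrow> l \<le> 1 \<longrightarrow> 1 \<le> Q \<longrightarrow> 0 < D \<longrightarrow>
        real (card (near_cone f S l h Q D)) \<le> C * cone_bound CARD('m) (\<beta> / (1 + \<beta>)) l h Q D"
    unfolding m_def \<gamma>_def by blast
qed

text \<open>The substitution \<beta> -> \<beta> / (1 + \<beta>) adds 1 to 1 / \<beta>, so starting
  from 1 it runs through the reciprocals of the positive integers.\<close>

lemma cone_estimate_inverse:
  assumes "CARD('m::finite) \<ge> 2"
  shows "cone_estimate TYPE('m) (1 / real (Suc k))"
proof (induction k)
  case 0
  show ?case using cone_estimate_1 by simp
next
  case (Suc k)
  have "1 / real (Suc k) / (1 + 1 / real (Suc k)) = 1 / real (Suc (Suc k))" by (simp add: field_simps)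
  then show ?case using cone_estimate_step[OF Suc _ assms] by (metis of_nat_0_less_iff zero_less_Suc zero_less_divide_1_iff)
qed

subsection \<open>Local charts of homogeneous functions\<close>

text \<open>A quantitative inverse function theorem for the gradient p. On a small ball, p differs
  from the linear map \<open>A u\<close> by a map with Lipschitz constant B / 2, half the lower
  bound of \<open>A u\<close>; so p is bi-Lipschitz there, and invariance of domain makes its image
  open. The function g is the Legendre transform of f.\<close>

lemma dual_pair_local:
  fixes f :: "real^'m \<Rightarrow> real" and p :: "real^'m \<Rightarrow> real^'m" and A :: "real^'m \<Rightarrow> real^'m^'m"
  assumes W: "open W" "u \<in> W"
    and f': "\<And>x. x \<in> W \<Longrightarrow> (f has_derivative (\<lambda>v. p x \<bullet> v)) (at x)"
    and p': "\<And>x. x \<in> W \<Longrightarrow> (p has_derivative (\<lambda>v. A x *v v)) (at x)"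
    and cont: "\<And>i j. continuous_on W (\<lambda>x. A x $ i $ j)"
    and det: "det (A u) \<noteq> 0" and u0: "u \<noteq> 0" and pu0: "p u \<noteq> 0"
  obtains U V g q L where "u \<in> U" "dual_pair U V f g p q L"
proof -
  have "inj ((*v) (A u))" using det by (simp add: inj_matrix_vector_mult invertible_det_nz)
  then obtain B where B: "B > 0" "\<And>x. B * norm x \<le> norm (A u *v x)"
    using linear_inj_bounded_below_pos[OF matrix_vector_mul_linear] by blast
  obtain B' where B': "\<And>x. norm (A u *v x) \<le> B' * norm x"
    using linear_bounded[OF matrix_vector_mul_linear] by blast
  define m where "m = real CARD('m)"
  have m: "m > 0" by (simp add: m_def)
  \<comment> \<open>If all entries of \<open>A x - A u\<close> are at most \<epsilon> in absolute
    value, its operator norm is at most m^2 \<epsilon> = B / 2.\<close>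
  define \<epsilon> where "\<epsilon> = B / (2 * m * m)"
  have \<epsilon>: "\<epsilon> > 0" using B m by (simp add: \<epsilon>_def)
  have "\<forall>\<^sub>F x in nhds u. \<forall>i j. \<bar>A x $ i $ j - A u $ i $ j\<bar> < \<epsilon>"
  proof (intro eventually_all_finite)
    fix i j
    have "isCont (\<lambda>x. A x $ i $ j) u" using cont W by (simp add: continuous_on_eq_continuous_at)
    then have "((\<lambda>x. A x $ i $ j) \<longlongrightarrow> A u $ i $ j) (nhds u)"
      using tendsto_at_iff_tendsto_nhds[of "\<lambda>x. A x $ i $ j" u] by (simp add: isCont_def)
    then show "\<forall>\<^sub>F x in nhds u. \<bar>A x $ i $ j - A u $ i $ j\<bar> < \<epsilon>"
      using \<epsilon> by (auto simp: tendsto_iff dist_real_def)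
  qed
  then obtain r1 where r1: "r1 > 0" "\<And>x i j. x \<in> ball u r1 \<Longrightarrow> \<bar>A x $ i $ j - A u $ i $ j\<bar> < \<epsilon>"
    unfolding eventually_nhds_metric by (auto simp: dist_commute)
  obtain r2 where r2: "r2 > 0" "ball u r2 \<subseteq> W" using W by (meson open_contains_ball)
  obtain i0 where i0: "u $ i0 \<noteq> 0" using u0 by (auto simp: vec_eq_iff)
  obtain i1 where i1: "p u $ i1 \<noteq> 0" using pu0 by (auto simp: vec_eq_iff)
  define L0 where "L0 = \<bar>B'\<bar> + B"
  have L0: "L0 > 0" using B by (simp add: L0_def)
  \<comment> \<open>The last two entries keep one coordinate of x and one of \<open>p x\<close> at
    no less than half of their absolute values at u, as the coordinate conditions of
    \<open>dual_pair\<close> demand.\<close>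
  define r where "r = Min {r1, r2, \<bar>u $ i0\<bar> / 2, \<bar>p u $ i1\<bar> / (2 * L0)}"
  have r: "r > 0" "r \<le> r1" "r \<le> r2" "r \<le> \<bar>u $ i0\<bar> / 2" "r \<le> \<bar>p u $ i1\<bar> / (2 * L0)"
  proof -
    show "r > 0" using r1 r2 i0 i1 L0 by (simp add: r_def)
    show "r \<le> r1" "r \<le> r2" "r \<le> \<bar>u $ i0\<bar> / 2" "r \<le> \<bar>p u $ i1\<bar> / (2 * L0)"
      unfolding r_def by (rule Min_le; simp)+
  qed
  define U where "U = ball u r"
  have UW: "U \<subseteq> W" using r r2 by (auto simp: U_def)
  have uU: "u \<in> U" using r by (simp add: U_def)
  define k where "k = (\<lambda>x. p x - A u *v x)"
  have kder: "(k has_derivative (\<lambda>v. (A x - A u) *v v)) (at x within U)" if "x \<in> U" for x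
  proof -
    have "(p has_derivative (\<lambda>v. A x *v v)) (at x within U)"
      using p' that UW has_derivative_at_withinI by blast
    moreover have "((\<lambda>x. A u *v x) has_derivative (\<lambda>v. A u *v v)) (at x within U)"
      by (intro linear_imp_has_derivative matrix_vector_mul_linear)
    ultimately have "(k has_derivative (\<lambda>v. A x *v v - A u *v v)) (at x within U)"
      unfolding k_def by (rule has_derivative_diff)
    then show ?thesis by (simp add: matrix_vector_mult_diff_rdistrib)
  qed
  have kbound: "onorm (\<lambda>v. (A x - A u) *v v) \<le> B / 2" if "x \<in> U" for x
  proof -
    have "\<bar>(A x - A u) $ i $ j\<bar> \<le> \<epsilon>" for i j using r1(2)[of x i j] that r by (simp add: U_def less_imp_le)
    then have "onorm ((*v) (A x - A u)) \<le> real CARD('m) * real CARD('m) * \<epsilon>" by (rule onorm_le_matrix_component)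
    also have "\<dots> = B / 2" using m by (simp add: \<epsilon>_def m_def)
    finally show ?thesis .
  qed
  have k_lip: "norm (k x - k y) \<le> B / 2 * norm (x - y)" if "x \<in> U" "y \<in> U" for x y
    using differentiable_bound[OF _ kder kbound that] by (simp add: U_def)
  have p_diff: "p x - p y = A u *v (x - y) + (k x - k y)" for x y
    by (simp add: k_def matrix_vector_mult_diff_distrib)
  have p_lower: "norm (x - y) \<le> 2 / B * norm (p x - p y)" if "x \<in> U" "y \<in> U" for x y
  proof -
    have "norm (A u *v (x - y)) \<le> norm (p x - p y) + norm (k x - k y)"
    proof -
      have "A u *v (x - y) = (p x - p y) - (k x - k y)" by (simp add: p_diff[of x y])
      then show ?thesis using norm_triangle_ineq4[of "p x - p y" "k x - k y"] by simp
    qed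
    then have "B * norm (x - y) \<le> norm (p x - p y) + B / 2 * norm (x - y)"
      using B(2)[of "x - y"] k_lip[OF that] by linarith
    then have "B / 2 * norm (x - y) \<le> norm (p x - p y)" by simp
    then show ?thesis using B by (simp add: field_simps)
  qed
  have p_upper: "norm (p x - p y) \<le> L0 * norm (x - y)" if "x \<in> U" "y \<in> U" for x y
  proof -
    have "norm (p x - p y) \<le> norm (A u *v (x - y)) + norm (k x - k y)"
      unfolding p_diff[of x y] by (rule norm_triangle_ineq)
    also have "\<dots> \<le> B' * norm (x - y) + B / 2 * norm (x - y)" using B'[of "x - y"] k_lip[OF that] by linarith
    also have "\<dots> = (B' + B / 2) * norm (x - y)" by (simp add: distrib_right)
    also have "\<dots> \<le> L0 * norm (x - y)" using B by (intro mult_right_mono) (auto simp: L0_def)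
    finally show ?thesis .
  qed
  have taylor: "\<bar>f y - f x - p x \<bullet> (y - x)\<bar> \<le> L0 * (norm (y - x))\<^sup>2" if xy: "x \<in> U" "y \<in> U" for x y
  proof -
    define F where "F = (\<lambda>z. f z - p x \<bullet> z)"
    have seg: "closed_segment x y \<subseteq> U" using xy unfolding U_def by (simp add: closed_segment_subset)
    have der: "(F has_derivative (\<lambda>v. (p z - p x) \<bullet> v)) (at z within closed_segment x y)" if "z \<in> closed_segment x y" for z
    proof -
      have "(f has_derivative (\<lambda>v. p z \<bullet> v)) (at z within closed_segment x y)"
        using f' that seg UW has_derivative_at_withinI by blast
      then have "(F has_derivative (\<lambda>v. p z \<bullet> v - p x \<bullet> v)) (at z within closed_segment x y)"
        unfolding F_def by (intro derivative_intros) auto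
      then show ?thesis by (simp add: inner_diff_left)
    qed
    have bd: "onorm (\<lambda>v. (p z - p x) \<bullet> v) \<le> L0 * norm (y - x)" if z: "z \<in> closed_segment x y" for z
    proof (rule onorm_bound)
      show "0 \<le> L0 * norm (y - x)" using L0 by simp
      fix v :: "real^'m"
      have "norm (z - x) \<le> norm (y - x)" using segment_bound(1)[OF z] .
      then have "L0 * norm (z - x) \<le> L0 * norm (y - x)" using L0 by (intro mult_left_mono) auto
      moreover have "norm (p z - p x) \<le> L0 * norm (z - x)" using p_upper xy z seg by blast
      ultimately have "norm (p z - p x) \<le> L0 * norm (y - x)" by linarith
      then have "norm (p z - p x) * norm v \<le> L0 * norm (y - x) * norm v" by (intro mult_right_mono) auto
      then show "norm ((p z - p x) \<bullet> v) \<le> L0 * norm (y - x) * norm v"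
        using Cauchy_Schwarz_ineq2[of "p z - p x" v] by simp
    qed
    have "norm (F y - F x) \<le> (L0 * norm (y - x)) * norm (y - x)"
      by (rule differentiable_bound[OF convex_closed_segment der bd]) auto
    then show ?thesis by (simp add: F_def inner_diff_right power2_eq_square algebra_simps)
  qed
  have inj: "inj_on p U"
  proof (rule inj_onI)
    fix x y assume "x \<in> U" "y \<in> U" "p x = p y"
    then show "x = y" using p_lower[of x y] by simp
  qed
  have contp: "continuous_on U p"
    using p' UW by (intro continuous_at_imp_continuous_on ballI has_derivative_continuous) blast
  define V where "V = p ` U"
  have openV: "open V" unfolding V_def by (rule invariance_of_domain[OF contp _ inj]) (simp add: U_def)
  define q where "q = the_inv_into U p"
  have q: "q (p x) = x" if "x \<in> U" for x unfolding q_def using the_inv_into_f_f[OF inj that] .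
  define g where "g = (\<lambda>y. y \<bullet> q y - f (q y))"
  have gp: "g (p x) = p x \<bullet> x - f x" if "x \<in> U" for x using q[OF that] by (simp add: g_def)
  define a where "a = norm u + r"
  define b where "b = norm (p u) + L0 * r"
  define c where "c = \<bar>f u\<bar> + norm (p u) * r + L0 * r\<^sup>2"
  have a: "norm x \<le> a" if "x \<in> U" for x
    using that norm_triangle_ineq2[of x u] by (simp add: U_def a_def dist_norm norm_minus_commute)
  have nr: "norm (x - u) \<le> r" if "x \<in> U" for x
    using that by (simp add: U_def dist_norm norm_minus_commute)
  have b: "norm (p x) \<le> b" if "x \<in> U" for x
  proof -
    have "L0 * norm (x - u) \<le> L0 * r" using nr[OF that] L0 by (intro mult_left_mono) auto
    then have "norm (p x - p u) \<le> L0 * r" using p_upper[OF that uU] by linarith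
    then show ?thesis using norm_triangle_ineq2[of "p x" "p u"] by (simp add: b_def)
  qed
  have c: "\<bar>f x\<bar> \<le> c" if "x \<in> U" for x
  proof -
    have "\<bar>p u \<bullet> (x - u)\<bar> \<le> norm (p u) * norm (x - u)" by (rule Cauchy_Schwarz_ineq2)
    also have "\<dots> \<le> norm (p u) * r" using nr[OF that] by (intro mult_left_mono) auto
    finally have "\<bar>p u \<bullet> (x - u)\<bar> \<le> norm (p u) * r" .
    moreover have "L0 * (norm (x - u))\<^sup>2 \<le> L0 * r\<^sup>2" using nr[OF that] L0 by (intro mult_left_mono power_mono) auto
    ultimately show ?thesis using taylor[OF uU that] unfolding c_def by linarith
  qed
  define L where "L = 1 + a + b + c + (a * b + c) + L0 + 2 / B + L0 * (2 / B)\<^sup>2 + 2 / \<bar>u $ i0\<bar> + 2 / \<bar>p u $ i1\<bar>"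
  have nn: "a \<ge> 0" "b \<ge> 0" "c \<ge> 0" "a * b \<ge> 0" "2 / B \<ge> 0" "L0 * (2 / B)\<^sup>2 \<ge> 0" "2 / \<bar>u $ i0\<bar> \<ge> 0" "2 / \<bar>p u $ i1\<bar> \<ge> 0"
    using r L0 B by (auto simp: a_def b_def c_def)
  have L: "1 \<le> L" "a \<le> L" "b \<le> L" "c \<le> L" "a * b + c \<le> L" "L0 \<le> L" "2 / B \<le> L" "L0 * (2 / B)\<^sup>2 \<le> L" "2 / \<bar>u $ i0\<bar> \<le> L" "2 / \<bar>p u $ i1\<bar> \<le> L"
    using nn L0 unfolding L_def by linarith+
  have coord: "1 / L \<le> \<bar>z\<bar>" if "\<bar>z - w\<bar> \<le> \<bar>w\<bar> / 2" "w \<noteq> 0" "2 / \<bar>w\<bar> \<le> L" for z w :: real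
  proof -
    have "1 / L \<le> 1 / (2 / \<bar>w\<bar>)" using that L(1) by (intro divide_left_mono) auto
    also have "\<dots> = \<bar>w\<bar> / 2" by simp
    also have "\<dots> \<le> \<bar>z\<bar>" using that by linarith
    finally show ?thesis .
  qed
  have "dual_pair U V f g p q L"
    unfolding dual_pair_def
  proof (intro conjI ballI)
    show "open U" "open V" "1 \<le> L" using openV L by (auto simp: U_def)
    fix x assume x: "x \<in> U"
    show "p x \<in> V" "q (p x) = x" using x q by (auto simp: V_def)
    show "f x + g (p x) = x \<bullet> p x" using gp[OF x] by (simp add: inner_commute)
    show "norm x \<le> L" "norm (p x) \<le> L" "\<bar>f x\<bar> \<le> L" using a[OF x] b[OF x] c[OF x] L by linarith+
    have "\<bar>p x \<bullet> x\<bar> \<le> b * a" using Cauchy_Schwarz_ineq2[of "p x" x] mult_mono[OF b[OF x] a[OF x] nn(2) norm_ge_zero] by linarith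
    then show "\<bar>g (p x)\<bar> \<le> L" using gp[OF x] c[OF x] L(5) by (simp add: mult.commute)
  next
    fix y assume "y \<in> V"
    then obtain x where "x \<in> U" "y = p x" by (auto simp: V_def)
    then show "q y \<in> U" "p (q y) = y" using q by auto
  next
    fix x y assume x: "x \<in> U" and y: "y \<in> U"
    show "norm (p x - p y) \<le> L * norm (x - y)"
      by (rule order_trans[OF p_upper[OF x y] mult_right_mono[OF L(6) norm_ge_zero]])
    show "norm (x - y) \<le> L * norm (p x - p y)"
      by (rule order_trans[OF p_lower[OF x y] mult_right_mono[OF L(7) norm_ge_zero]])
    show "\<bar>f y - f x - p x \<bullet> (y - x)\<bar> \<le> L * (norm (y - x))\<^sup>2"
      by (rule order_trans[OF taylor[OF x y] mult_right_mono[OF L(6) zero_le_power2]])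
    \<comment> \<open>The Taylor remainder of g at \<open>p x\<close> is that of f at y, by the
      Legendre identity at both points; no derivative of g is taken.\<close>
    have "g (p y) - g (p x) - x \<bullet> (p y - p x) = f x - f y - p y \<bullet> (x - y)"
      using gp[OF x] gp[OF y] by (simp add: inner_diff_right inner_commute)
    also have "\<bar>\<dots>\<bar> \<le> L0 * (norm (x - y))\<^sup>2" by (rule taylor[OF y x])
    also have "\<dots> \<le> L0 * (2 / B * norm (p y - p x))\<^sup>2"
      using p_lower[OF x y] L0 by (intro mult_left_mono power_mono) (auto simp: norm_minus_commute)
    also have "\<dots> = L0 * (2 / B)\<^sup>2 * (norm (p y - p x))\<^sup>2" by (simp only: power_mult_distrib mult.assoc)
    also have "\<dots> \<le> L * (norm (p y - p x))\<^sup>2" using L(8) by (intro mult_right_mono) auto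
    finally show "\<bar>g (p y) - g (p x) - x \<bullet> (p y - p x)\<bar> \<le> L * (norm (p y - p x))\<^sup>2" .
  next
    show "\<exists>i. \<forall>x\<in>U. 1 / L \<le> \<bar>p x $ i\<bar>"
    proof (intro exI[of _ i1] ballI)
      fix x assume x: "x \<in> U"
      have "\<bar>(p x - p u) $ i1\<bar> \<le> norm (p x - p u)" by (rule component_le_norm_cart)
      also have "\<dots> \<le> L0 * norm (x - u)" by (rule p_upper[OF x uU])
      also have "\<dots> \<le> L0 * (\<bar>p u $ i1\<bar> / (2 * L0))" using nr[OF x] r(5) L0 by (intro mult_left_mono) auto
      also have "\<dots> = \<bar>p u $ i1\<bar> / 2" using L0 by simp
      finally show "1 / L \<le> \<bar>p x $ i1\<bar>" using i1 L(10) by (intro coord) auto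
    qed
    show "\<exists>i. \<forall>x\<in>U. 1 / L \<le> \<bar>x $ i\<bar>"
    proof (intro exI[of _ i0] ballI)
      fix x assume x: "x \<in> U"
      have "\<bar>(x - u) $ i0\<bar> \<le> norm (x - u)" by (rule component_le_norm_cart)
      also have "\<dots> \<le> \<bar>u $ i0\<bar> / 2" using nr[OF x] r(4) by linarith
      finally show "1 / L \<le> \<bar>x $ i0\<bar>" using i0 L(9) by (intro coord) auto
    qed
  qed
  then show ?thesis using that uU by blast
qed

section \<open>Gradient and Hessian of a homogeneous function\<close>

definition gradient :: "(real^'m \<Rightarrow> real) \<Rightarrow> real^'m \<Rightarrow> real^'m" where
  "gradient f x = (\<chi> i. partial_deriv i f x)"

lemma has_derivative_gradient:
  fixes f :: "real^'m \<Rightarrow> real"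
  assumes "f differentiable (at x)"
  shows "(f has_derivative (\<lambda>v. gradient f x \<bullet> v)) (at x)"
proof -
  have d: "(f has_derivative frechet_derivative f (at x)) (at x)"
    using assms by (simp add: frechet_derivative_works)
  then have lin: "linear (frechet_derivative f (at x))" by (rule has_derivative_linear)
  have "frechet_derivative f (at x) v = gradient f x \<bullet> v" for v
  proof -
    have "v = (\<Sum>i\<in>UNIV. v $ i *\<^sub>R axis i 1)"
      using basis_expansion[of v] by (simp add: scalar_mult_eq_scaleR)
    then have "frechet_derivative f (at x) v = frechet_derivative f (at x) (\<Sum>i\<in>UNIV. v $ i *\<^sub>R axis i 1)"
      by (rule arg_cong)
    also have "\<dots> = (\<Sum>i\<in>UNIV. v $ i * frechet_derivative f (at x) (axis i 1))"
      by (simp add: linear_sum[OF lin] linear_scale[OF lin])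
    finally have "frechet_derivative f (at x) v = (\<Sum>i\<in>UNIV. v $ i * frechet_derivative f (at x) (axis i 1))" .
    then show ?thesis by (simp add: gradient_def partial_deriv_def inner_vec_def mult.commute)
  qed
  then have "frechet_derivative f (at x) = (\<lambda>v. gradient f x \<bullet> v)" by auto
  with d show ?thesis by simp
qed

text \<open>The transpose arises because \<open>hessian\<close> has the outer derivative as its row
  index; keeping it avoids any appeal to the symmetry of second derivatives. The last claim compares
  the derivatives of both sides of f (t x) = t^d f x.\<close>

lemma homogeneous_nondegenerateD:
  fixes f :: "real^'m \<Rightarrow> real"
  assumes f: "f \<in> homogeneous_nondegenerate d" and x: "x \<noteq> 0"
  shows "(f has_derivative (\<lambda>v. gradient f x \<bullet> v)) (at x)"
    and "(gradient f has_derivative (\<lambda>v. transpose (hessian f x) *v v)) (at x)"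
    and "\<And>t. t > 0 \<Longrightarrow> gradient f (t *\<^sub>R x) = t powr (d - 1) *\<^sub>R gradient f x"
proof -
  have "C_k_on (Suc (Suc 0)) (- {0}) f" using f by (simp add: homogeneous_nondegenerate_def smooth_on_def)
  then have fd: "\<And>y. y \<noteq> 0 \<Longrightarrow> f differentiable (at y)"
    and pd: "\<And>i y. y \<noteq> 0 \<Longrightarrow> partial_deriv i f differentiable (at y)" by auto
  show "(f has_derivative (\<lambda>v. gradient f x \<bullet> v)) (at x)" by (rule has_derivative_gradient[OF fd[OF x]])
  show "(gradient f has_derivative (\<lambda>v. transpose (hessian f x) *v v)) (at x)"
  proof (subst has_derivative_componentwise_within, intro ballI)
    fix b :: "real^'m" assume "b \<in> Basis"
    then obtain i where b: "b = axis i 1" by (auto simp: Basis_vec_def)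
    have wb: "w \<bullet> b = w $ i" for w by (simp add: b inner_axis)
    have gr: "gradient k x \<bullet> v = (\<Sum>j\<in>UNIV. partial_deriv j k x * v $ j)" for k v
      by (simp add: gradient_def inner_vec_def)
    have "(\<lambda>x. gradient f x \<bullet> b) = partial_deriv i f" unfolding wb by (auto simp: gradient_def)
    moreover have "(\<lambda>v. (transpose (hessian f x) *v v) \<bullet> b) = (\<lambda>v. gradient (partial_deriv i f) x \<bullet> v)"
      unfolding wb gr by (auto simp: matrix_vector_mult_def transpose_def hessian_def)
    ultimately show "((\<lambda>x. gradient f x \<bullet> b) has_derivative (\<lambda>v. (transpose (hessian f x) *v v) \<bullet> b)) (at x)"
      using has_derivative_gradient[OF pd[OF x, of i]] by simp
  qed
  fix t :: real assume t: "t > 0"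
  have tx: "t *\<^sub>R x \<noteq> 0" using t x by simp
  have hom: "f (t *\<^sub>R y) = t powr d * f y" for y using f t by (simp add: homogeneous_nondegenerate_def)
  have "((\<lambda>y. f (t *\<^sub>R y)) has_derivative (\<lambda>v. gradient f (t *\<^sub>R x) \<bullet> (t *\<^sub>R v))) (at x)"
    using has_derivative_gradient[OF fd[OF tx]]
    by (intro has_derivative_compose[where f = "\<lambda>y. t *\<^sub>R y" and g = f] derivative_intros) auto
  moreover have "((\<lambda>y. t powr d * f y) has_derivative (\<lambda>v. t powr d * (gradient f x \<bullet> v))) (at x)"
    by (intro has_derivative_mult_right has_derivative_gradient fd x)
  ultimately have eq: "(\<lambda>v. gradient f (t *\<^sub>R x) \<bullet> (t *\<^sub>R v)) = (\<lambda>v. t powr d * (gradient f x \<bullet> v))"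
    unfolding hom by (rule has_derivative_unique)
  show "gradient f (t *\<^sub>R x) = t powr (d - 1) *\<^sub>R gradient f x"
  proof (subst vec_eq_iff, rule allI)
    fix i
    have "t * gradient f (t *\<^sub>R x) $ i = t powr d * gradient f x $ i"
      using fun_cong[OF eq, of "axis i 1"] by (simp add: inner_axis)
    then show "gradient f (t *\<^sub>R x) $ i = (t powr (d - 1) *\<^sub>R gradient f x) $ i"
      using t by (simp add: powr_diff field_simps)
  qed
qed

subsection \<open>Counting rational points near the hypersurface\<close>

text \<open>By homogeneity a zero of the gradient at u persists along the ray through u, so the
  derivative of the gradient in direction u vanishes; then u would lie in the kernel of the
  nonsingular transposed Hessian.\<close>

lemma gradient_nonzero:
  fixes f :: "real^'m \<Rightarrow> real"
  assumes f: "f \<in> homogeneous_nondegenerate d" and u: "u \<noteq> 0"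
  shows "gradient f u \<noteq> 0"
proof
  assume z: "gradient f u = 0"
  have d1: "((\<lambda>t. t *\<^sub>R u) has_derivative (\<lambda>s. s *\<^sub>R u)) (at (1::real))"
    by (rule bounded_linear_imp_has_derivative[OF bounded_linear_scaleR_left])
  have d2: "(gradient f has_derivative (\<lambda>v. transpose (hessian f u) *v v)) (at (1 *\<^sub>R u))"
    using homogeneous_nondegenerateD(2)[OF f u] by simp
  note has_derivative_compose[OF d1 d2]
  moreover have "((\<lambda>t. gradient f (t *\<^sub>R u)) has_derivative (\<lambda>s. 0)) (at 1)"
  proof (rule has_derivative_transform_within_open[where s = "{0<..}"])
    show "((\<lambda>t::real. 0 :: real^'m) has_derivative (\<lambda>s. 0)) (at 1)" by (rule has_derivative_const)
    show "0 = gradient f (t *\<^sub>R u)" if "t \<in> {0<..}" for t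
      using homogeneous_nondegenerateD(3)[OF f u, of t] that z by simp
  qed auto
  ultimately have "(\<lambda>s::real. transpose (hessian f u) *v (s *\<^sub>R u)) = (\<lambda>s. 0)" by (rule has_derivative_unique)
  then have e: "transpose (hessian f u) *v (1 *\<^sub>R u) = 0" by (rule fun_cong)
  have "inj ((*v) (transpose (hessian f u)))"
    using f u by (simp add: inj_matrix_vector_mult invertible_det_nz homogeneous_nondegenerate_def)
  from injD[OF this, of u 0] e have "u = 0" by simp
  then show False using u by simp
qed

lemma dual_pair_exists:
  fixes f :: "real^'m \<Rightarrow> real"
  assumes f: "f \<in> homogeneous_nondegenerate d" and u: "u \<noteq> 0"
  obtains U V g q L where "u \<in> U" "dual_pair U V f g (gradient f) q L"
proof -
  have "C_k_on (Suc (Suc 0)) (- {0}) f" using f by (simp add: homogeneous_nondegenerate_def smooth_on_def)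
  then have cont: "continuous_on (- {0}) (\<lambda>x. transpose (hessian f x) $ i $ j)" for i j
    by (simp add: transpose_def hessian_def)
  have W: "open (- {0::real^'m})" "u \<in> - {0}" using u by auto
  have det: "det (transpose (hessian f u)) \<noteq> 0" using f u by (simp add: homogeneous_nondegenerate_def)
  have f': "(f has_derivative (\<lambda>v. gradient f x \<bullet> v)) (at x)" if "x \<in> - {0}" for x
    using homogeneous_nondegenerateD(1)[OF f] that by simp
  have p': "(gradient f has_derivative (\<lambda>v. transpose (hessian f x) *v v)) (at x)" if "x \<in> - {0}" for x
    using homogeneous_nondegenerateD(2)[OF f] that by simp
  show ?thesis
    by (rule dual_pair_local[OF W f' p' cont det u gradient_nonzero[OF f u]]) (assumption | erule (1) that)+
qed

text \<open>Every point of the compact shell has a ball inside a chart of a dual pair; finitely many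
  such balls cover the shell, and their constants add.\<close>

lemma shell_estimate:
  fixes f :: "real^'m \<Rightarrow> real"
  assumes f: "f \<in> homogeneous_nondegenerate d" and H: "cone_estimate TYPE('m) \<beta>"
  defines "K \<equiv> {x::real^'m. 1 \<le> norm x \<and> norm x \<le> 2}"
  shows "\<exists>C\<ge>0. \<forall>l h Q D. 0 < h \<longrightarrow> h \<le> l \<longrightarrow> l \<le> 1 \<longrightarrow> 1 \<le> Q \<longrightarrow> 0 < D \<longrightarrow>
        finite (near_cone f K l h Q D) \<and> real (card (near_cone f K l h Q D)) \<le> C * cone_bound CARD('m) \<beta> l h Q D"
proof -
  define P where "P = (\<lambda>u e C. e > 0 \<and> C \<ge> 0 \<and> (\<forall>l h Q D. 0 < h \<longrightarrow> h \<le> l \<longrightarrow> l \<le> 1 \<longrightarrow> 1 \<le> Q \<longrightarrow> 0 < D \<longrightarrow>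
        finite (near_cone f (cball u e) l h Q D) \<and> real (card (near_cone f (cball u e) l h Q D)) \<le> C * cone_bound CARD('m) \<beta> l h Q D))"
  have "\<exists>e C. P u e C"
    if u: "u \<in> K" for u
  proof -
    have "u \<noteq> 0" using u by (auto simp: K_def)
    then obtain U V g q L where U: "u \<in> U" and dp: "dual_pair U V f g (gradient f) q L"
      by (rule dual_pair_exists[OF f])
    obtain e where e: "e > 0" "cball u e \<subseteq> U" using dual_pairD(1)[OF dp] U by (meson open_contains_cball)
    have "\<exists>C. \<forall>l h Q D. 0 < h \<longrightarrow> h \<le> l \<longrightarrow> l \<le> 1 \<longrightarrow> 1 \<le> Q \<longrightarrow> 0 < D \<longrightarrow>
        real (card (near_cone f (cball u e) l h Q D)) \<le> C * cone_bound CARD('m) \<beta> l h Q D"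
      by (rule H[unfolded cone_estimate_def, rule_format, OF dp compact_cball e(2)])
    then obtain C where C0: "\<forall>l h Q D. 0 < h \<longrightarrow> h \<le> l \<longrightarrow> l \<le> 1 \<longrightarrow> 1 \<le> Q \<longrightarrow> 0 < D \<longrightarrow>
        real (card (near_cone f (cball u e) l h Q D)) \<le> C * cone_bound CARD('m) \<beta> l h Q D"
      by (rule exE)
    note C = C0[rule_format]
    have "finite (near_cone f (cball u e) l h Q D) \<and> real (card (near_cone f (cball u e) l h Q D)) \<le> max C 0 * cone_bound CARD('m) \<beta> l h Q D"
      if pos: "0 < h" "h \<le> l" "l \<le> 1" "1 \<le> Q" "0 < D" for l h Q D
    proof
      have l: "l > 0" using pos by simp
      show "finite (near_cone f (cball u e) l h Q D)"
        by (rule dual_pair_trivial_bound(1)[OF dp e(2) l pos(4)]) (use pos in simp)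
      have "0 \<le> max (l / sqrt h) (sqrt h / l)" using aspect_ge_1[OF pos(1) l] by linarith
      then have "0 \<le> cone_bound CARD('m) \<beta> l h Q D" using pos l by (simp add: cone_bound_def)
      then have "C * cone_bound CARD('m) \<beta> l h Q D \<le> max C 0 * cone_bound CARD('m) \<beta> l h Q D"
        by (intro mult_right_mono) auto
      then show "real (card (near_cone f (cball u e) l h Q D)) \<le> max C 0 * cone_bound CARD('m) \<beta> l h Q D"
        using C[OF pos] by linarith
    qed
    then have "P u e (max C 0)" using e(1) unfolding P_def by simp
    then show ?thesis by blast
  qed
  note ex = this
  have "\<forall>u\<in>K. \<exists>z. P u (fst z) (snd z)"
  proof
    fix u assume "u \<in> K"
    then obtain e C where "P u e C" using ex by blast
    then show "\<exists>z. P u (fst z) (snd z)" by (intro exI[of _ "(e, C)"]) simp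
  qed
  from bchoice[OF this] obtain F where F: "\<forall>u\<in>K. P u (fst (F u)) (snd (F u))" by (rule exE)
  define e where "e = (\<lambda>u. fst (F u))"
  define C where "C = (\<lambda>u. snd (F u))"
  have P: "P u (e u) (C u)" if "u \<in> K" for u using F that by (simp add: e_def C_def)
  have e: "e u > 0" if "u \<in> K" for u using P[OF that] unfolding P_def by (rule conjunct1)
  have C0: "C u \<ge> 0" if "u \<in> K" for u using P[OF that] unfolding P_def by (elim conjE)
  have C': "\<forall>l h Q D. 0 < h \<longrightarrow> h \<le> l \<longrightarrow> l \<le> 1 \<longrightarrow> 1 \<le> Q \<longrightarrow> 0 < D \<longrightarrow>
        finite (near_cone f (cball u (e u)) l h Q D) \<and> real (card (near_cone f (cball u (e u)) l h Q D)) \<le> C u * cone_bound CARD('m) \<beta> l h Q D"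
    if "u \<in> K" for u
    using P[OF that] unfolding P_def by (elim conjE)
  note C = C'[rule_format]
  have "K = cball 0 2 - ball 0 1" by (auto simp: K_def)
  then have cK: "compact K" by (simp add: compact_diff)
  have cov: "K \<subseteq> (\<Union>u\<in>K. ball u (e u))"
  proof
    fix u assume "u \<in> K"
    then show "u \<in> (\<Union>u\<in>K. ball u (e u))" using e[of u] by (intro UN_I[of u]) auto
  qed
  obtain T where T: "T \<subseteq> K" "finite T" "K \<subseteq> (\<Union>u\<in>T. ball u (e u))"
    by (rule compactE_image[OF cK _ cov]) (rule open_ball, erule (2) that)
  have bound: "finite (near_cone f K l h Q D) \<and> real (card (near_cone f K l h Q D)) \<le> (\<Sum>u\<in>T. C u) * cone_bound CARD('m) \<beta> l h Q D"
    if pos: "0 < h" "h \<le> l" "l \<le> 1" "1 \<le> Q" "0 < D" for l h Q D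
  proof -
    have Cu: "finite (near_cone f (cball u (e u)) l h Q D)"
      "real (card (near_cone f (cball u (e u)) l h Q D)) \<le> C u * cone_bound CARD('m) \<beta> l h Q D" if "u \<in> T" for u
      by (rule C[OF subsetD[OF T(1) that] pos, THEN conjunct1], rule C[OF subsetD[OF T(1) that] pos, THEN conjunct2])
    have sub: "near_cone f K l h Q D \<subseteq> (\<Union>u\<in>T. near_cone f (cball u (e u)) l h Q D)"
    proof clarify
      fix q a b assume z: "(q, a, b) \<in> near_cone f K l h Q D"
      then have "rvec a /\<^sub>R (of_int q * l) \<in> K" by (simp add: near_cone_def)
      then have "rvec a /\<^sub>R (of_int q * l) \<in> (\<Union>u\<in>T. ball u (e u))" by (rule subsetD[OF T(3)])
      then obtain u where u: "u \<in> T" "rvec a /\<^sub>R (of_int q * l) \<in> ball u (e u)" by (rule UN_E)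
      then have "rvec a /\<^sub>R (of_int q * l) \<in> cball u (e u)" by simp
      then have "(q, a, b) \<in> near_cone f (cball u (e u)) l h Q D" using z by (simp add: near_cone_def)
      with u(1) show "(q, a, b) \<in> (\<Union>u\<in>T. near_cone f (cball u (e u)) l h Q D)" by (rule UN_I)
    qed
    have fin: "finite (\<Union>u\<in>T. near_cone f (cball u (e u)) l h Q D)"
      by (intro finite_UN_I T(2) Cu(1))
    have "real (card (near_cone f K l h Q D)) \<le> real (card (\<Union>u\<in>T. near_cone f (cball u (e u)) l h Q D))"
      using card_mono[OF fin sub] by simp
    also have "\<dots> \<le> (\<Sum>u\<in>T. real (card (near_cone f (cball u (e u)) l h Q D)))"
      unfolding of_nat_sum[symmetric] of_nat_le_iff by (rule card_UN_le[OF T(2)])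
    also have "\<dots> \<le> (\<Sum>u\<in>T. C u * cone_bound CARD('m) \<beta> l h Q D)"
      by (intro sum_mono Cu(2))
    finally show ?thesis using finite_subset[OF sub fin] unfolding sum_distrib_right by (rule conjI[rotated])
  qed
  have "(\<Sum>u\<in>T. C u) \<ge> 0" by (rule sum_nonneg) (rule C0[OF subsetD[OF T(1)]])
  with bound show ?thesis by (intro exI[of _ "\<Sum>u\<in>T. C u"]) simp
qed

text \<open>The condition on a leaves out the point over the origin, so a has norm at least 1 and
  only shells of radius at least 1 / (4 Q) occur. The factor 2 in the norm bound leaves room for
  approximations to points of the unit ball.\<close>

definition rational_near :: "(real^'m \<Rightarrow> real) \<Rightarrow> real \<Rightarrow> real \<Rightarrow> (int \<times> ('m \<Rightarrow> int) \<times> int) set" where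
  "rational_near f Q D = {(q, a, b). Q \<le> of_int q \<and> of_int q \<le> 2 * Q \<and> a \<noteq> (\<lambda>_. 0) \<and> norm (rvec a) \<le> 2 * of_int q
     \<and> \<bar>of_int b - of_int q * f (rvec a /\<^sub>R of_int q)\<bar> \<le> D}"

text \<open>The shell index i is the least one with 2^-i at most the norm of a / q, and homogeneity
  turns f at a / q into l^d f at a / (q l) for l = 2^-i. The norm of a / q is at least 1 / (2 Q),
  which bounds i.\<close>

lemma rational_near_subset:
  fixes f :: "real^'m \<Rightarrow> real"
  assumes f: "f \<in> homogeneous_nondegenerate d" and Q: "Q \<ge> 1"
  shows "rational_near f Q D \<subseteq> (\<Union>i\<in>{i::nat. 2 ^ i \<le> 4 * Q}.
     near_cone f {x. 1 \<le> norm x \<and> norm x \<le> 2} ((1 / 2) ^ i) (((1 / 2) ^ i) powr d) Q D)"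
proof clarify
  fix q a b assume z: "(q, a, b) \<in> rational_near f Q D"
  then have q: "Q \<le> of_int q" "of_int q \<le> 2 * Q" and a: "a \<noteq> (\<lambda>_. 0)" and n: "norm (rvec a) \<le> 2 * of_int q"
     and b: "\<bar>of_int b - of_int q * f (rvec a /\<^sub>R of_int q)\<bar> \<le> D" by (auto simp: rational_near_def)
  have q0: "real_of_int q > 0" using q Q by linarith
  obtain j where "a j \<noteq> 0" using a by auto
  then have "1 \<le> \<bar>rvec a $ j\<bar>" by simp
  also have "\<dots> \<le> norm (rvec a)" by (rule component_le_norm_cart)
  finally have n1: "1 \<le> norm (rvec a)" .
  define y where "y = norm (rvec a) / of_int q"
  have y: "y \<le> 2" using n q0 by (simp add: y_def divide_le_eq)
  have y0: "y > 0" unfolding y_def using n1 q0 by (intro divide_pos_pos) linarith+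
  have "1 / (2 * Q) \<le> norm (rvec a) / of_int q" using n1 q q0 Q by (intro frac_le) auto
  then have yQ: "1 / (2 * Q) \<le> y" by (simp add: y_def)
  have ex: "\<exists>i. (1 / 2 :: real) ^ i \<le> y"
    using real_arch_pow_inv[of y "1 / 2"] y0 by (auto intro: less_imp_le)
  define i where "i = (LEAST i. (1 / 2 :: real) ^ i \<le> y)"
  have i1: "(1 / 2) ^ i \<le> y" unfolding i_def using LeastI_ex[OF ex] .
  have i2: "y \<le> 2 * (1 / 2) ^ i"
  proof (cases i)
    case 0
    then show ?thesis using y by simp
  next
    case (Suc k)
    have "\<not> (1 / 2) ^ k \<le> y" using not_less_Least[of k "\<lambda>i. (1 / 2 :: real) ^ i \<le> y"] Suc i_def by simp
    then show ?thesis using Suc by simp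
  qed
  define l :: real where "l = (1 / 2) ^ i"
  have l: "l > 0" by (simp add: l_def)
  have l2: "l = 1 / 2 ^ i" by (simp add: l_def power_one_over)
  have "1 / (2 * Q) \<le> 2 * l" using yQ i2 by (simp add: l_def)
  then have iQ: "2 ^ i \<le> 4 * Q" using Q by (simp add: l2 field_simps)
  have f': "f (rvec a /\<^sub>R (of_int q * l)) * l powr d = f (rvec a /\<^sub>R of_int q)"
  proof -
    have "f (t *\<^sub>R v) = t powr d * f v" if "t \<ge> 0" for t v
      using f that by (simp add: homogeneous_nondegenerate_def)
    then have "f (l *\<^sub>R (rvec a /\<^sub>R (of_int q * l))) = l powr d * f (rvec a /\<^sub>R (of_int q * l))"
      using l by (meson less_imp_le)
    moreover have "l *\<^sub>R (rvec a /\<^sub>R (of_int q * l)) = rvec a /\<^sub>R of_int q"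
    proof -
      have "l * inverse (of_int q * l) = inverse (of_int q)" using l by simp
      then show ?thesis by (simp only: scaleR_scaleR)
    qed
    ultimately show ?thesis by (simp only: mult.commute)
  qed
  have "norm (rvec a /\<^sub>R (of_int q * l)) = y / l" using q0 l by (simp add: y_def divide_inverse abs_mult mult_ac)
  then have "1 \<le> norm (rvec a /\<^sub>R (of_int q * l))" "norm (rvec a /\<^sub>R (of_int q * l)) \<le> 2"
    using i1 i2 l by (auto simp: l_def[symmetric] divide_le_eq)
  moreover have "\<bar>of_int b - of_int q * l powr d * f (rvec a /\<^sub>R (of_int q * l))\<bar> \<le> D"
    using b unfolding f'[symmetric] by (simp add: mult_ac)
  ultimately have "(q, a, b) \<in> near_cone f {x. 1 \<le> norm x \<and> norm x \<le> 2} l (l powr d) Q D"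
    using q by (simp add: near_cone_def)
  then show "(q, a, b) \<in> (\<Union>i\<in>{i::nat. 2 ^ i \<le> 4 * Q}.
     near_cone f {x. 1 \<le> norm x \<and> norm x \<le> 2} ((1 / 2) ^ i) (((1 / 2) ^ i) powr d) Q D)"
    using iQ by (auto simp: l_def)
qed

lemma card_dyadic_le:
  fixes X \<epsilon> :: real
  assumes "X \<ge> 1" "\<epsilon> > 0"
  shows "finite {i::nat. 2 ^ i \<le> X}" and "real (card {i::nat. 2 ^ i \<le> X}) \<le> (1 + 1 / (\<epsilon> * ln 2)) * X powr \<epsilon>"
proof -
  have sub: "{i::nat. 2 ^ i \<le> X} \<subseteq> {..nat \<lfloor>log 2 X\<rfloor>}"
  proof
    fix i :: nat assume "i \<in> {i::nat. 2 ^ i \<le> X}"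
    then have "real i \<le> log 2 X" using assms by (simp add: le_log_iff powr_realpow)
    then show "i \<in> {..nat \<lfloor>log 2 X\<rfloor>}" by (simp add: le_nat_floor)
  qed
  show "finite {i::nat. 2 ^ i \<le> X}" using finite_subset[OF sub] by simp
  have "log 2 X \<ge> 0" using assms by simp
  then have "real (card {i::nat. 2 ^ i \<le> X}) \<le> 1 + log 2 X"
    using card_mono[OF _ sub] by (simp add: le_floor_iff) linarith
  also have "log 2 X = ln X / ln 2" by (simp add: log_def)
  also have "\<dots> \<le> X powr \<epsilon> / \<epsilon> / ln 2" using ln_powr_bound[OF assms] by (intro divide_right_mono) auto
  also have "1 \<le> X powr \<epsilon>" using assms by (simp add: ge_one_powr_ge_zero)
  finally show "real (card {i::nat. 2 ^ i \<le> X}) \<le> (1 + 1 / (\<epsilon> * ln 2)) * X powr \<epsilon>"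
    by (simp add: distrib_right)
qed

text \<open>On the shell with l = 2^-i and h = l^d, d > 1 gives h \<le> l, and
  \<open>d \<le> 2 * real CARD('m)\<close> makes l^m / sqrt h at most 1, so no error term grows as
  the shells shrink. The main terms form a geometric series.\<close>

lemma rational_near_count:
  fixes f :: "real^'m \<Rightarrow> real"
  assumes f: "f \<in> homogeneous_nondegenerate d" and d: "1 < d" "d \<le> 2 * real CARD('m)" and m2: "CARD('m) \<ge> 2" and \<epsilon>: "\<epsilon> > 0"
  shows "\<exists>C\<ge>0. \<forall>Q D. 1 \<le> Q \<longrightarrow> 0 < D \<longrightarrow> Q powr \<epsilon> \<le> D * Q \<longrightarrow>
     finite (rational_near f Q D) \<and> real (card (rational_near f Q D)) \<le> C * (D * Q * Q ^ CARD('m))"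
proof -
  define m where "m = CARD('m)"
  have m: "m \<ge> 2" "d \<le> 2 * real m" using m2 d by (auto simp: m_def)
  \<comment> \<open>Two factors Q^\<beta> must fit into Q^\<epsilon>: one is the error exponent, the
    other pays for the logarithmic number of shells.\<close>
  obtain k :: nat where k: "1 / real (Suc k) < \<epsilon> / 2" using nat_approx_posE[of "\<epsilon> / 2"] \<epsilon> by auto
  define \<beta> where "\<beta> = 1 / real (Suc k)"
  have \<beta>: "\<beta> > 0" "2 * \<beta> \<le> \<epsilon>" using k by (auto simp: \<beta>_def)
  have H: "cone_estimate TYPE('m) \<beta>" unfolding \<beta>_def by (rule cone_estimate_inverse[OF m2])
  define K where "K = {x::real^'m. 1 \<le> norm x \<and> norm x \<le> 2}"
  obtain C where C: "C \<ge> 0" and shell': "\<forall>l h Q D. 0 < h \<longrightarrow> h \<le> l \<longrightarrow> l \<le> 1 \<longrightarrow> 1 \<le> Q \<longrightarrow> 0 < D \<longrightarrow>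
        finite (near_cone f K l h Q D) \<and> real (card (near_cone f K l h Q D)) \<le> C * cone_bound m \<beta> l h Q D"
    using shell_estimate[OF f H, folded K_def m_def] by blast
  note shell = shell'[rule_format]
  define c where "c = (1 + 1 / (\<beta> * ln 2)) * 4 powr \<beta>"
  have c: "c \<ge> 0" using \<beta> by (simp add: c_def)
  have bound: "finite (rational_near f Q D) \<and> real (card (rational_near f Q D)) \<le> C * (2 + 2 * c) * (D * Q * Q ^ m)"
    if Q: "1 \<le> Q" and D: "0 < D" and QD: "Q powr \<epsilon> \<le> D * Q" for Q D
  proof -
    define I where "I = {i::nat. 2 ^ i \<le> 4 * Q}"
    have I: "finite I" "real (card I) \<le> c * Q powr \<beta>"
      using card_dyadic_le[of "4 * Q" \<beta>] Q \<beta> by (auto simp: I_def c_def powr_mult)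
    define N where "N = (\<lambda>i. near_cone f K ((1 / 2) ^ i) (((1 / 2) ^ i) powr d) Q D)"
    have N: "finite (N i) \<and> real (card (N i)) \<le> C * (Q ^ m * (D * Q * (1 / 2) ^ i + (Q powr \<beta> + sqrt (D * Q))))" for i
    proof -
      define l :: real where "l = (1 / 2) ^ i"
      have l: "0 < l" "l \<le> 1" by (auto simp: l_def power_le_one)
      define h where "h = l powr d"
      have h: "0 < h" using l by (simp add: h_def)
      have hl: "h \<le> l" using powr_mono'[of 1 d l] l d by (simp add: h_def)
      have lp: "l ^ n = l powr real n" for n using l by (simp add: powr_realpow)
      have sh: "sqrt h = l powr (d / 2)" using l by (simp add: h_def powr_half_sqrt[symmetric] powr_powr)
      have e1: "l ^ m / sqrt h \<le> 1"
      proof -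
        have "l ^ m / sqrt h = l powr (real m - d / 2)" unfolding sh lp using l by (simp add: powr_diff)
        also have "\<dots> \<le> 1" using l m by (intro powr_le1) auto
        finally show ?thesis .
      qed
      have lm: "l ^ m = l ^ (m - 1) * l" using m by (cases m) auto
      have e2: "l ^ (m - 1) * (sqrt h / l) \<le> 1"
      proof -
        have "sqrt h / l = l powr (d / 2 - 1)" unfolding sh using l by (simp add: powr_diff)
        then have "l ^ (m - 1) * (sqrt h / l) = l powr (real (m - 1) + (d / 2 - 1))" 
          unfolding lp by (simp add: powr_add)
        also have "\<dots> \<le> 1" using l m d by (intro powr_le1) auto
        finally show ?thesis .
      qed
      have "l ^ (m - 1) * max (l / sqrt h) (sqrt h / l) \<le> 1"
        using e1 e2 by (auto simp: max_def lm)
      then have a2: "Q powr \<beta> * (l ^ (m - 1) * max (l / sqrt h) (sqrt h / l)) \<le> Q powr \<beta> * 1"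
        by (intro mult_left_mono) auto
      have a3: "sqrt (D * Q) * (l ^ m / sqrt h) \<le> sqrt (D * Q) * 1"
        using e1 D Q by (intro mult_left_mono) auto
      have "l ^ m \<le> l ^ 1" using l m by (intro power_decreasing) auto
      then have a1: "D * Q * l ^ m \<le> D * Q * l" using D Q by (intro mult_left_mono) auto
      have "cone_bound m \<beta> l h Q D \<le> Q ^ m * (D * Q * l + (Q powr \<beta> + sqrt (D * Q)))"
        unfolding cone_bound_def
      proof (rule mult_left_mono)
        show "D * Q * l ^ m + Q powr \<beta> * (l ^ (m - 1) * max (l / sqrt h) (sqrt h / l)) + sqrt (D * Q) * (l ^ m / sqrt h)
          \<le> D * Q * l + (Q powr \<beta> + sqrt (D * Q))" using a1 a2 a3 by linarith
        show "0 \<le> Q ^ m" using Q by simp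
      qed
      then have "C * cone_bound m \<beta> l h Q D \<le> C * (Q ^ m * (D * Q * l + (Q powr \<beta> + sqrt (D * Q))))"
        using C by (rule mult_left_mono)
      then show ?thesis using shell[OF h hl l(2) Q D] by (simp add: N_def l_def h_def)
    qed
    have sub: "rational_near f Q D \<subseteq> (\<Union>i\<in>I. N i)"
      unfolding I_def N_def K_def by (rule rational_near_subset[OF f Q])
    have fin: "finite (\<Union>i\<in>I. N i)" using N by (intro finite_UN_I I(1)) simp
    have s1: "(\<Sum>i\<in>I. (1 / 2 :: real) ^ i) \<le> 2"
    proof -
      have "(\<Sum>i\<in>I. (1 / 2 :: real) ^ i) \<le> (\<Sum>i. (1 / 2 :: real) ^ i)"
        by (intro sum_le_suminf I(1)) (auto intro: summable_geometric)
      also have "\<dots> = 2" by (subst suminf_geometric) auto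
      finally show ?thesis .
    qed
    have "real (card (rational_near f Q D)) \<le> real (card (\<Union>i\<in>I. N i))"
      using card_mono[OF fin sub] by simp
    also have "\<dots> \<le> (\<Sum>i\<in>I. real (card (N i)))"
      using card_UN_le[OF I(1), of N] by (metis of_nat_le_iff of_nat_sum)
    also have "\<dots> \<le> (\<Sum>i\<in>I. C * (Q ^ m * (D * Q * (1 / 2) ^ i + (Q powr \<beta> + sqrt (D * Q)))))"
      using N by (intro sum_mono) simp
    also have "\<dots> = C * (Q ^ m * (D * Q * (\<Sum>i\<in>I. (1 / 2) ^ i) + real (card I) * (Q powr \<beta> + sqrt (D * Q))))"
    proof -
      have "(\<Sum>i\<in>I. D * Q * (1 / 2) ^ i + (Q powr \<beta> + sqrt (D * Q)))
         = D * Q * (\<Sum>i\<in>I. (1 / 2) ^ i) + real (card I) * (Q powr \<beta> + sqrt (D * Q))"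
        by (subst sum.distrib) (simp only: sum_distrib_left sum_constant)
      then show ?thesis by (simp only: sum_distrib_left[symmetric])
    qed
    also have "\<dots> \<le> C * (Q ^ m * (D * Q * 2 + (c * Q powr \<beta>) * (Q powr \<beta> + sqrt (D * Q))))"
      using C Q D s1 I(2) by (intro mult_left_mono add_mono mult_right_mono) auto
    also have "\<dots> \<le> C * (Q ^ m * (D * Q * 2 + c * (2 * (D * Q))))"
    proof -
      have "Q powr \<beta> * Q powr \<beta> = Q powr (2 * \<beta>)" by (simp add: powr_add[symmetric])
      also have "\<dots> \<le> Q powr \<epsilon>" using Q \<beta> by (intro powr_mono) auto
      finally have b: "Q powr \<beta> * Q powr \<beta> \<le> D * Q" using QD by linarith
      then have "(Q powr \<beta>)\<^sup>2 \<le> D * Q" by (simp add: power2_eq_square)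
      then have "Q powr \<beta> \<le> sqrt (D * Q)" by (rule real_le_rsqrt)
      then have "Q powr \<beta> * sqrt (D * Q) \<le> sqrt (D * Q) * sqrt (D * Q)" using D Q by (intro mult_right_mono) auto
      also have "\<dots> = D * Q" using D Q by simp
      finally have "Q powr \<beta> * (Q powr \<beta> + sqrt (D * Q)) \<le> 2 * (D * Q)" using b by (simp add: distrib_left)
      then have "c * (Q powr \<beta> * (Q powr \<beta> + sqrt (D * Q))) \<le> c * (2 * (D * Q))" using c by (rule mult_left_mono)
      then show ?thesis using C Q by (intro mult_left_mono add_left_mono) (auto simp: mult.assoc)
    qed
    also have "\<dots> = C * (2 + 2 * c) * (D * Q * Q ^ m)" by (simp add: algebra_simps)
    finally show ?thesis using finite_subset[OF sub fin] by simp
  qed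
  have "C * (2 + 2 * c) \<ge> 0" using C c by simp
  with bound show ?thesis unfolding m_def by (intro exI[of _ "C * (2 + 2 * c)"]) simp
qed

subsection \<open>Hausdorff measure of limsup sets\<close>

text \<open>The gradient is homogeneous of degree d - 1 > 0, hence bounded near the origin, and the
  mean value inequality applies on segments that avoid 0. On a segment through 0 the norms of the
  end points add up to the distance, and |f x| \<le> L |x| suffices.\<close>

lemma homogeneous_lipschitz:
  fixes f :: "real^'m \<Rightarrow> real"
  assumes f: "f \<in> homogeneous_nondegenerate d" and d: "d > 1"
  obtains L where "L \<ge> 0" "\<And>x y. norm x \<le> 2 \<Longrightarrow> norm y \<le> 2 \<Longrightarrow> \<bar>f x - f y\<bar> \<le> L * norm (x - y)"
proof -
  note D = homogeneous_nondegenerateD[OF f]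
  have contf: "continuous_on (sphere 0 1) f"
    by (intro continuous_at_imp_continuous_on ballI has_derivative_continuous[OF D(1)]) auto
  have contg: "continuous_on (sphere 0 1) (gradient f)"
    by (intro continuous_at_imp_continuous_on ballI has_derivative_continuous[OF D(2)]) auto
  obtain A where A: "\<forall>x\<in>sphere 0 1. norm (f x) \<le> A"
    using compact_imp_bounded[OF compact_continuous_image[OF contf compact_sphere]] by (auto simp: bounded_iff)
  obtain B where B: "\<forall>x\<in>sphere 0 1. norm (gradient f x) \<le> B"
    using compact_imp_bounded[OF compact_continuous_image[OF contg compact_sphere]] by (auto simp: bounded_iff)
  define L where "L = 2 powr (d - 1) * (\<bar>A\<bar> + \<bar>B\<bar>)"
  have L: "L \<ge> 0" by (simp add: L_def)
  have pw: "norm x powr (d - 1) \<le> 2 powr (d - 1)" if "norm x \<le> 2" for x :: "real^'m"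
    using that d by (intro powr_mono2) auto
  have gL: "norm (gradient f x) \<le> L" if x: "x \<noteq> 0" "norm x \<le> 2" for x
  proof -
    have u: "x /\<^sub>R norm x \<in> sphere 0 1" "x /\<^sub>R norm x \<noteq> 0" using x by auto
    have "gradient f (norm x *\<^sub>R (x /\<^sub>R norm x)) = norm x powr (d - 1) *\<^sub>R gradient f (x /\<^sub>R norm x)"
      using x by (intro D(3) u) auto
    then have "norm (gradient f x) = norm x powr (d - 1) * norm (gradient f (x /\<^sub>R norm x))" using x by simp
    also have "\<dots> \<le> 2 powr (d - 1) * (\<bar>A\<bar> + \<bar>B\<bar>)"
      using pw[OF x(2)] bspec[OF B u(1)] by (intro mult_mono) auto
    finally show ?thesis by (simp add: L_def)
  qed
  have hom: "f (t *\<^sub>R v) = t powr d * f v" if "t \<ge> 0" for t v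
    using f that unfolding homogeneous_nondegenerate_def by blast
  have fL: "\<bar>f x\<bar> \<le> L * norm x" if x: "norm x \<le> 2" for x
  proof (cases "x = 0")
    case True
    then show ?thesis using hom[of 0 x] by simp
  next
    case False
    have u: "x /\<^sub>R norm x \<in> sphere 0 1" using False by auto
    have "f x = norm x powr d * f (x /\<^sub>R norm x)" using hom[of "norm x" "x /\<^sub>R norm x"] False by simp
    then have "\<bar>f x\<bar> = norm x powr (d - 1) * norm x * \<bar>f (x /\<^sub>R norm x)\<bar>"
      using False by (simp add: abs_mult powr_diff)
    also have "\<dots> = norm x powr (d - 1) * \<bar>f (x /\<^sub>R norm x)\<bar> * norm x" by simp
    also have "\<dots> \<le> 2 powr (d - 1) * (\<bar>A\<bar> + \<bar>B\<bar>) * norm x"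
      using pw[OF x] bspec[OF A u] by (intro mult_right_mono mult_mono) auto
    finally show ?thesis by (simp add: L_def)
  qed
  have "\<bar>f x - f y\<bar> \<le> L * norm (x - y)" if xy: "norm x \<le> 2" "norm y \<le> 2" for x y
  proof (cases "0 \<in> closed_segment x y")
    case True
    then have "dist x y = dist x 0 + dist 0 y" using between_mem_segment[of x y 0] by (simp add: between)
    then have "norm (x - y) = norm x + norm y" by (simp add: dist_norm)
    then have "L * norm (x - y) = L * norm x + L * norm y" by (simp add: distrib_left)
    then show ?thesis using fL[OF xy(1)] fL[OF xy(2)] by linarith
  next
    case False
    have seg: "norm z \<le> 2" if "z \<in> closed_segment x y" for z
    proof -
      have "closed_segment x y \<subseteq> cball 0 2" using xy by (intro closed_segment_subset) auto
      then show ?thesis using that by auto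
    qed
    have der: "(f has_derivative (\<lambda>v. gradient f z \<bullet> v)) (at z within closed_segment x y)" if "z \<in> closed_segment x y" for z
      using D(1)[of z] that False has_derivative_at_withinI by metis
    have bd: "onorm (\<lambda>v. gradient f z \<bullet> v) \<le> L" if z: "z \<in> closed_segment x y" for z
    proof (rule onorm_bound)
      show "0 \<le> L" by (rule L)
      fix v :: "real^'m"
      have "norm (gradient f z) \<le> L" using gL seg[OF z] z False by metis
      then have "norm (gradient f z) * norm v \<le> L * norm v" by (intro mult_right_mono) auto
      then show "norm (gradient f z \<bullet> v) \<le> L * norm v" using Cauchy_Schwarz_ineq2[of "gradient f z" v] by simp
    qed
    have "norm (f x - f y) \<le> L * norm (x - y)"
      by (rule differentiable_bound[OF convex_closed_segment der bd]) auto
    then show ?thesis by simp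
  qed
  then show ?thesis using that L by blast
qed

lemma hausdorff_measure_eq_0I:
  fixes A :: "'a::metric_space set"
  assumes "\<And>\<delta> \<epsilon>. \<delta> > 0 \<Longrightarrow> \<epsilon> > 0 \<Longrightarrow> \<exists>U. (\<forall>i. bounded (U i) \<and> diameter (U i) \<le> \<delta>) \<and> A \<subseteq> (\<Union>i. U i)
     \<and> (\<Sum>i::nat. hausdorff_gauge s (U i)) \<le> ennreal \<epsilon>"
  shows "hausdorff_measure s A = 0"
proof -
  have "hausdorff_premeasure \<delta> s A \<le> 0" if \<delta>: "\<delta> > 0" for \<delta>
  proof (rule ennreal_le_epsilon)
    fix \<epsilon> :: real assume "\<epsilon> > 0"
    then obtain U where U: "\<forall>i. bounded (U i) \<and> diameter (U i) \<le> \<delta>" "A \<subseteq> (\<Union>i. U i)"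
      "(\<Sum>i::nat. hausdorff_gauge s (U i)) \<le> ennreal \<epsilon>" using assms[OF \<delta>] by metis
    have "hausdorff_premeasure \<delta> s A \<le> (\<Sum>i. hausdorff_gauge s (U i))"
      unfolding hausdorff_premeasure_def using U by (intro INF_lower) simp
    also note U(3)
    finally show "hausdorff_premeasure \<delta> s A \<le> 0 + ennreal \<epsilon>" by simp
  qed
  then show ?thesis unfolding hausdorff_measure_def by (auto intro!: antisym SUP_least)
qed

text \<open>The Borel-Cantelli argument for Hausdorff measure: every tail of the family of sets
  covers A, and the tails of the series are arbitrarily small. One exceptional point x0 is allowed;
  it is covered by a singleton, of gauge 0 because s > 0.\<close>

lemma hausdorff_null_limsup:
  fixes A :: "'a::metric_space set" and W :: "nat \<Rightarrow> 'j::countable set" and V :: "nat \<Rightarrow> 'j \<Rightarrow> 'a set"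
  assumes s: "s > 0" and fin: "\<And>i. finite (W i)"
    and V: "\<And>i j. bounded (V i j)" "\<And>i j. diameter (V i j) \<le> r i" and r: "r \<longlonglongrightarrow> 0"
    and sm: "summable (\<lambda>i. real (card (W i)) * r i powr s)"
    and A: "\<And>x i0. x \<in> A \<Longrightarrow> x \<noteq> x0 \<Longrightarrow> \<exists>i\<ge>i0. \<exists>j\<in>W i. x \<in> V i j"
  shows "hausdorff_measure s A = 0"
proof (rule hausdorff_measure_eq_0I)
  fix \<delta> \<epsilon> :: real assume \<delta>: "\<delta> > 0" and \<epsilon>: "\<epsilon> > 0"
  define t where "t = (\<lambda>i. real (card (W i)) * r i powr s)"
  have t0: "t i \<ge> 0" for i by (simp add: t_def)
  have smt: "summable t" using sm by (simp add: t_def)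
  obtain N1 where N1: "\<And>n. n \<ge> N1 \<Longrightarrow> norm (\<Sum>i. t (i + n)) < \<epsilon>"
    using suminf_exist_split[OF \<epsilon> smt] by blast
  obtain N2 where N2: "\<And>n. n \<ge> N2 \<Longrightarrow> r n < \<delta>"
    using order_tendstoD(2)[OF r \<delta>] by (auto simp: eventually_sequentially)
  define i0 where "i0 = max N1 N2"
  define J where "J = {(i, j). i \<ge> i0 \<and> j \<in> W i}"
  define V' where "V' = (\<lambda>(i, j). V i j)"
  define T where "T = (\<lambda>k. if k \<in> to_nat ` J then V' (from_nat k) else {})"
  define U where "U = (\<lambda>k. case k of 0 \<Rightarrow> {x0} | Suc k \<Rightarrow> T k)"
  have T: "bounded (T k) \<and> diameter (T k) \<le> \<delta>" for k
  proof (cases "k \<in> to_nat ` J")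
    case True
    then obtain i and j :: 'j where ij: "k = to_nat (i, j)" "i \<ge> i0" by (auto simp: J_def)
    then have "T k = V i j" using True by (simp add: T_def V'_def)
    moreover have "r i < \<delta>" using N2 ij by (simp add: i0_def)
    ultimately show ?thesis using V[of i j] by simp
  qed (use \<delta> in \<open>simp add: T_def\<close>)
  have "bounded (U k) \<and> diameter (U k) \<le> \<delta>" for k
    using T \<delta> by (cases k) (simp_all add: U_def)
  moreover have "A \<subseteq> (\<Union>k. U k)"
  proof
    fix x assume x: "x \<in> A"
    show "x \<in> (\<Union>k. U k)"
    proof (cases "x = x0")
      case True
      then have "x \<in> U 0" by (simp add: U_def)
      then show ?thesis by blast
    next
      case False
      then obtain i j where ij: "i \<ge> i0" "j \<in> W i" "x \<in> V i j" using A[OF x, of i0] by blast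
      then have "(i, j) \<in> J" by (simp add: J_def)
      then have "x \<in> U (Suc (to_nat (i, j)))" using ij by (simp add: U_def T_def V'_def)
      then show ?thesis by blast
    qed
  qed
  moreover have "(\<Sum>k. hausdorff_gauge s (U k)) \<le> ennreal \<epsilon>"
  proof (rule suminf_le_const)
    fix N
    have "(\<Sum>k<N. hausdorff_gauge s (U k)) \<le> (\<Sum>k<Suc N. hausdorff_gauge s (U k))"
      by (intro sum_mono2) auto
    also have "\<dots> = hausdorff_gauge s {x0} + (\<Sum>k<N. hausdorff_gauge s (T k))"
      by (subst sum.lessThan_Suc_shift) (simp add: U_def)
    also have "hausdorff_gauge s {x0} = 0" using s by (simp add: hausdorff_gauge_def)
    also have "0 + (\<Sum>k<N. hausdorff_gauge s (T k)) \<le> ennreal \<epsilon>"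
    proof -
      define F where "F = {p \<in> J. to_nat p < N}"
      have "finite (to_nat ` F)" by (rule finite_subset[of _ "{..<N}"]) (auto simp: F_def)
      then have finF: "finite F" by (rule finite_imageD) (auto intro: inj_on_subset[OF inj_to_nat])
      obtain M where M: "\<And>p. p \<in> F \<Longrightarrow> fst p < M"
        using finite_nat_set_iff_bounded[of "fst ` F"] finF by auto
      define G where "G = (SIGMA i:{i0..<i0 + M}. W i)"
      have finG: "finite G" unfolding G_def using fin by (intro finite_SigmaI) auto
      have FG: "F \<subseteq> G" using M by (fastforce simp: F_def J_def G_def)
      have "(\<Sum>k<N. hausdorff_gauge s (T k)) = (\<Sum>k\<in>to_nat ` F. hausdorff_gauge s (T k))"
        by (intro sum.mono_neutral_right) (auto simp: F_def T_def hausdorff_gauge_def)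
      also have "\<dots> = (\<Sum>p\<in>F. hausdorff_gauge s (T (to_nat p)))"
        by (subst sum.reindex) (auto intro: inj_on_subset[OF inj_to_nat])
      also have "\<dots> \<le> (\<Sum>p\<in>F. ennreal (r (fst p) powr s))"
      proof (rule sum_mono)
        fix p assume "p \<in> F"
        then have p: "p \<in> J" by (simp add: F_def)
        obtain i j where ij: "p = (i, j)" by (cases p)
        have "T (to_nat p) = V i j" using p by (simp add: T_def V'_def ij)
        moreover have "diameter (V i j) powr s \<le> r i powr s"
          using V s diameter_ge_0[of "V i j"] by (intro powr_mono2) auto
        ultimately show "hausdorff_gauge s (T (to_nat p)) \<le> ennreal (r (fst p) powr s)"
          using s by (simp add: hausdorff_gauge_def ij ennreal_leI)
      qed
      also have "\<dots> = ennreal (\<Sum>p\<in>F. r (fst p) powr s)" by simp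
      also have "\<dots> \<le> ennreal \<epsilon>"
      proof (rule ennreal_leI)
        have "(\<Sum>p\<in>F. r (fst p) powr s) \<le> (\<Sum>p\<in>G. r (fst p) powr s)"
          using finG FG by (intro sum_mono2) auto
        also have "\<dots> = (\<Sum>i\<in>{i0..<i0 + M}. \<Sum>j\<in>W i. r i powr s)"
          unfolding G_def by (subst sum.Sigma) (auto simp: fin case_prod_unfold)
        also have "\<dots> = (\<Sum>i\<in>{i0..<i0 + M}. t i)" by (simp add: t_def)
        also have "\<dots> = (\<Sum>i<M. t (i + i0))"
          using sum.shift_bounds_nat_ivl[of t 0 i0 M] by (simp add: add.commute atLeast0LessThan)
        also have "\<dots> \<le> (\<Sum>i. t (i + i0))"
          using smt t0 by (intro sum_le_suminf) (auto simp: summable_iff_shift)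
        also have "\<dots> \<le> \<epsilon>" using N1[of i0] by (simp add: i0_def)
        finally show "(\<Sum>p\<in>F. r (fst p) powr s) \<le> \<epsilon>" .
      qed
      finally show ?thesis by simp
    qed
    finally show "(\<Sum>k<N. hausdorff_gauge s (U k)) \<le> ennreal \<epsilon>" .
  qed simp
  ultimately show "\<exists>U. (\<forall>i. bounded (U i) \<and> diameter (U i) \<le> \<delta>) \<and> A \<subseteq> (\<Union>i. U i)
     \<and> (\<Sum>i::nat. hausdorff_gauge s (U i)) \<le> ennreal \<epsilon>" by blast
qed

section \<open>Dyadic blocks of denominators and the resulting cover\<close>

lemma summable_dyadic_blocks:
  fixes w :: "nat \<Rightarrow> real"
  assumes "summable w" "\<And>q. w q \<ge> 0"
  shows "summable (\<lambda>i. \<Sum>q\<in>{2 ^ i..<2 ^ Suc i}. w q)"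
proof (rule summableI_nonneg_bounded)
  show "0 \<le> (\<Sum>q\<in>{2 ^ i..<2 ^ Suc i}. w q)" for i using assms by (intro sum_nonneg) auto
  fix N
  have "(\<Sum>i<N. \<Sum>q\<in>{2 ^ i..<2 ^ Suc i}. w q) = (\<Sum>q\<in>{1..<2 ^ N}. w q)"
  proof (induction N)
    case (Suc N)
    have "(1::nat) \<le> 2 ^ N" "(2::nat) ^ N \<le> 2 ^ Suc N" by simp_all
    from sum.atLeastLessThan_concat[OF this, of w] show ?case using Suc by simp
  qed simp
  also have "\<dots> \<le> suminf w" using assms by (intro sum_le_suminf) auto
  finally show "(\<Sum>i<N. \<Sum>q\<in>{2 ^ i..<2 ^ Suc i}. w q) \<le> suminf w" .
qed

lemma infdist_Ints_less:
  assumes "infdist y \<int> < e"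
  shows "\<exists>k::int. \<bar>y - of_int k\<bar> < e"
proof -
  have "(\<int> :: real set) \<noteq> {}" by auto
  then have "(INF a\<in>\<int>. dist y a) < e" using assms by (simp add: infdist_notempty)
  then obtain a where "a \<in> \<int>" "dist y a < e"
    using cInf_lessD[of "dist y ` \<int>" e] \<open>\<int> \<noteq> {}\<close> by blast
  then show ?thesis by (auto simp: Ints_def dist_real_def)
qed

lemma simult_approx_rational:
  fixes f :: "real^'m \<Rightarrow> real" and q :: nat
  assumes q: "q \<ge> 1" and close: "Max ((\<lambda>b. infdist (real q * ((x, f x) \<bullet> b)) \<int>) ` Basis) < e"
  shows "\<exists>(a :: 'm \<Rightarrow> int) b. (\<forall>i. \<bar>real q * x $ i - of_int (a i)\<bar> < e) \<and> \<bar>real q * f x - of_int b\<bar> < e"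
proof -
  have B: "infdist (real q * ((x, f x) \<bullet> b)) \<int> < e" if "b \<in> Basis" for b
    using close that by (subst (asm) Max_less_iff) auto
  have "\<exists>k::int. \<bar>real q * x $ i - of_int k\<bar> < e" for i
  proof -
    have "(axis i 1, 0) \<in> (Basis :: ((real^'m) \<times> real) set)" by (auto simp: Basis_prod_def Basis_vec_def)
    from B[OF this] show ?thesis by (intro infdist_Ints_less) (simp add: inner_axis)
  qed
  then obtain a where "\<forall>i. \<bar>real q * x $ i - of_int (a i)\<bar> < e" by metis
  moreover have "\<exists>k::int. \<bar>real q * f x - of_int k\<bar> < e"
  proof -
    have "(0, 1) \<in> (Basis :: ((real^'m) \<times> real) set)" by (auto simp: Basis_prod_def)
    from B[OF this] show ?thesis by (intro infdist_Ints_less) simp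
  qed
  ultimately show ?thesis by blast
qed

text \<open>The Lipschitz bound moves the approximation of q f x by b to one of q f (a / q), at the
  cost of the factor 1 + L m. The hypothesis on the coordinate j prevents a = 0, and q \<ge> m keeps
  the norm of a below 2 q. The bound e, common to the whole dyadic block, replaces the value at
  q.\<close>

lemma simult_approx_cover:
  fixes f :: "real^'m \<Rightarrow> real" and x :: "real^'m" and q :: nat and e L :: real
  assumes lip: "\<And>x y. norm x \<le> 2 \<Longrightarrow> norm y \<le> 2 \<Longrightarrow> \<bar>f x - f y\<bar> \<le> L * norm (x - y)" and L: "L \<ge> 0"
    and x: "norm x < 1" and j: "real q * \<bar>x $ j\<bar> \<ge> 1" and q: "real q \<ge> CARD('m)"
    and e: "e \<le> 1" and iq: "2 ^ i \<le> q" "q < 2 ^ Suc i"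
    and close: "Max ((\<lambda>b. infdist (real q * ((x, f x) \<bullet> b)) \<int>) ` Basis) < e"
  shows "\<exists>k a b. (k, a, b) \<in> rational_near f (2 ^ i) ((1 + L * real CARD('m)) * e) \<and>
     (x, f x) \<in> cball (rvec a /\<^sub>R of_int k, of_int b / of_int k) ((real CARD('m) + 1) * e / 2 ^ i)"
proof -
  define m where "m = real CARD('m)"
  have m: "m \<ge> 1" by (simp add: m_def Suc_leI)
  have q1: "real q \<ge> 1" using q m unfolding m_def by linarith
  obtain a :: "'m \<Rightarrow> int" and b where a: "\<And>k. \<bar>real q * x $ k - of_int (a k)\<bar> < e" and b: "\<bar>real q * f x - of_int b\<bar> < e"
    using simult_approx_rational[where x = x and f = f and q = q and e = e, OF _ close] q1 by auto
  have e0: "e > 0" using b by linarith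
  define y where "y = rvec a /\<^sub>R real q"
  have ya: "rvec a = real q *\<^sub>R y" using q1 by (simp add: y_def)
  have n1: "norm (real q *\<^sub>R x - rvec a) \<le> m * e"
  proof -
    have "norm (real q *\<^sub>R x - rvec a) \<le> (\<Sum>k\<in>UNIV. \<bar>(real q *\<^sub>R x - rvec a) $ k\<bar>)" by (rule norm_le_l1_cart)
    also have "\<dots> \<le> (\<Sum>k\<in>(UNIV::'m set). e)" using a by (intro sum_mono) (simp add: less_imp_le)
    finally show ?thesis by (simp add: m_def)
  qed
  have "real q * norm (x - y) = norm (real q *\<^sub>R x - rvec a)"
    by (simp add: ya flip: scaleR_diff_right)
  then have qxy: "real q * norm (x - y) \<le> m * e" using n1 by simp
  have me: "m * e \<le> m" using e m by (simp add: mult_left_le)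
  have na: "norm (rvec a) \<le> 2 * real q"
  proof -
    have "norm (rvec a) \<le> norm (real q *\<^sub>R x) + norm (real q *\<^sub>R x - rvec a)"
      by (metis norm_minus_commute norm_triangle_sub)
    also have "norm (real q *\<^sub>R x) \<le> real q * 1" using x by (simp add: mult_left_le)
    finally show ?thesis using n1 me q unfolding m_def by linarith
  qed
  then have "real q * norm y \<le> 2 * real q" by (simp add: ya)
  then have ny: "norm y \<le> 2" using q1 by simp
  have "a j \<noteq> 0"
  proof
    assume "a j = 0"
    then have "\<bar>real q * x $ j\<bar> < e" using a[of j] by simp
    then show False using j e by (simp add: abs_mult)
  qed
  then have a0: "a \<noteq> (\<lambda>_. 0)" by auto
  have "\<bar>f x - f y\<bar> \<le> L * norm (x - y)" using lip x ny by simp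
  then have "real q * \<bar>f x - f y\<bar> \<le> real q * (L * norm (x - y))" by (intro mult_left_mono) auto
  also have "\<dots> = L * (real q * norm (x - y))" by simp
  also have "\<dots> \<le> L * (m * e)" using qxy L by (intro mult_left_mono) auto
  finally have "\<bar>real q * f x - real q * f y\<bar> \<le> L * (m * e)"
    by (simp add: abs_mult flip: right_diff_distrib)
  then have "\<bar>of_int b - real q * f y\<bar> \<le> e + L * (m * e)" using b by linarith
  also have "\<dots> = (1 + L * m) * e" by (simp add: algebra_simps)
  finally have fb: "\<bar>of_int b - real q * f y\<bar> \<le> (1 + L * m) * e" .
  have iq': "2 ^ i \<le> real q" "real q \<le> 2 * 2 ^ i"
  proof -
    have "real (2 ^ i) \<le> real q" "real q \<le> real (2 ^ Suc i)" using iq by (simp_all only: of_nat_le_iff less_imp_le)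
    then show "2 ^ i \<le> real q" "real q \<le> 2 * 2 ^ i" by simp_all
  qed
  have mem: "(int q, a, b) \<in> rational_near f (2 ^ i) ((1 + L * m) * e)"
    using iq' a0 na fb by (simp add: rational_near_def y_def)
  have "norm (x - y) \<le> m * e / real q" using qxy q1 by (simp add: field_simps)
  moreover have "\<bar>f x - of_int b / real q\<bar> \<le> e / real q"
  proof -
    have "f x - of_int b / real q = (real q * f x - of_int b) / real q" using q1 by (simp add: field_simps)
    then have "\<bar>f x - of_int b / real q\<bar> = \<bar>real q * f x - of_int b\<bar> / real q" by (simp add: abs_divide)
    also have "\<dots> \<le> e / real q" using b by (intro divide_right_mono) auto
    finally show ?thesis .
  qed
  moreover have "dist (x, f x) (y, of_int b / real q) \<le> norm (x - y) + \<bar>f x - of_int b / real q\<bar>"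
    unfolding dist_Pair_Pair dist_real_def dist_norm[of x y] by (rule sqrt_sum_squares_le_sum) auto
  ultimately have "dist (x, f x) (y, of_int b / real q) \<le> (m + 1) * e / real q"
    by (simp add: add_divide_distrib distrib_right)
  also have "\<dots> \<le> (m + 1) * e / 2 ^ i" using iq' m e0 q1 by (intro divide_left_mono mult_pos_pos) auto
  finally have "(x, f x) \<in> cball (rvec a /\<^sub>R of_int (int q), of_int b / of_int (int q)) ((m + 1) * e / 2 ^ i)"
    by (simp add: y_def dist_commute)
  with mem show ?thesis unfolding m_def by blast
qed

text \<open>Cauchy condensation. As \<Psi> q / q is non-increasing, the power of \<Psi> q / q at q =
  2^(i+1) is at most that at every q in the block from 2^i to 2^(i+1). The 2^i terms of the block
  account for the extra power of 2^i.\<close>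

lemma summable_condensed:
  fixes \<Psi> :: "nat \<Rightarrow> real"
  assumes pos: "\<And>q. q \<ge> 1 \<Longrightarrow> \<Psi> q > 0" and mono: "\<And>q r. 1 \<le> q \<Longrightarrow> q \<le> r \<Longrightarrow> \<Psi> r \<le> \<Psi> q" and s: "s > 0"
    and sm: "summable (\<lambda>q. (\<Psi> q / real q) powr (s + 1) * real q ^ n)"
  shows "summable (\<lambda>i. (\<Psi> (2 ^ i) / 2 ^ i) powr (s + 1) * (2 ^ i) ^ (n + 1))"
proof -
  define w where "w = (\<lambda>q. (\<Psi> q / real q) powr (s + 1) * real q ^ n)"
  define t where "t = (\<lambda>i. (\<Psi> (2 ^ i) / 2 ^ i) powr (s + 1) * (2 ^ i :: real) ^ (n + 1))"
  have w0: "w q \<ge> 0" for q by (simp add: w_def)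
  have sb: "summable (\<lambda>i. 2 ^ (n + 1) * (\<Sum>q\<in>{2 ^ i..<2 ^ Suc i}. w q))"
    using sm by (intro summable_mult summable_dyadic_blocks w0) (simp add: w_def)
  have "t (Suc i) \<le> 2 ^ (n + 1) * (\<Sum>q\<in>{2 ^ i..<2 ^ Suc i}. w q)" for i
  proof -
    define c where "c = (\<Psi> (2 ^ Suc i) / 2 ^ Suc i) powr (s + 1)"
    have "(\<Sum>q\<in>{2 ^ i..<2 ^ Suc i::nat}. c * (2 ^ i) ^ n) \<le> (\<Sum>q\<in>{2 ^ i..<2 ^ Suc i}. w q)"
    proof (rule sum_mono)
      fix q :: nat assume q: "q \<in> {2 ^ i..<2 ^ Suc i}"
      have "(1::nat) \<le> 2 ^ i" by simp
      then have q1: "q \<ge> 1" using q by (meson atLeastLessThan_iff order_trans)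
      have qr: "real (2 ^ i) \<le> real q" "real q \<le> real (2 ^ Suc i)" using q by (simp_all only: of_nat_le_iff atLeastLessThan_iff less_imp_le)
      have "\<Psi> (2 ^ Suc i) / 2 ^ Suc i \<le> \<Psi> q / real q"
        using mono[OF q1, of "2 ^ Suc i"] pos[OF q1] pos[of "2 ^ Suc i"] q qr q1 by (intro frac_le) auto
      then have "c \<le> (\<Psi> q / real q) powr (s + 1)"
        unfolding c_def using s pos[of "2 ^ Suc i"] by (intro powr_mono2) auto
      then show "c * (2 ^ i) ^ n \<le> w q" unfolding w_def using qr by (intro mult_mono power_mono) auto
    qed
    also have "(\<Sum>q\<in>{2 ^ i..<2 ^ Suc i::nat}. c * (2 ^ i) ^ n) = 2 ^ i * (c * (2 ^ i) ^ n)" by simp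
    finally have "2 ^ (n + 1) * (2 ^ i * (c * (2 ^ i) ^ n)) \<le> 2 ^ (n + 1) * (\<Sum>q\<in>{2 ^ i..<2 ^ Suc i}. w q)"
      by (intro mult_left_mono) auto
    moreover have "t (Suc i) = 2 ^ (n + 1) * (2 ^ i * (c * (2 ^ i) ^ n))"
      by (simp add: t_def c_def power_mult_distrib mult_ac)
    ultimately show ?thesis by simp
  qed
  then have "summable (\<lambda>i. t (Suc i))"
    by (intro summable_comparison_test'[OF sb, of 0]) (simp add: t_def)
  then show ?thesis unfolding summable_Suc_iff by (simp add: t_def)
qed

text \<open>For Q = 2^i there are O(\<Psi> Q^(m+1)) balls of radius O(\<Psi> / Q), where \<Psi> is
  the enlarged \<psi> at Q. The sum of the s-th powers of their diameters is O((\<Psi> / Q)^(s+1)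
  Q^(m+2)), the condensed term of the given series with n = m + 1.\<close>

lemma hausdorff_null_graph:
  fixes f :: "real^'m \<Rightarrow> real"
  assumes m2: "CARD('m) \<ge> 2" and f: "f \<in> homogeneous_nondegenerate d" and d: "1 < d" "d \<le> 2 * real CARD('m)"
    and \<psi>: "approximation_function \<psi>" and s: "s > real CARD('m) / 2"
    and sm: "(\<lambda>q. (\<psi> q / real q) powr (s + 1) * real q ^ (CARD('m) + 1)) summable_on {1..}"
  shows "hausdorff_measure s (simult_approx \<psi> \<inter> {(x, f x) | x. norm x < 1}) = 0"
proof -
  define m where "m = CARD('m)"
  define n where "n = m + 1"
  have m: "m \<ge> 2" using m2 by (simp add: m_def)
  have s0: "s > 0" using s by (smt (verit) divide_nonneg_nonneg of_nat_0_le_iff)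
  \<comment> \<open>The second entry yields \<epsilon> (s + 1) < 2 s - m, which is exactly the
    convergence of the series of q^(n - (2 - \<epsilon>) (s + 1)); so enlarging \<psi> to
    q^-(1-\<epsilon>) keeps the series summable. It is positive by the lower bound on s. The entry
    1/2 makes q^-(1-\<epsilon>) decreasing.\<close>
  define \<epsilon> where "\<epsilon> = min (1 / 2) ((2 * s - real m) / (2 * (s + 1)))"
  have sm0: "2 * s - real m > 0" using s by (simp add: m_def)
  have \<epsilon>: "\<epsilon> > 0" using sm0 s0 by (simp add: \<epsilon>_def)
  have \<epsilon>2: "\<epsilon> \<le> 1 / 2" unfolding \<epsilon>_def by (rule min.cobounded1)
  have "\<epsilon> * (s + 1) \<le> (2 * s - real m) / (2 * (s + 1)) * (s + 1)" using s0 by (intro mult_right_mono) (auto simp: \<epsilon>_def)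
  also have "\<dots> = (2 * s - real m) / 2" using s0 by (simp add: field_simps)
  also have "\<dots> < 2 * s - real m" using sm0 by simp
  finally have \<epsilon>s: "\<epsilon> * (s + 1) < 2 * s - real m" .
  define \<Psi> where "\<Psi> = (\<lambda>q::nat. max (\<psi> q) (real q powr (- (1 - \<epsilon>))))"
  have \<Psi>_pos: "\<Psi> q > 0" if "q \<ge> 1" for q using that by (simp add: \<Psi>_def less_max_iff_disj)
  have \<Psi>_1: "\<Psi> q \<le> 1" if "q \<ge> 1" for q
  proof -
    have "real q powr (- (1 - \<epsilon>)) \<le> 1" using that \<epsilon>2 powr_mono[of "- (1 - \<epsilon>)" 0 "real q"] by simp
    moreover have "\<psi> q < 1 / 2" using \<psi> that by (simp add: approximation_function_def)
    ultimately show ?thesis by (simp add: \<Psi>_def)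
  qed
  have \<Psi>_mono: "\<Psi> r \<le> \<Psi> q" if "1 \<le> q" "q \<le> r" for q r
  proof -
    have "real r powr (- (1 - \<epsilon>)) \<le> real q powr (- (1 - \<epsilon>))" using that \<epsilon>2 by (intro powr_mono2') auto
    moreover have "\<psi> r \<le> \<psi> q" using \<psi> that by (simp add: approximation_function_def)
    ultimately show ?thesis unfolding \<Psi>_def by (rule max.mono[rotated])
  qed
  have sm\<psi>: "summable (\<lambda>q. (\<psi> q / real q) powr (s + 1) * real q ^ n)"
  proof -
    \<comment> \<open>The added index q = 0 contributes 0, because n > 0 makes 0^n vanish.\<close>
    have "(\<lambda>q. (\<psi> q / real q) powr (s + 1) * real q ^ n) summable_on UNIV"
      by (rule summable_on_cong_neutral[THEN iffD1, OF _ _ _ sm[folded m_def n_def]])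
         (auto simp: n_def)
    then show ?thesis by (rule summable_on_imp_summable)
  qed
  have sm\<Psi>: "summable (\<lambda>q. (\<Psi> q / real q) powr (s + 1) * real q ^ n)"
  proof (rule summable_comparison_test'[where N = 1])
    have "real n - (2 - \<epsilon>) * (s + 1) < -1" using \<epsilon>s by (simp add: n_def algebra_simps)
    then have "summable (\<lambda>q. real q powr (real n - (2 - \<epsilon>) * (s + 1)))" by (simp add: summable_real_powr_iff)
    then show "summable (\<lambda>q. (\<psi> q / real q) powr (s + 1) * real q ^ n + real q powr (real n - (2 - \<epsilon>) * (s + 1)))"
      by (intro summable_add sm\<psi>)
    fix q :: nat assume q: "q \<ge> 1"
    have e: "(real q powr (- (1 - \<epsilon>)) / real q) powr (s + 1) * real q ^ n = real q powr (real n - (2 - \<epsilon>) * (s + 1))"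
    proof -
      have "real q powr (- (1 - \<epsilon>)) / real q = real q powr (- (2 - \<epsilon>))"
        using q powr_diff[of "real q" "- (1 - \<epsilon>)" 1] by simp
      moreover have "real q ^ n = real q powr real n" using q by (simp add: powr_realpow)
      ultimately show ?thesis by (simp add: powr_powr powr_add[symmetric] algebra_simps)
    qed
    have "(\<Psi> q / real q) powr (s + 1) * real q ^ n \<le> (\<psi> q / real q) powr (s + 1) * real q ^ n + (real q powr (- (1 - \<epsilon>)) / real q) powr (s + 1) * real q ^ n"
      unfolding \<Psi>_def by (simp add: max_def)
    then show "norm ((\<Psi> q / real q) powr (s + 1) * real q ^ n) \<le> (\<psi> q / real q) powr (s + 1) * real q ^ n + real q powr (real n - (2 - \<epsilon>) * (s + 1))"
      using e by simp
  qed
  obtain L where L: "L \<ge> 0" and lip: "\<And>x y. norm x \<le> 2 \<Longrightarrow> norm y \<le> 2 \<Longrightarrow> \<bar>f x - f y\<bar> \<le> L * norm (x - y)"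
    using homogeneous_lipschitz[OF f d(1)] by blast
  define C1 where "C1 = 1 + L * real m"
  have C1: "C1 \<ge> 1" using L by (simp add: C1_def)
  obtain C where C: "C \<ge> 0" and count': "\<forall>Q D. 1 \<le> Q \<longrightarrow> 0 < D \<longrightarrow> Q powr \<epsilon> \<le> D * Q \<longrightarrow>
     finite (rational_near f Q D) \<and> real (card (rational_near f Q D)) \<le> C * (D * Q * Q ^ m)"
    using rational_near_count[OF f d m2 \<epsilon>] unfolding m_def by blast
  note count = count'[rule_format]
  define W where "W = (\<lambda>i::nat. rational_near f (2 ^ i) (C1 * \<Psi> (2 ^ i)))"
  define r where "r = (\<lambda>i::nat. 2 * ((real m + 1) * \<Psi> (2 ^ i) / 2 ^ i))"
  define V where "V = (\<lambda>i (q, a :: 'm \<Rightarrow> int, b). cball (rvec a /\<^sub>R real_of_int q, real_of_int b / real_of_int q) ((real m + 1) * \<Psi> (2 ^ i) / 2 ^ i))"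
  have W: "finite (W i) \<and> real (card (W i)) \<le> C * (C1 * \<Psi> (2 ^ i) * 2 ^ i * (2 ^ i) ^ m)" for i
    unfolding W_def
  proof (rule count)
    let ?Q = "2 ^ i :: real"
    show "1 \<le> ?Q" "0 < C1 * \<Psi> (2 ^ i)" using C1 \<Psi>_pos[of "2 ^ i"] by auto
    have "?Q powr \<epsilon> = ?Q powr (- (1 - \<epsilon>)) * ?Q" using powr_add[of ?Q "- (1 - \<epsilon>)" 1] by simp
    also have "\<dots> \<le> \<Psi> (2 ^ i) * ?Q" by (intro mult_right_mono) (auto simp: \<Psi>_def)
    also have "\<dots> \<le> C1 * \<Psi> (2 ^ i) * ?Q" using C1 \<Psi>_pos[of "2 ^ i"] by (intro mult_right_mono) auto
    finally show "?Q powr \<epsilon> \<le> C1 * \<Psi> (2 ^ i) * ?Q" .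
  qed
  \<comment> \<open>The exceptional point is the one over the origin. Any other x has a nonzero
    coordinate j, and \<open>q0\<close> below makes q |x j| \<ge> 1, q \<ge> m and i \<ge> i0 at
    once.\<close>
  show ?thesis
  proof (rule hausdorff_null_limsup[OF s0, where W = W and V = V and r = r and ?x0.0 = "(0, f 0)"])
    show "finite (W i)" for i using W by blast
    show "bounded (V i j)" for i j by (cases j) (simp add: V_def)
    show "diameter (V i j) \<le> r i" for i j
    proof (cases j)
      case (fields q a b)
      have "(real m + 1) * \<Psi> (2 ^ i) / 2 ^ i \<ge> 0" using \<Psi>_pos[of "2 ^ i"] by (simp add: less_imp_le)
      then show ?thesis by (simp add: fields V_def r_def)
    qed
    show "r \<longlonglongrightarrow> 0"
    proof (rule tendsto_sandwich)
      show "\<forall>\<^sub>F i in sequentially. 0 \<le> r i" using \<Psi>_pos by (intro always_eventually allI) (simp add: r_def less_imp_le)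
      show "\<forall>\<^sub>F i in sequentially. r i \<le> 2 * (real m + 1) * (1 / 2) ^ i"
      proof (intro always_eventually allI)
        fix i :: nat
        have "(real m + 1) * \<Psi> (2 ^ i) / 2 ^ i \<le> (real m + 1) * 1 / 2 ^ i"
          using \<Psi>_1[of "2 ^ i"] by (intro divide_right_mono mult_left_mono) auto
        then have "r i \<le> 2 * ((real m + 1) * 1 / 2 ^ i)" unfolding r_def by (rule mult_left_mono) simp
        then show "r i \<le> 2 * (real m + 1) * (1 / 2) ^ i" by (simp add: power_one_over)
      qed
      have "(\<lambda>i. 2 * (real m + 1) * (1 / 2) ^ i) \<longlonglongrightarrow> 2 * (real m + 1) * 0"
        by (intro tendsto_mult_left LIMSEQ_realpow_zero) auto
      then show "(\<lambda>i. 2 * (real m + 1) * (1 / 2) ^ i) \<longlonglongrightarrow> 0" by simp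
    qed auto
    show "summable (\<lambda>i. real (card (W i)) * r i powr s)"
    proof (rule summable_comparison_test'[where N = 0])
      show "summable (\<lambda>i. C * C1 * (2 * (real m + 1)) powr s * ((\<Psi> (2 ^ i) / 2 ^ i) powr (s + 1) * (2 ^ i) ^ (n + 1)))"
        by (intro summable_mult summable_condensed[OF \<Psi>_pos \<Psi>_mono s0 sm\<Psi>])
      fix i :: nat
      define u where "u = \<Psi> (2 ^ i) / 2 ^ i"
      have u: "u > 0" using \<Psi>_pos[of "2 ^ i"] by (simp add: u_def)
      have ps: "\<Psi> (2 ^ i) = u * 2 ^ i" by (simp add: u_def)
      have ri: "r i powr s = (2 * (real m + 1)) powr s * u powr s"
        using u by (simp add: r_def ps powr_mult flip: mult.assoc)
      have "real (card (W i)) * r i powr s \<le> C * (C1 * \<Psi> (2 ^ i) * 2 ^ i * (2 ^ i) ^ m) * r i powr s"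
        using W[of i] by (intro mult_right_mono) auto
      also have "\<dots> = C * C1 * (2 * (real m + 1)) powr s * (u powr (s + 1) * (2 ^ i) ^ (n + 1))"
        unfolding ri ps using u by (simp add: n_def powr_add)
      finally show "norm (real (card (W i)) * r i powr s) \<le> C * C1 * (2 * (real m + 1)) powr s * ((\<Psi> (2 ^ i) / 2 ^ i) powr (s + 1) * (2 ^ i) ^ (n + 1))"
        by (simp add: u_def)
    qed
    fix z i0 assume z: "z \<in> simult_approx \<psi> \<inter> {(x, f x) | x. norm x < 1}" and z0: "z \<noteq> (0, f 0)"
    then obtain x where x: "z = (x, f x)" "norm x < 1" by blast
    then have "x \<noteq> 0" using z0 by auto
    then obtain j where j: "x $ j \<noteq> 0" by (auto simp: vec_eq_iff)
    define q0 where "q0 = nat \<lceil>1 / \<bar>x $ j\<bar>\<rceil> + m + 2 ^ i0"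
    have "infinite {q::nat. 1 \<le> q \<and> Max ((\<lambda>b. infdist (real q * (z \<bullet> b)) \<int>) ` Basis) < \<psi> q}"
      using z by (simp add: simult_approx_def)
    then obtain q where q: "q \<ge> q0" "1 \<le> q" and close: "Max ((\<lambda>b. infdist (real q * ((x, f x) \<bullet> b)) \<int>) ` Basis) < \<psi> q"
      unfolding infinite_nat_iff_unbounded_le x(1) by blast
    obtain i where i: "2 ^ i \<le> q" "q < 2 ^ (i + 1)" using ex_power_ivl1[of 2 q] q(2) by auto
    have "2 ^ i0 \<le> q" "m \<le> q" "nat \<lceil>1 / \<bar>x $ j\<bar>\<rceil> \<le> q" using q(1) unfolding q0_def by linarith+
    then have "(2::nat) ^ i0 < 2 ^ (i + 1)" using i by linarith
    then have "i0 < i + 1" by (rule power_less_imp_less_exp[rotated]) simp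
    then have ii: "i0 \<le> i" by simp
    have "1 / \<bar>x $ j\<bar> \<le> real q" using real_nat_ceiling_ge[of "1 / \<bar>x $ j\<bar>"] \<open>nat \<lceil>1 / \<bar>x $ j\<bar>\<rceil> \<le> q\<close> by linarith
    then have qj: "real q * \<bar>x $ j\<bar> \<ge> 1" using j by (simp add: divide_le_eq)
    have "\<psi> q \<le> \<Psi> q" by (simp add: \<Psi>_def)
    also have "\<dots> \<le> \<Psi> (2 ^ i)" using i by (intro \<Psi>_mono) auto
    finally have close': "Max ((\<lambda>b. infdist (real q * ((x, f x) \<bullet> b)) \<int>) ` Basis) < \<Psi> (2 ^ i)" using close by linarith
    have "\<exists>k a b. (k, a, b) \<in> rational_near f (2 ^ i) ((1 + L * real CARD('m)) * \<Psi> (2 ^ i)) \<and>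
       (x, f x) \<in> cball (rvec a /\<^sub>R of_int k, of_int b / of_int k) ((real CARD('m) + 1) * \<Psi> (2 ^ i) / 2 ^ i)"
    proof (rule simult_approx_cover[OF lip L x(2) qj _ _ _ _ close'])
      show "real q \<ge> CARD('m)" using \<open>m \<le> q\<close> by (simp add: m_def)
      show "\<Psi> (2 ^ i) \<le> 1" by (rule \<Psi>_1) simp
      show "2 ^ i \<le> q" "q < 2 ^ Suc i" using i by auto
    qed
    then obtain k a b where "(k, a, b) \<in> W i" "z \<in> V i (k, a, b)"
      unfolding W_def V_def C1_def m_def x(1) by auto
    then have "\<exists>j\<in>W i. z \<in> V i j" by blast
    then show "\<exists>i\<ge>i0. \<exists>j\<in>W i. z \<in> V i j" using ii by blast
  qed
qed

theorem theorem2p6: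
  fixes n :: nat and d s :: real and \<psi> :: "nat \<Rightarrow> real"
    and M :: "((real^'m) \<times> real) set"
  assumes "n \<ge> 3" and "CARD('m) = n - 1"
    and "2 * (real n - 1) / (2 * real n - 3) < d" and "d \<le> 2 * (real n - 1)"
    and "approximation_function \<psi>"
    and "s > (real n - 1) / 2"
    and "M \<in> graph_hypersurfaces (homogeneous_nondegenerate d)"
    and "(\<lambda>q. (\<psi> q / real q) powr (s + 1) * real q ^ n) summable_on {1..}"
  shows "hausdorff_measure s (simult_approx \<psi> \<inter> M) = 0"
proof -
  obtain f where f: "f \<in> homogeneous_nondegenerate d" and M: "M = {(x, f x) | x. norm x < 1}"
    using assms(7) by (auto simp: graph_hypersurfaces_def)
  have m: "real CARD('m) = real n - 1" "CARD('m) + 1 = n" using assms(1,2) by (auto simp: of_nat_diff)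
  \<comment> \<open>As 2 n - 2 > 2 n - 3 > 0, the lower bound gives d > 1, which the Lipschitz
    estimate and the shell condition h \<le> l use.\<close>
  have "1 < 2 * (real n - 1) / (2 * real n - 3)" using assms(1) by (simp add: less_divide_eq)
  then have "1 < d" using assms(3) by linarith
  then show ?thesis unfolding M
    using assms(1,2,4-6,8) f m by (intro hausdorff_null_graph) auto
qed

end
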